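(* Let $\alpha>0$, $0<\beta\le 1$, $N\in\mathbb N$, and let $\tilde A^\alpha_h=\sum_{j=0}^N b_jA^\alpha_{c_jh,p_j}$ be an $N+1$ order Grünwald approximation. Then there exists $C>0$ such that $f\in X_{\alpha+N+\beta}(\mathbb R)$ implies $$\left\|\tilde A_h^\alpha f-f^{(\alpha)}\right\|_{L_1(\mathbb R)}\le Ch^{N+\beta}\|f\|_{\alpha+N+\beta}$$ as $h\to0^+$ (i.e. for all sufficiently small $h>0$). If moreover $p_j\le 0$ for all $0\le j\le N$, and $f\in X_{\alpha+N+\beta}(\mathbb R_+)$, then $$\left\|\tilde A_h^\alpha f-f^{(\alpha)}\right\|_{L_1(\mathbb R_+)}\le Ch^{N+\beta}\|f\|_{\alpha+N+\beta}$$ as $h\to 0^+$.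
   Context: $\mathbb N$ includes $0$. All complex powers are principal (branch cut along the negative real axis). $\hat f(k)=\int_{-\infty}^\infty e^{ikx}f(x)\,dx$ for $f\in L_1(\mathbb R)$. For $\gamma>0$: $X_\gamma(\mathbb R)=\{f\in L_1(\mathbb R):\exists g\in L_1(\mathbb R),\ \hat g(k)=(-ik)^\gamma\hat f(k),\ k\in\mathbb R\}$; for such $f$ put $f^{(\gamma)}:=g$ (Riemann–Liouville fractional derivative) and $\|f\|_\gamma:=\|f^{(\gamma)}\|_{L_1(\mathbb R)}$. Similarly $X_\gamma(\mathbb R_+)=\{f\in L_1(\mathbb R_+):\exists g\in L_1(\mathbb R_+),\ \hat g(z)=(-z)^\gamma\hat f(z),\ \operatorname{Re}z\le0\}$ with $\hat f(z)=\int_0^\infty e^{zt}f(t)\,dt$, and then $f^{(\gamma)}:=g$, $\|f\|_\gamma:=\|f^{(\gamma)}\|_{L_1(\mathbb R_+)}$. For $h>0$, $p\in\mathbb R$ the shifted Grünwald operator is $$A^\alpha_{h,p}f(x)=\frac{1}{\Gamma(-\alpha)}\frac1{h^\alpha}\sum_{m=0}^\infty\frac{\Gamma(m-\alpha)}{\Gamma(m+1)}f(x-(m-p)h),$$ where $\frac{\Gamma(m-\alpha)}{\Gamma(-\alpha)\Gamma(m+1)}=(-1)^m\binom{\alpha}{m}$ (the latter expression is used if $\alpha$ is an integer). Functions in $L_1(\mathbb R_+)$ are extended by $0$ to $x<0$; if $p\le0$ then $A^\alpha_{h,p}$ acts on $L_1(\mathbb R_+)$. Let $\omega_{p,\alpha}(z)=\left(\frac{1-e^{-z}}{z}\right)^\alpha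 e^{zp}$, which is analytic near $z=0$ with $\omega_{p,\alpha}(0)=1$. Let $b_j,p_j\in\mathbb R$, $c_j>0$ $(0\le j\le N)$ be such that there exist $d_j$ with $$\sum_{j=0}^{N} b_j \omega_{p_j,\alpha}(c_jz)-1=\sum_{j=N+1}^\infty d_j z^j$$ for all $z$ in a neighbourhood of $0$. Then $\tilde A^\alpha_hf:=\sum_{j=0}^{N} b_j A_{c_jh,p_j}^\alpha f$ is called an $N+1$ order Grünwald approximation. *)

theory Defs
  imports "HOL-Analysis.Analysis"
begin

text \<open>
  Elements of \<open>L\<^sub>1(\<real>)\<close> and \<open>L\<^sub>1(\<real>\<^sub>+)\<close> are represented by complex-valued functions on the real line
  that are integrable over \<open>S = UNIV\<close> or \<open>S = {0..}\<close>; values outside \<open>S\<close> are irrelevant. The norm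
  takes values in \<open>ennreal\<close>, so that it is infinite, rather than 0 by convention, on (measurable)
  functions that are not integrable.
\<close>

definition L1 :: "real set \<Rightarrow> (real \<Rightarrow> complex) set" where
  "L1 S = {f. set_integrable lborel S f}"

definition L1_norm :: "real set \<Rightarrow> (real \<Rightarrow> complex) \<Rightarrow> ennreal" where
  "L1_norm S f = (\<integral>\<^sup>+x\<in>S. ennreal (norm (f x)) \<partial>lborel)"

definition fourier :: "(real \<Rightarrow> complex) \<Rightarrow> real \<Rightarrow> complex" where
  "fourier f k = (LINT x|lborel. exp (\<i> * of_real k * of_real x) * f x)"

definition laplace :: "(real \<Rightarrow> complex) \<Rightarrow> complex \<Rightarrow> complex" where
  "laplace f z = (LINT t:{0..}|lborel. exp (z * of_real t) * f t)"

text \<open>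
  A fractional derivative of \<open>f\<close> is determined only up to a null set, by injectivity of the
  transforms. The operators \<open>frac_deriv\<close> and \<open>frac_deriv_half\<close> below pick a representative; they
  are meaningful only on \<open>frac_space \<gamma>\<close> and \<open>frac_space_half \<gamma>\<close>, respectively.
\<close>

definition is_frac_deriv :: "real \<Rightarrow> (real \<Rightarrow> complex) \<Rightarrow> (real \<Rightarrow> complex) \<Rightarrow> bool" where
  "is_frac_deriv \<gamma> f g \<longleftrightarrow> g \<in> L1 UNIV \<and>
     (\<forall>k. fourier g k = (- \<i> * of_real k) powr of_real \<gamma> * fourier f k)"

definition frac_space :: "real \<Rightarrow> (real \<Rightarrow> complex) set" where
  "frac_space \<gamma> = {f \<in> L1 UNIV. \<exists>g. is_frac_deriv \<gamma> f g}"

definition frac_deriv :: "real \<Rightarrow> (real \<Rightarrow> complex) \<Rightarrow> real \<Rightarrow> complex" where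
  "frac_deriv \<gamma> f = (SOME g. is_frac_deriv \<gamma> f g)"

definition frac_norm :: "real \<Rightarrow> (real \<Rightarrow> complex) \<Rightarrow> ennreal" where
  "frac_norm \<gamma> f = L1_norm UNIV (frac_deriv \<gamma> f)"

definition is_frac_deriv_half :: "real \<Rightarrow> (real \<Rightarrow> complex) \<Rightarrow> (real \<Rightarrow> complex) \<Rightarrow> bool" where
  "is_frac_deriv_half \<gamma> f g \<longleftrightarrow> g \<in> L1 {0..} \<and>
     (\<forall>z. Re z \<le> 0 \<longrightarrow> laplace g z = (- z) powr of_real \<gamma> * laplace f z)"

definition frac_space_half :: "real \<Rightarrow> (real \<Rightarrow> complex) set" where
  "frac_space_half \<gamma> = {f \<in> L1 {0..}. \<exists>g. is_frac_deriv_half \<gamma> f g}"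

definition frac_deriv_half :: "real \<Rightarrow> (real \<Rightarrow> complex) \<Rightarrow> real \<Rightarrow> complex" where
  "frac_deriv_half \<gamma> f = (SOME g. is_frac_deriv_half \<gamma> f g)"

definition frac_norm_half :: "real \<Rightarrow> (real \<Rightarrow> complex) \<Rightarrow> ennreal" where
  "frac_norm_half \<gamma> f = L1_norm {0..} (frac_deriv_half \<gamma> f)"

definition zero_ext :: "(real \<Rightarrow> complex) \<Rightarrow> real \<Rightarrow> complex" where
  "zero_ext f x = (if x < 0 then 0 else f x)"

definition grunwald_coeff :: "real \<Rightarrow> nat \<Rightarrow> real" where
  "grunwald_coeff \<alpha> m =
     (if \<alpha> \<in> \<int> then (-1) ^ m * (\<alpha> gchoose m)
      else Gamma (real m - \<alpha>) / (Gamma (- \<alpha>) * Gamma (real m + 1)))"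

lemma grunwald_coeff_gbinomial: "grunwald_coeff \<alpha> m = (-1) ^ m * (\<alpha> gchoose m)"
proof (cases "\<alpha> \<in> \<int>")
  case False
  then have "- \<alpha> \<notin> \<int>\<^sub>\<le>\<^sub>0"
    using minus_in_Ints_iff nonpos_Ints_Int by blast
  then have "pochhammer (- \<alpha>) m = Gamma (real m - \<alpha>) / Gamma (- \<alpha>)"
    by (simp add: pochhammer_Gamma)
  moreover have "Gamma (real m + 1) = fact m"
    using Gamma_fact[of m, where 'a = real] by (simp add: add.commute)
  ultimately show ?thesis
    using False
    by (simp add: grunwald_coeff_def gbinomial_pochhammer flip: power_mult_distrib mult.assoc)
qed (simp add: grunwald_coeff_def)

text \<open>
  The coefficients are absolutely summable for \<open>\<alpha> > 0\<close>, so for integrable \<open>f\<close> the series below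
  converges absolutely for almost every \<open>x\<close>, and its pointwise sum is the sum in \<open>L\<^sub>1\<close>.
\<close>

definition grunwald :: "real \<Rightarrow> real \<Rightarrow> real \<Rightarrow> (real \<Rightarrow> complex) \<Rightarrow> real \<Rightarrow> complex" where
  "grunwald \<alpha> h p f x =
     (1 / h powr \<alpha>) *\<^sub>R (\<Sum>m. grunwald_coeff \<alpha> m *\<^sub>R f (x - (real m - p) * h))"

definition grunwald_comb ::
  "real \<Rightarrow> nat \<Rightarrow> (nat \<Rightarrow> real) \<Rightarrow> (nat \<Rightarrow> real) \<Rightarrow> (nat \<Rightarrow> real) \<Rightarrow>
     real \<Rightarrow> (real \<Rightarrow> complex) \<Rightarrow> real \<Rightarrow> complex" where
  "grunwald_comb \<alpha> N b c p h f x = (\<Sum>j\<le>N. b j *\<^sub>R grunwald \<alpha> (c j * h) (p j) f x)"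

text \<open>The value at 0 fills the removable singularity.\<close>

definition omega :: "real \<Rightarrow> real \<Rightarrow> complex \<Rightarrow> complex" where
  "omega p \<alpha> z =
     (if z = 0 then 1 else ((1 - exp (- z)) / z) powr of_real \<alpha> * exp (z * of_real p))"

text \<open>The combination above is a Gruenwald approximation of order \<open>N + 1\<close>.\<close>

definition grunwald_approx ::
  "real \<Rightarrow> nat \<Rightarrow> (nat \<Rightarrow> real) \<Rightarrow> (nat \<Rightarrow> real) \<Rightarrow> (nat \<Rightarrow> real) \<Rightarrow> bool" where
  "grunwald_approx \<alpha> N b c p \<longleftrightarrow>
     (\<forall>j\<le>N. c j > 0) \<and>
     (\<exists>d :: nat \<Rightarrow> complex. \<forall>\<^sub>F z in nhds 0.
        (\<lambda>j. d (N + 1 + j) * z ^ (N + 1 + j)) sums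
          ((\<Sum>j\<le>N. of_real (b j) * omega (p j) \<alpha> (of_real (c j) * z)) - 1))"

end

theory Submission
  imports Defs "HOL-Probability.Levy" "HOL-Real_Asymp.Real_Asymp"
begin

text \<open>
  Let \<open>z\<close> stand for \<open>- \<i> k\<close> on the line and for minus the Laplace variable on the half-line. With
  \<open>T f z = \<integral> exp (- z t) f t dt\<close>, where \<open>Re z \<ge> 0\<close>, a fractional derivative of order \<open>\<gamma>\<close> multiplies
  \<open>T f\<close> by \<open>z\<^sup>\<gamma>\<close>, and the Gruenwald combination with step \<open>h\<close> multiplies it by \<open>(W (h z) + 1) z\<^sup>\<alpha>\<close>
  where \<open>W z = (\<Sum>j. b\<^sub>j \<omega>\<^sub>j (c\<^sub>j z)) - 1\<close>. If \<open>g\<close> is the derivative of order \<open>\<alpha> + N + \<beta>\<close> of \<open>f\<close>, the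
  error therefore has the transform \<open>h\<^sup>N\<^sup>+\<^sup>\<beta> \<zeta> (h z) T g z\<close> with \<open>\<zeta> z = W z / z\<^sup>N\<^sup>+\<^sup>\<beta>\<close>. Hence everything
  rests on \<open>\<zeta>\<close> being the symbol of a bounded operator on \<open>L\<^sub>1\<close> (\<open>multiplier_grunwald_error\<close>): such
  operators may be dilated without changing their norm, so one constant serves all \<open>h\<close>. The same
  operator also produces the derivative of order \<open>\<alpha>\<close>, namely as the Gruenwald combination minus the
  error; by injectivity of the Fourier transform it agrees almost everywhere with any other choice.

  Symbols of bounded operators form an algebra that is closed under absolutely convergent series.
  It contains \<open>exp (- a z)\<close> (translations, with \<open>a \<ge> 0\<close> on the half-line) and \<open>(1 + z)\<^sup>-\<^sup>s\<close> (convolution with a Gamma density), and,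
  by the binomial series, \<open>(1 - W)\<^sup>s\<close> for every symbol \<open>W\<close> of norm at most \<open>1\<close>; in this way
  \<open>(z / (1 + z))\<^sup>s\<close> and \<open>(1 - exp (- z))\<^sup>s\<close> are obtained. All these operators respect supports in
  \<open>[0, \<infinity>)\<close>, so that a single argument covers the line and the half-line.

  The difficulty is that \<open>u\<^sup>\<alpha>\<close>, where \<open>u z = (1 - exp (- z)) / z\<close>, is the transform of a fractional
  spline whose tail of order \<open>t\<^sup>-\<^sup>1\<^sup>-\<^sup>\<alpha>\<close> has few moments, although \<open>u\<^sup>\<alpha>\<close> is analytic at \<open>0\<close> and \<open>W\<close> must be
  divided by a high power of \<open>z\<close> there. Let \<open>P\<close> be the Taylor polynomial at \<open>1\<close> of degree less than \<open>D\<close> of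
  the power function. Then \<open>P (u z)\<close> is the transform of a compactly supported measure; if it replaces
  \<open>u\<^sup>\<alpha>\<close> in \<open>W\<close>, then \<open>W\<close> still vanishes to order \<open>N + 1\<close> at \<open>0\<close>, which now means vanishing moments, and
  division by \<open>z\<^sup>N\<^sup>+\<^sup>1\<close> is harmless (\<open>multiplier_divide_zero\<close>). For the remainder \<open>e = u\<^sup>\<alpha> - P (u)\<close> one uses
  the refinement equation \<open>u (2 z) = v z * u z\<close> with \<open>v z = (1 + exp (- z)) / 2\<close>. Since \<open>1 - v\<close> has norm at
  most \<open>1\<close>, the power \<open>v\<^sup>\<alpha>\<close> is an absolutely convergent series in \<open>1 - v\<close>, and it follows that
  \<open>r z = e (2 z) - v\<^sup>\<alpha> e z\<close> is divisible by \<open>z\<^sup>D\<close>. Telescoping over the scales \<open>z / 2\<^sup>i\<close> writes \<open>e / z\<^sup>D\<close> as a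
  series whose terms are bounded by a geometric sequence with ratio \<open>\<parallel>v\<^sup>\<alpha>\<parallel> / 2\<^sup>D\<close>, which is less than \<open>1\<close> for large
  \<open>D\<close> (\<open>multiplier_spline_defect_divide_power\<close>). This controls \<open>e / z\<^sup>N\<^sup>+\<^sup>\<beta>\<close> at low frequencies; at high
  frequencies the two parts of \<open>e\<close> are controlled separately (\<open>multiplier_spline_defect\<close>).
\<close>

section \<open>Binomial series on the closed unit disc\<close>

lemma grunwald_coeff_bigo: "(\<lambda>n. grunwald_coeff a n) \<in> O(\<lambda>n. real n powr (- a - 1))"
proof -
  have "(\<lambda>n. (a gchoose n) / ((-1)^n / exp ((a+1) * ln (real n)))) \<longlonglongrightarrow> inverse (Gamma (- a))"
    using gbinomial_asymptotic[of a] by simp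
  then have "(\<lambda>n. (a gchoose n) / ((-1)^n / exp ((a+1) * ln (real n)))) \<in> O(\<lambda>n. 1)"
    by (intro bigoI_tendsto[where c = "inverse (Gamma (- a))"]) simp_all
  then have "(\<lambda>n. (a gchoose n) / ((-1)^n / exp ((a+1) * ln (real n))) * (1 / exp ((a+1) * ln (real n))))
     \<in> O(\<lambda>n. 1 * (1 / exp ((a+1) * ln (real n))))"
    by (rule landau_o.big.mult) simp
  also have "(\<lambda>n. 1 * (1 / exp ((a+1) * ln (real n)))) \<in> \<Theta>(\<lambda>n. real n powr (- a - 1))"
    by (intro bigthetaI_cong eventually_mono[OF eventually_gt_at_top[of "0::nat"]])
       (simp add: powr_def exp_minus[symmetric] algebra_simps flip: inverse_eq_divide)
  also have "(\<lambda>n. (a gchoose n) / ((-1)^n / exp ((a+1) * ln (real n))) * (1 / exp ((a+1) * ln (real n))))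
     = (\<lambda>n. grunwald_coeff a n)"
    by (auto simp: grunwald_coeff_gbinomial fun_eq_iff field_simps minus_one_power_iff)
  finally show ?thesis .
qed

lemma summable_abs_grunwald_coeff:
  assumes "a > 0"
  shows "summable (\<lambda>n. \<bar>grunwald_coeff a n\<bar>)"
proof (rule summable_comparison_test_bigo)
  show "summable (\<lambda>n. norm (real n powr (- a - 1)))"
    using assms by (simp add: summable_real_powr_iff)
  show "(\<lambda>n. \<bar>grunwald_coeff a n\<bar>) \<in> O(\<lambda>n. real n powr (- a - 1))"
    using grunwald_coeff_bigo[of a] by simp
qed

lemma powr_of_real_tendsto_0:
  fixes f :: "'b \<Rightarrow> complex"
  assumes "a > 0" "(f \<longlongrightarrow> 0) F"
  shows "((\<lambda>x. f x powr of_real a) \<longlongrightarrow> 0) F"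
proof -
  have "((\<lambda>x. norm (f x) powr a) \<longlongrightarrow> 0 powr a) F"
    using assms by (intro tendsto_powr' tendsto_norm_zero tendsto_const) auto
  moreover have "norm (f x) powr a = norm (f x powr of_real a)" for x
    by (simp add: norm_powr_real_powr')
  ultimately show ?thesis
    using assms by (simp add: tendsto_norm_zero_iff)
qed

text \<open>
  On the open disc this is the binomial series. By absolute summability both sides extend continuously
  along the radius through \<open>y\<close>; at \<open>y = 1\<close> the right-hand side tends to \<open>0 = 0 powr a\<close>. The boundary
  is needed because \<open>y = exp (- z)\<close> has modulus \<open>1\<close> on the imaginary axis.
\<close>

lemma grunwald_coeff_sums:
  fixes y :: complex
  assumes a: "a > 0" and y: "norm y \<le> 1"
  shows "(\<lambda>m. of_real (grunwald_coeff a m) * y ^ m) sums ((1 - y) powr of_real a)"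
proof -
  let ?S = "\<lambda>y::complex. (\<Sum>m. of_real (grunwald_coeff a m) * y ^ m)"
  have bd: "norm (of_real (grunwald_coeff a m) * y ^ m) \<le> \<bar>grunwald_coeff a m\<bar>" if "norm y \<le> 1" for m and y :: complex
    using that by (simp add: norm_mult norm_power mult_left_le power_le_one)
  have sm: "summable (\<lambda>m. of_real (grunwald_coeff a m) * y ^ m)" if "norm y \<le> 1" for y :: complex
    by (rule summable_comparison_test'[OF summable_abs_grunwald_coeff[OF a], of 0]) (use bd that in auto)
  have inner: "?S w = (1 - w) powr of_real a" if "norm w < 1" for w
  proof -
    have "(\<lambda>n. (of_real a gchoose n) * (- w)^n) sums (1 - w) powr of_real a"
      using gen_binomial_complex[of "- w" "of_real a"] that by simp
    moreover have "(of_real a gchoose n) * (- w)^n = of_real (grunwald_coeff a n) * w ^ n" for n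
      using power_minus[of w n]
      by (simp add: grunwald_coeff_gbinomial gbinomial_prod_rev mult_ac power_minus[of w n])
    ultimately show ?thesis by (simp add: sums_iff)
  qed
  have cont: "continuous_on (cball 0 1) ?S"
  proof (rule uniform_limit_theorem)
    show "uniform_limit (cball 0 1) (\<lambda>n y. \<Sum>m<n. of_real (grunwald_coeff a m) * y ^ m) ?S sequentially"
      by (rule Weierstrass_m_test[OF _ summable_abs_grunwald_coeff[OF a]]) (use bd in auto)
  qed (auto intro!: always_eventually continuous_intros)
  have lim: "((\<lambda>r. complex_of_real r * y) \<longlongrightarrow> of_real 1 * y) (at_left 1)"
    by (intro tendsto_intros)
  have ev: "\<forall>\<^sub>F r in at_left (1::real). 0 < r \<and> r < 1"
    by (auto simp: eventually_at_left[of "0"] intro!: exI[of _ "0::real"])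
  have "((\<lambda>r. ?S (of_real r * y)) \<longlongrightarrow> ?S y) (at_left 1)"
  proof (rule continuous_on_tendsto_compose[OF cont])
    show "((\<lambda>r. complex_of_real r * y) \<longlongrightarrow> y) (at_left 1)" using lim by simp
    show "\<forall>\<^sub>F r in at_left 1. complex_of_real r * y \<in> cball 0 1"
      using ev by eventually_elim (use y in \<open>auto simp: norm_mult intro: mult_le_one\<close>)
  qed (use y in auto)
  moreover have "\<forall>\<^sub>F r in at_left 1. ?S (of_real r * y) = (1 - of_real r * y) powr of_real a"
    using ev
  proof eventually_elim
    case (elim r)
    have "norm (of_real r * y) \<le> r" using elim y by (simp add: norm_mult mult_left_le)
    then show ?case using elim by (intro inner) auto
  qed
  ultimately have "((\<lambda>r. (1 - of_real r * y) powr of_real a) \<longlongrightarrow> ?S y) (at_left 1)"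
    using tendsto_cong by force
  moreover have "((\<lambda>r. (1 - of_real r * y) powr of_real a) \<longlongrightarrow> (1 - y) powr of_real a) (at_left (1::real))"
  proof (cases "y = 1")
    case True
    have "((\<lambda>r. 1 - complex_of_real r * y) \<longlongrightarrow> 0) (at_left (1::real))"
      using tendsto_diff[OF tendsto_const[of 1] lim] True by simp
    from powr_of_real_tendsto_0[OF a this] show ?thesis using True a by simp
  next
    case False
    have "Re y < 1"
    proof (rule ccontr)
      assume "\<not> Re y < 1"
      moreover have "Re y \<le> 1" using complex_Re_le_cmod[of y] y by linarith
      ultimately have "Re y = 1" by simp
      moreover have "Im y = 0"
        using y cmod_power2[of y] \<open>Re y = 1\<close> power_mono[of "norm y" 1 2] by simp
      ultimately show False using False by (simp add: complex_eq_iff)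
    qed
    then have "1 - y \<notin> \<real>\<^sub>\<le>\<^sub>0" by (auto simp: complex_nonpos_Reals_iff)
    then show ?thesis using lim by (intro tendsto_intros) auto
  qed
  ultimately have "?S y = (1 - y) powr of_real a"
    by (rule tendsto_unique[rotated]) auto
  then show ?thesis using sm[OF y] by (metis sums_iff)
qed

section \<open>Principal powers in the right half-plane\<close>

text \<open>
  The arguments of the two factors add up to less than \<open>\<pi>\<close> in modulus, so no branch cut is crossed.
  One of the half-planes has to be open: for two negative imaginary numbers the arguments add up to \<open>- \<pi>\<close>,
  which is not a principal argument.
\<close>

lemma powr_mult_halfplane:
  fixes w z a :: complex
  assumes "0 < Re w" "0 \<le> Re z"
  shows "(w * z) powr a = w powr a * z powr a"
proof (cases "z = 0")
  case False
  have w: "w \<noteq> 0" using assms by auto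
  have "\<bar>Im (Ln w)\<bar> < pi / 2" "\<bar>Im (Ln z)\<bar> \<le> pi / 2"
    using Re_Ln_pos_lt[OF w] Re_Ln_pos_le[OF False] assms by auto
  then have "Ln (w * z) = Ln w + Ln z"
    using w False by (intro Ln_times_simple) linarith+
  then show ?thesis using w False by (simp add: powr_def distrib_left exp_add)
qed simp

lemma powr_inverse_halfplane:
  fixes z a :: complex
  assumes "0 \<le> Re z"
  shows "(inverse z) powr a = z powr (- a)"
proof (cases "z = 0")
  case False
  then have "z \<notin> \<real>\<^sub>\<le>\<^sub>0" using assms by (auto simp: complex_nonpos_Reals_iff complex_eq_iff)
  then have "Ln (inverse z) = - Ln z" by (rule Ln_inverse)
  then show ?thesis using False by (simp add: powr_def)
qed simp

lemma powr_divide_halfplane: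
  fixes w z a :: complex
  assumes "0 < Re w" "0 \<le> Re z"
  shows "(w / z) powr a = w powr a * z powr (- a)" "(z / w) powr a = z powr a * w powr (- a)"
proof -
  have 1: "Re (inverse z) \<ge> 0" "Re (inverse w) > 0"
    using assms by (auto simp: complex_is_Real_iff intro!: divide_nonneg_nonneg divide_pos_pos add_pos_nonneg)
  show "(w / z) powr a = w powr a * z powr (- a)"
    unfolding divide_inverse using 1 assms by (simp add: powr_mult_halfplane powr_inverse_halfplane)
  show "(z / w) powr a = z powr a * w powr (- a)"
    using powr_mult_halfplane[of "inverse w" z a] 1 assms
    by (simp add: divide_inverse mult.commute powr_inverse_halfplane)
qed

section \<open>Injectivity of the Fourier transform on integrable functions\<close>

lemma integrable_mult_exp_imaginary:
  fixes u :: "real \<Rightarrow> complex"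
  assumes "integrable lborel u"
  shows "integrable lborel (\<lambda>x. exp (\<i> * of_real k * of_real x) * u x)"
proof (rule Bochner_Integration.integrable_bound[OF assms])
  show "(\<lambda>x. exp (\<i> * of_real k * of_real x) * u x) \<in> borel_measurable lborel"
    using borel_measurable_integrable[OF assms] by measurable
  show "AE x in lborel. norm (exp (\<i> * of_real k * of_real x) * u x) \<le> norm (u x)"
    by (simp add: norm_mult)
qed

text \<open>
  Normalised by their common integral, \<open>P\<close> and \<open>N\<close> are probability densities with the same
  characteristic function, and Levy's uniqueness theorem applies.
\<close>

lemma real_density_unique_of_char:
  fixes P N :: "real \<Rightarrow> real"
  assumes P: "integrable lborel P" "\<And>x. 0 \<le> P x" and N: "integrable lborel N" "\<And>x. 0 \<le> N x"
    and eq: "\<And>k. (LINT x|lborel. exp (\<i> * of_real k * of_real x) * of_real (P x)) =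
       (LINT x|lborel. exp (\<i> * of_real k * of_real x) * of_real (N x))"
  shows "AE x in lborel. P x = N x"
proof -
  note [measurable] = borel_measurable_integrable[OF P(1)] borel_measurable_integrable[OF N(1)]
  define c where "c = (LINT x|lborel. P x)"
  have c': "(LINT x|lborel. N x) = c"
    using eq[of 0] by (simp add: c_def)
  show ?thesis
  proof (cases "c = 0")
    case True
    have "AE x in lborel. P x = 0"
      using integral_nonneg_eq_0_iff_AE[OF P(1)] P(2) True c_def by simp
    moreover have "AE x in lborel. N x = 0"
      using integral_nonneg_eq_0_iff_AE[OF N(1)] N(2) True c' by simp
    ultimately show ?thesis by eventually_elim simp
  next
    case False
    then have c: "c > 0"
      using P(2) by (simp add: c_def less_le)
    have rd: "real_distribution (density lborel (\<lambda>x. ennreal (F x / c)))"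
      if F: "integrable lborel F" "\<And>x. 0 \<le> F x" "(LINT x|lborel. F x) = c" for F
    proof -
      note [measurable] = borel_measurable_integrable[OF F(1)]
      have "(\<integral>\<^sup>+x. ennreal (F x / c) \<partial>lborel) = ennreal (LINT x|lborel. F x / c)"
        using F c by (intro nn_integral_eq_integral) auto
      also have "(LINT x|lborel. F x / c) = 1" using F(3) c by simp
      finally have "prob_space (density lborel (\<lambda>x. ennreal (F x / c)))"
        by (intro prob_spaceI) (simp add: emeasure_density)
      then show ?thesis
        by (simp add: real_distribution_def real_distribution_axioms_def)
    qed
    have ch: "char (density lborel (\<lambda>x. ennreal (F x / c))) t =
        (LINT x|lborel. exp (\<i> * of_real t * of_real x) * of_real (F x)) / of_real c"
      if F: "integrable lborel F" "\<And>x. 0 \<le> F x" for F t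
    proof -
      note [measurable] = borel_measurable_integrable[OF F(1)]
      have "char (density lborel (\<lambda>x. ennreal (F x / c))) t =
         (LINT x|lborel. (F x / c) *\<^sub>R exp (\<i> * of_real (t * x)))"
        unfolding char_def using F c by (subst integral_density) auto
      also have "\<dots> = (LINT x|lborel. exp (\<i> * of_real t * of_real x) * of_real (F x) / of_real c)"
        by (intro Bochner_Integration.integral_cong) (auto simp: scaleR_conv_of_real mult_ac)
      finally show ?thesis by simp
    qed
    have "density lborel (\<lambda>x. ennreal (P x / c)) = density lborel (\<lambda>x. ennreal (N x / c))"
      by (rule Levy_uniqueness[OF rd[OF P c_def[symmetric]] rd[OF N c']])
         (auto simp: fun_eq_iff ch[OF P] ch[OF N] eq)
    then have "AE x in lborel. ennreal (P x / c) = ennreal (N x / c)"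
      by (intro sigma_finite_measure.density_unique[OF sigma_finite_lborel]) auto
    then show ?thesis
      by (rule AE_mp) (use c P(2) N(2) in \<open>auto simp: ennreal_inj divide_simps\<close>)
  qed
qed

lemma real_eq_0_of_fourier:
  fixes u :: "real \<Rightarrow> real"
  assumes u: "integrable lborel u" and z: "\<And>k. fourier (\<lambda>x. of_real (u x)) k = 0"
  shows "AE x in lborel. u x = 0"
proof -
  have "AE x in lborel. max 0 (u x) = max 0 (- u x)"
  proof (rule real_density_unique_of_char)
    fix k
    have 1: "integrable lborel (\<lambda>x. exp (\<i> * of_real k * of_real x) * complex_of_real (max 0 (u x)))"
      and 2: "integrable lborel (\<lambda>x. exp (\<i> * of_real k * of_real x) * complex_of_real (max 0 (- u x)))"
      using u by (auto intro!: integrable_mult_exp_imaginary)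
    have "(LINT x|lborel. exp (\<i> * of_real k * of_real x) * complex_of_real (max 0 (u x))) -
       (LINT x|lborel. exp (\<i> * of_real k * of_real x) * complex_of_real (max 0 (- u x))) =
       fourier (\<lambda>x. of_real (u x)) k"
      unfolding fourier_def Bochner_Integration.integral_diff[OF 1 2, symmetric]
      by (intro Bochner_Integration.integral_cong) (auto simp: max_def)
    then show "(LINT x|lborel. exp (\<i> * of_real k * of_real x) * complex_of_real (max 0 (u x))) =
       (LINT x|lborel. exp (\<i> * of_real k * of_real x) * complex_of_real (max 0 (- u x)))"
      using z by simp
  qed (use u in auto)
  then show ?thesis by eventually_elim (auto simp: max_def split: if_splits)
qed

theorem fourier_injective:
  assumes g: "integrable lborel g" and z: "\<And>k. fourier g k = 0"
  shows "AE x in lborel. g x = 0"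
proof -
  let ?R = "\<lambda>x. complex_of_real (Re (g x))" and ?I = "\<lambda>x. complex_of_real (Im (g x))"
  have R: "integrable lborel ?R" and I: "integrable lborel ?I" using g by auto
  have cn: "integrable lborel (\<lambda>x. cnj (g x))" using g by simp
  have cnj0: "fourier (\<lambda>x. cnj (g x)) k = 0" for k
  proof -
    have "fourier (\<lambda>x. cnj (g x)) k = cnj (fourier g (- k))"
      unfolding fourier_def
      by (subst Bochner_Integration.integral_cnj[symmetric], intro Bochner_Integration.integral_cong)
         (auto simp: exp_cnj)
    then show ?thesis using z by simp
  qed
  have lin: "fourier (\<lambda>x. a * g x + b * cnj (g x)) k = 0" for a b k
  proof -
    note 1 = integrable_mult_exp_imaginary[OF g, of k] and 2 = integrable_mult_exp_imaginary[OF cn, of k]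
    have "fourier (\<lambda>x. a * g x + b * cnj (g x)) k =
      (LINT x|lborel. a * (exp (\<i> * of_real k * of_real x) * g x) + b * (exp (\<i> * of_real k * of_real x) * cnj (g x)))"
      unfolding fourier_def by (intro Bochner_Integration.integral_cong) (auto simp: algebra_simps)
    also have "\<dots> = a * fourier g k + b * fourier (\<lambda>x. cnj (g x)) k"
      unfolding fourier_def using 1 2 by simp
    finally show ?thesis using z cnj0 by simp
  qed
  have "?R x = (1/2) * g x + (1/2) * cnj (g x)" for x
    by (simp add: complex_eq_iff)
  with lin[of "1/2" "1/2"] have 1: "fourier ?R k = 0" for k by presburger
  have "?I x = (- \<i>/2) * g x + (\<i>/2) * cnj (g x)" for x
    by (simp add: complex_eq_iff)
  with lin[of "- \<i>/2" "\<i>/2"] have 2: "fourier ?I k = 0" for k by presburger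
  have "AE x in lborel. Re (g x) = 0" "AE x in lborel. Im (g x) = 0"
    using real_eq_0_of_fourier[of "\<lambda>x. Re (g x)"] real_eq_0_of_fourier[of "\<lambda>x. Im (g x)"] 1 2 g by auto
  then show ?thesis by eventually_elim (simp add: complex_eq_iff)
qed

section \<open>Laplace transforms of Gamma densities\<close>

text \<open>
  The integrand of Euler's integral with complex rate \<open>a\<close>; for \<open>a = 1\<close> it is the Gamma density without
  its normalising factor.
\<close>

definition gamma_kernel :: "real \<Rightarrow> complex \<Rightarrow> real \<Rightarrow> complex" where
  "gamma_kernel s a t = indicator {0<..} t *\<^sub>R (of_real (t powr (s - 1)) * exp (- (a * of_real t)))"

lemma gamma_kernel_measurable [measurable]: "gamma_kernel s a \<in> borel_measurable lborel"
  unfolding gamma_kernel_def by measurable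

lemma integrable_gamma_kernel_real:
  assumes s: "s > 0" and a: "a > 0"
  shows "integrable lborel (gamma_kernel s (of_real a))"
proof -
  have 1: "integrable lborel (\<lambda>t. indicator {0..} t * t powr (s - 1) / exp t)"
  proof (rule integrableI_nonneg)
    show "(\<integral>\<^sup>+t. ennreal (indicator {0..} t * t powr (s - 1) / exp t) \<partial>lborel) < \<infinity>"
      using Gamma_conv_nn_integral_real[OF s] by (metis ennreal_less_top infinity_ennreal_def)
  qed auto
  have "integrable lborel (\<lambda>t. a powr (1 - s) * (indicator {0..} (a * t) * (a * t) powr (s - 1) / exp (a * t)))"
    using lborel_integrable_real_affine[OF 1, of a 0] a by (intro integrable_mult_right) simp
  then have "integrable lborel (\<lambda>t. complex_of_real (a powr (1 - s) * (indicator {0..} (a * t) * (a * t) powr (s - 1) / exp (a * t))))"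
    by (rule integrable_of_real)
  moreover have "complex_of_real (a powr (1 - s) * (indicator {0..} (a * t) * (a * t) powr (s - 1) / exp (a * t)))
      = gamma_kernel s (of_real a) t" for t
  proof (cases "t > 0")
    case True
    have "a powr (1 - s) * a powr (s - 1) = 1" using a by (simp flip: powr_add)
    then show ?thesis using True a
      by (simp add: gamma_kernel_def powr_mult exp_minus field_simps flip: exp_of_real of_real_mult)
  next
    case False
    then show ?thesis using a
      by (cases "t = 0") (auto simp: gamma_kernel_def indicator_def zero_le_mult_iff)
  qed
  ultimately show ?thesis by simp
qed

lemma norm_gamma_kernel: "norm (gamma_kernel s a t) = norm (gamma_kernel s (of_real (Re a)) t)"
  by (simp add: gamma_kernel_def norm_mult)

lemma integrable_gamma_kernel:
  assumes s: "s > 0" and a: "Re a > 0"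
  shows "integrable lborel (gamma_kernel s a)"
  by (rule Bochner_Integration.integrable_bound[OF integrable_gamma_kernel_real[OF s a]])
     (simp_all add: norm_gamma_kernel[of s a])

definition gamma_transform :: "real \<Rightarrow> complex \<Rightarrow> complex" where
  "gamma_transform s a = (LINT t|lborel. gamma_kernel s a t)"

lemma gamma_transform_1:
  assumes s: "s > 0"
  shows "gamma_transform s 1 = of_real (Gamma s)"
proof -
  have "(LINT t|lborel. indicator {0..} t * t powr (s - 1) / exp t) = Gamma s"
    using Gamma_conv_nn_integral_real[OF s] Gamma_real_pos[OF s]
    by (intro integral_eq_nn_integral[THEN trans]) (auto simp flip: ennreal_eq_0_iff)
  moreover have "gamma_kernel s 1 t = of_real (indicator {0..} t * t powr (s - 1) / exp t)" for t
    by (cases "t = 0") (auto simp: gamma_kernel_def indicator_def exp_minus divide_simps simp flip: exp_of_real)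
  then have "gamma_transform s 1 = (LINT t|lborel. of_real (indicator {0..} t * t powr (s - 1) / exp t))"
    by (simp only: gamma_transform_def)
  ultimately show ?thesis by (simp only: integral_complex_of_real)
qed

text \<open>
  Integration by parts with the antiderivative \<open>t\<^sup>s exp (- a t)\<close>, which vanishes at both ends.
\<close>

lemma gamma_transform_parts:
  assumes s: "s > 0" and a: "Re a > 0"
  shows "a * gamma_transform (s + 1) a = of_real s * gamma_transform s a"
proof -
  define F where "F = (\<lambda>t::real. complex_of_real (t powr s) * exp (- (a * of_real t)))"
  define f where "f = (\<lambda>t::real. of_real s * (complex_of_real (t powr (s - 1)) * exp (- (a * of_real t)))
      - a * (of_real (t powr s) * exp (- (a * of_real t))))"
  have nF: "norm (F t) = t powr s * exp (- (Re a * t))" for t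
    by (simp add: F_def norm_mult)
  have eq: "indicator {0<..} t *\<^sub>R f t = of_real s * gamma_kernel s a t - a * gamma_kernel (s + 1) a t" for t
    by (simp add: f_def gamma_kernel_def indicator_def)
  have int: "integrable lborel (\<lambda>t. of_real s * gamma_kernel s a t - a * gamma_kernel (s + 1) a t)"
    using integrable_gamma_kernel[of s a] integrable_gamma_kernel[of "s + 1" a] s a by simp
  have "(LBINT t=0..\<infinity>. f t) = 0 - 0"
  proof (rule interval_integral_FTC_integrable)
    fix t :: real assume "0 < ereal t"
    then have t: "t > 0" by simp
    have 1: "((\<lambda>t. t powr s) has_real_derivative s * t powr (s - 1)) (at t)"
      using t by (auto intro!: derivative_eq_intros)
    have 2: "((\<lambda>t. exp (- (a * complex_of_real t))) has_vector_derivative (- a * exp (- (a * of_real t)))) (at t)"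
      by (rule has_vector_derivative_real_field) (auto intro!: derivative_eq_intros)
    have "(F has_vector_derivative (of_real (t powr s) * (- a * exp (- (a * of_real t))) +
        of_real (s * t powr (s - 1)) * exp (- (a * of_real t)))) (at t)"
      unfolding F_def
      by (rule has_vector_derivative_mult[OF has_vector_derivative_of_real[OF 1] 2])
    then show "(F has_vector_derivative f t) (at t)"
      by (simp add: f_def algebra_simps)
    show "isCont f t"
      unfolding f_def using t by (intro continuous_intros) auto
  next
    show "set_integrable lborel (einterval 0 \<infinity>) f"
      using int unfolding set_integrable_def zero_ereal_def einterval_eq_Ici eq .
    have "((\<lambda>t. norm (F t)) \<longlongrightarrow> 0) (at_right 0)"
      unfolding nF using s by real_asymp
    then have "(F \<longlongrightarrow> 0) (at_right 0)" by (rule tendsto_norm_zero_cancel)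
    then show "((F \<circ> real_of_ereal) \<longlongrightarrow> 0) (at_right 0)"
      by (simp add: zero_ereal_def ereal_tendsto_simps)
    have "((\<lambda>t. norm (F t)) \<longlongrightarrow> 0) at_top"
      unfolding nF using a by real_asymp
    then have "(F \<longlongrightarrow> 0) at_top" by (rule tendsto_norm_zero_cancel)
    then show "((F \<circ> real_of_ereal) \<longlongrightarrow> 0) (at_left \<infinity>)"
      by (simp add: ereal_tendsto_simps)
  qed auto
  then have "(LINT t|lborel. of_real s * gamma_kernel s a t - a * gamma_kernel (s + 1) a t) = 0"
    by (simp add: interval_lebesgue_integral_0_infty set_lebesgue_integral_def eq)
  then show ?thesis
    using integrable_gamma_kernel[of s a] integrable_gamma_kernel[of "s + 1" a] s a
    by (simp add: gamma_transform_def)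
qed

text \<open>
  Differentiation under the integral sign. The second-order Taylor estimate of the exponential gives a
  difference quotient that deviates from the derivative by at most a multiple of \<open>\<bar>w\<bar>\<close>; half of the
  decay rate absorbs the growth of the remainder.
\<close>

lemma gamma_transform_has_derivative:
  assumes s: "s > 0" and a: "Re a > 0"
  shows "(gamma_transform s has_field_derivative - gamma_transform (s + 1) a) (at a)"
proof -
  define M where "M = (LINT t|lborel. norm (gamma_kernel (s + 2) (of_real (Re a / 2)) t))"
  have M: "integrable lborel (\<lambda>t. norm (gamma_kernel (s + 2) (of_real (Re a / 2)) t))"
    using integrable_gamma_kernel[of "s + 2" "of_real (Re a / 2)"] s a by simp
  have bound: "norm ((gamma_transform s (a + w) - gamma_transform s a) / w - (- gamma_transform (s + 1) a)) \<le> norm w * M"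
    if w: "w \<noteq> 0" "norm w < Re a / 2" for w
  proof -
    have aw: "Re (a + w) > 0"
      using abs_Re_le_cmod[of w] w a by simp
    have i: "integrable lborel (gamma_kernel s (a + w))" "integrable lborel (gamma_kernel s a)"
      "integrable lborel (gamma_kernel (s + 1) a)"
      using s a aw by (auto intro!: integrable_gamma_kernel)
    have pt: "norm (gamma_kernel s (a + w) t - gamma_kernel s a t + w * gamma_kernel (s + 1) a t)
        \<le> (norm w)\<^sup>2 * norm (gamma_kernel (s + 2) (of_real (Re a / 2)) t)" for t
    proof (cases "t > 0")
      case True
      define v where "v = - (w * of_real t)"
      have "norm (exp v - (\<Sum>k\<le>1. v ^ k / fact k)) \<le> exp \<bar>Re v\<bar> * norm v ^ Suc 1 / fact 1"
        by (rule Taylor_exp)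
      then have 1: "norm (exp v - 1 - v) \<le> exp \<bar>Re v\<bar> * (norm v)\<^sup>2"
        by (simp add: algebra_simps power2_eq_square)
      have "\<bar>Re v\<bar> \<le> Re a / 2 * t"
        using abs_Re_le_cmod[of w] w True by (simp add: v_def abs_mult)
      with 1 have 2: "norm (exp v - 1 - v) \<le> exp (Re a / 2 * t) * (norm v)\<^sup>2"
        by (meson exp_le_cancel_iff mult_right_mono order_trans zero_le_power2)
      have pw: "t powr s = t powr (s - 1) * t" "t powr (s + 1) = t powr (s - 1) * t\<^sup>2"
        using True by (simp_all add: powr_diff powr_add power2_eq_square)
      have "gamma_kernel s (a + w) t - gamma_kernel s a t + w * gamma_kernel (s + 1) a t
        = of_real (t powr (s - 1)) * exp (- (a * of_real t)) * (exp v - 1 - v)"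
        using True by (simp add: gamma_kernel_def v_def pw exp_add[symmetric] algebra_simps flip: exp_add)
      also have "norm \<dots> \<le> t powr (s - 1) * exp (- (Re a * t)) * (exp (Re a / 2 * t) * (norm v)\<^sup>2)"
        unfolding norm_mult using 2 by (simp add: mult_left_mono)
      also have "\<dots> = (norm w)\<^sup>2 * (t powr (s + 1) * exp (- (Re a * t) + Re a / 2 * t))"
        unfolding exp_add using True by (simp add: v_def norm_mult pw power_mult_distrib mult_ac)
      also have "\<dots> = (norm w)\<^sup>2 * norm (gamma_kernel (s + 2) (of_real (Re a / 2)) t)"
        using True by (simp add: gamma_kernel_def norm_mult algebra_simps flip: exp_of_real of_real_mult of_real_minus)
      finally show ?thesis .
    qed (simp add: gamma_kernel_def)
    have "gamma_transform s (a + w) - gamma_transform s a + w * gamma_transform (s + 1) a =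
       (LINT t|lborel. gamma_kernel s (a + w) t - gamma_kernel s a t + w * gamma_kernel (s + 1) a t)"
      unfolding gamma_transform_def using i by simp
    also have "norm \<dots> \<le> (LINT t|lborel. (norm w)\<^sup>2 * norm (gamma_kernel (s + 2) (of_real (Re a / 2)) t))"
      using i M pt by (intro Bochner_Integration.integral_norm_bound_integral) auto
    also have "\<dots> = (norm w)\<^sup>2 * M" by (simp add: M_def)
    finally have "norm (gamma_transform s (a + w) - gamma_transform s a + w * gamma_transform (s + 1) a) / norm w
        \<le> (norm w)\<^sup>2 * M / norm w"
      by (rule divide_right_mono) simp
    then show ?thesis
      using w by (simp add: divide_simps power2_eq_square mult.commute flip: norm_divide)
  qed
  have "((\<lambda>w. (gamma_transform s (a + w) - gamma_transform s a) / w - (- gamma_transform (s + 1) a)) \<longlongrightarrow> 0) (at 0)"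
  proof (rule Lim_null_comparison)
    show "\<forall>\<^sub>F w in at 0. norm ((gamma_transform s (a + w) - gamma_transform s a) / w - (- gamma_transform (s + 1) a)) \<le> norm w * M"
      unfolding eventually_at using a bound by (intro exI[of _ "Re a / 2"]) auto
    show "((\<lambda>w. norm w * M) \<longlongrightarrow> 0) (at (0::complex))"
      by (auto intro!: tendsto_eq_intros)
  qed
  then show ?thesis
    unfolding DERIV_def by (subst (asm) LIM_zero_iff)
qed

text \<open>
  By the two preceding lemmas the product \<open>a\<^sup>s * gamma_transform s a\<close> has derivative \<open>0\<close> on the right
  half-plane, so it equals its value at \<open>a = 1\<close>.
\<close>

theorem gamma_transform_eq:
  assumes s: "s > 0" and a: "Re a > 0"
  shows "gamma_transform s a = of_real (Gamma s) * a powr (- of_real s)"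
proof -
  let ?\<Phi> = "\<lambda>a. a powr of_real s * gamma_transform s a"
  have "\<exists>c. \<forall>a\<in>{a. Re a > 0}. ?\<Phi> a = c"
  proof (rule has_field_derivative_zero_constant)
    show "convex {a. 0 < Re a}" by (rule convex_halfspace_Re_gt)
    fix b assume "b \<in> {a. 0 < Re a}"
    then have b: "Re b > 0" and nb: "b \<notin> \<real>\<^sub>\<le>\<^sub>0" and b0: "b \<noteq> 0" by (auto simp: complex_nonpos_Reals_iff)
    have "(?\<Phi> has_field_derivative (b powr of_real s * (- gamma_transform (s + 1) b)
         + of_real s * b powr (of_real s - 1) * gamma_transform s b)) (at b)"
      by (rule DERIV_mult'[OF has_field_derivative_powr[OF nb] gamma_transform_has_derivative[OF s b]])
    also have "b powr of_real s * (- gamma_transform (s + 1) b)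
         + of_real s * b powr (of_real s - 1) * gamma_transform s b
       = b powr (of_real s - 1) * (of_real s * gamma_transform s b - b * gamma_transform (s + 1) b)"
      using b0 by (simp add: powr_diff field_simps)
    also have "\<dots> = 0" using gamma_transform_parts[OF s b] by simp
    finally show "(?\<Phi> has_field_derivative 0) (at b within {a. 0 < Re a})"
      by (rule has_field_derivative_at_within)
  qed
  then have "?\<Phi> a = ?\<Phi> 1" using a by (metis mem_Collect_eq one_complex.sel(1) zero_less_one)
  then have "a powr of_real s * gamma_transform s a = of_real (Gamma s)"
    by (simp add: gamma_transform_1[OF s])
  moreover have "a powr of_real s \<noteq> 0" using a by auto
  ultimately show ?thesis
    by (simp add: powr_minus field_simps)
qed

section \<open>Multipliers on a line or half-line\<close>

text \<open>
  The sign convention makes a fractional derivative of order \<open>\<gamma>\<close> act as multiplication by \<open>z powr \<gamma>\<close>, with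
  \<open>z\<close> in the closed right half-plane.
\<close>

definition transform :: "(real \<Rightarrow> complex) \<Rightarrow> complex \<Rightarrow> complex" where
  "transform f z = (LINT t|lborel. exp (- (z * of_real t)) * f t)"

lemma transform_translate:
  "transform (\<lambda>x. f (x - a)) z = exp (- (z * of_real a)) * transform f z"
proof -
  have "transform (\<lambda>x. f (x - a)) z =
     (LINT x|lborel. exp (- (z * of_real (a + 1 * x))) * f (a + 1 * x - a))"
    unfolding transform_def by (subst lborel_integral_real_affine[of 1 _ a]) simp_all
  also have "\<dots> = (LINT x|lborel. exp (- (z * of_real a)) * (exp (- (z * of_real x)) * f x))"
    by (intro Bochner_Integration.integral_cong) (simp_all add: algebra_simps exp_diff exp_minus field_simps)
  finally show ?thesis by (simp add: transform_def)
qed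

lemma transform_dilate:
  assumes "a > 0"
  shows "transform (\<lambda>x. f (a * x)) z = transform f (z / of_real a) / of_real a"
proof -
  have "transform f (z / of_real a) = a *\<^sub>R (LINT x|lborel. exp (- (z / of_real a * of_real (0 + a * x))) * f (0 + a * x))"
    unfolding transform_def by (subst lborel_integral_real_affine[of a _ 0]) (use assms in simp_all)
  also have "(LINT x|lborel. exp (- (z / of_real a * of_real (0 + a * x))) * f (0 + a * x)) = transform (\<lambda>x. f (a * x)) z"
    unfolding transform_def using assms by (intro Bochner_Integration.integral_cong) simp_all
  finally show ?thesis using assms by (simp add: scaleR_conv_of_real)
qed

lemma integral_norm_translate:
  fixes f :: "real \<Rightarrow> complex"
  shows "(LINT x|lborel. norm (f (x - a))) = (LINT x|lborel. norm (f x))"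
  by (subst lborel_integral_real_affine[of 1 _ a]) simp_all

lemma integral_norm_dilate:
  fixes f :: "real \<Rightarrow> complex"
  assumes "a > 0"
  shows "(LINT x|lborel. norm (f (a * x))) = (LINT x|lborel. norm (f x)) / a"
  using lborel_integral_real_affine[of a "\<lambda>x. norm (f x)" 0] assms by simp

lemma integrable_translate:
  fixes f :: "real \<Rightarrow> complex"
  assumes "integrable lborel f"
  shows "integrable lborel (\<lambda>x. f (x - a))"
  using lborel_integrable_real_affine[OF assms, of 1 "- a"] by (simp add: algebra_simps)

lemma integrable_dilate:
  fixes f :: "real \<Rightarrow> complex"
  assumes "integrable lborel f" "a > 0"
  shows "integrable lborel (\<lambda>x. f (a * x))"
  using lborel_integrable_real_affine[OF assms(1), of a 0] assms(2) by simp

lemma AE_summable_norm: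
  fixes g :: "nat \<Rightarrow> real \<Rightarrow> complex"
  assumes g: "\<And>i. integrable lborel (g i)" and sm: "summable (\<lambda>i. LINT x|lborel. norm (g i x))"
  shows "AE x in lborel. summable (\<lambda>i. norm (g i x))"
proof -
  have [measurable]: "g i \<in> borel_measurable lborel" for i
    using g by (rule borel_measurable_integrable)
  have "(\<integral>\<^sup>+x. (\<Sum>i. ennreal (norm (g i x))) \<partial>lborel) = (\<Sum>i. \<integral>\<^sup>+x. ennreal (norm (g i x)) \<partial>lborel)"
    by (intro nn_integral_suminf) auto
  also have "\<dots> = (\<Sum>i. ennreal (LINT x|lborel. norm (g i x)))"
    by (intro suminf_cong nn_integral_eq_integral) (use g in auto)
  also have "\<dots> = ennreal (\<Sum>i. LINT x|lborel. norm (g i x))"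
    by (intro suminf_ennreal2 sm) auto
  finally have "AE x in lborel. (\<Sum>i. ennreal (norm (g i x))) \<noteq> \<infinity>"
    by (intro nn_integral_PInf_AE) auto
  then show ?thesis
    by eventually_elim (intro summable_suminf_not_top, auto)
qed

text \<open>
  The common features of the line (\<open>S = UNIV\<close>, \<open>Z\<close> the imaginary axis) and of the half-line
  (\<open>S = {0..}\<close>, \<open>Z\<close> the closed right half-plane). Time is scaled and shifted to the right within \<open>S\<close>, and
  \<open>exp (- z t)\<close> is bounded by \<open>1\<close> for \<open>t \<in> S\<close> and \<open>z \<in> Z\<close>. The origin is left out of \<open>Z\<close>, so that symbols
  may contain negative powers of \<open>z\<close>; it is recovered by continuity in \<open>transform_0_eq_0\<close>.
\<close>

locale transform_domain =
  fixes S :: "real set" and Z :: "complex set"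
  assumes zero_in_S: "0 \<in> S"
    and S_add: "t \<in> S \<Longrightarrow> 0 \<le> a \<Longrightarrow> t + a \<in> S"
    and S_scale: "t \<in> S \<Longrightarrow> 0 < a \<Longrightarrow> a * t \<in> S"
    and Z_nonzero: "z \<in> Z \<Longrightarrow> z \<noteq> 0"
    and Z_Re: "z \<in> Z \<Longrightarrow> 0 \<le> Re z"
    and Z_scale: "z \<in> Z \<Longrightarrow> 0 < a \<Longrightarrow> of_real a * z \<in> Z"
    and Z_imaginary: "k \<noteq> 0 \<Longrightarrow> \<i> * of_real k \<in> Z"
    and decay: "t \<in> S \<Longrightarrow> z \<in> Z \<Longrightarrow> 0 \<le> Re z * t"
begin

definition L :: "(real \<Rightarrow> complex) set" where
  "L = {f. integrable lborel f \<and> (\<forall>t. t \<notin> S \<longrightarrow> f t = 0)}"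

lemma L_integrable: "f \<in> L \<Longrightarrow> integrable lborel f" by (simp add: L_def)
lemma L_zero: "f \<in> L \<Longrightarrow> t \<notin> S \<Longrightarrow> f t = 0" by (simp add: L_def)

lemma L_measurable: "f \<in> L \<Longrightarrow> f \<in> borel_measurable borel"
  using L_integrable by fastforce

lemma norm_exp_mult_le:
  assumes "z \<in> Z" "t \<notin> S \<Longrightarrow> w = 0"
  shows "norm (exp (- (z * of_real t)) * w) \<le> norm w"
proof (cases "t \<in> S")
  case True
  then have "norm (exp (- (z * of_real t))) \<le> 1" using decay[OF True assms(1)] by simp
  then show ?thesis by (simp add: norm_mult mult_left_le_one_le)
qed (use assms in simp)

lemma integrable_exp_mult:
  assumes "f \<in> L" "z \<in> Z"
  shows "integrable lborel (\<lambda>t. exp (- (z * of_real t)) * f t)"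
  by (rule Bochner_Integration.integrable_bound[OF L_integrable[OF assms(1)]])
     (use L_measurable[OF assms(1)] norm_exp_mult_le[OF assms(2) L_zero[OF assms(1)]] in auto)

lemma norm_transform_le:
  assumes "f \<in> L" "z \<in> Z"
  shows "norm (transform f z) \<le> (LINT t|lborel. norm (f t))"
  unfolding transform_def
  using integrable_exp_mult[OF assms] L_integrable[OF assms(1)]
    norm_exp_mult_le[OF assms(2) L_zero[OF assms(1)]]
  by (intro Bochner_Integration.integral_norm_bound_integral) auto

lemma L_add: "f \<in> L \<Longrightarrow> g \<in> L \<Longrightarrow> (\<lambda>x. f x + g x) \<in> L"
  and L_diff: "f \<in> L \<Longrightarrow> g \<in> L \<Longrightarrow> (\<lambda>x. f x - g x) \<in> L"
  and L_cmult: "f \<in> L \<Longrightarrow> (\<lambda>x. c * f x) \<in> L"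
  by (auto simp: L_def)

lemma L_translate: "f \<in> L \<Longrightarrow> (\<And>t. t \<in> S \<Longrightarrow> t + a \<in> S) \<Longrightarrow> (\<lambda>x. f (x - a)) \<in> L"
  by (force simp: L_def intro: integrable_translate)

lemma L_dilate: "f \<in> L \<Longrightarrow> 0 < a \<Longrightarrow> (\<lambda>x. f (a * x)) \<in> L"
proof -
  assume f: "f \<in> L" and a: "0 < a"
  have "a * t \<notin> S" if "t \<notin> S" for t
    using S_scale[of "a * t" "1 / a"] a that by auto
  then show ?thesis using f a by (auto simp: L_def intro: integrable_dilate)
qed

lemma transform_add: "f \<in> L \<Longrightarrow> g \<in> L \<Longrightarrow> z \<in> Z \<Longrightarrow> transform (\<lambda>x. f x + g x) z = transform f z + transform g z"
  using integrable_exp_mult by (simp add: transform_def distrib_left)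

lemma transform_diff: "f \<in> L \<Longrightarrow> g \<in> L \<Longrightarrow> z \<in> Z \<Longrightarrow> transform (\<lambda>x. f x - g x) z = transform f z - transform g z"
  using integrable_exp_mult by (simp add: transform_def right_diff_distrib)

lemma transform_cmult: "transform (\<lambda>x. c * f x) z = c * transform f z"
  by (simp add: transform_def mult.left_commute)

text \<open>
  Summation in \<open>L\<^sub>1\<close> is realised by the pointwise sum, which converges absolutely almost everywhere. The
  Gruenwald operator is defined by such a pointwise sum.
\<close>

lemma L_suminf:
  assumes g: "\<And>i. g i \<in> L" and sm: "summable (\<lambda>i. LINT x|lborel. norm (g i x))"
  shows "(\<lambda>x. \<Sum>i. g i x) \<in> L"
    and "z \<in> Z \<Longrightarrow> (\<lambda>i. transform (g i) z) sums transform (\<lambda>x. \<Sum>i. g i x) z"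
    and "(LINT x|lborel. norm (\<Sum>i. g i x)) \<le> (\<Sum>i. LINT x|lborel. norm (g i x))"
proof -
  have gi: "integrable lborel (g i)" for i using g L_integrable by blast
  note ae = AE_summable_norm[OF gi sm]
  have int: "integrable lborel (\<lambda>x. \<Sum>i. g i x)"
    by (rule integrable_suminf[OF gi ae sm])
  show "(\<lambda>x. \<Sum>i. g i x) \<in> L"
    using int g by (auto simp: L_def)
  show "(LINT x|lborel. norm (\<Sum>i. g i x)) \<le> (\<Sum>i. LINT x|lborel. norm (g i x))"
  proof -
    have int': "integrable lborel (\<lambda>x. \<Sum>i. norm (g i x))"
      by (rule integrable_suminf) (use gi ae sm in auto)
    have "(LINT x|lborel. norm (\<Sum>i. g i x)) \<le> (LINT x|lborel. (\<Sum>i. norm (g i x)))"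
    proof (rule integral_mono_AE)
      show "AE x in lborel. norm (\<Sum>i. g i x) \<le> (\<Sum>i. norm (g i x))"
        using ae by eventually_elim (rule summable_norm)
    qed (use int int' in auto)
    also have "\<dots> = (\<Sum>i. LINT x|lborel. norm (g i x))"
      by (rule integral_suminf) (use gi ae sm in auto)
    finally show ?thesis .
  qed
  assume z: "z \<in> Z"
  have e: "norm (exp (- (z * of_real x)) * g i x) \<le> norm (g i x)" for i x
    by (rule norm_exp_mult_le[OF z L_zero[OF g]])
  have "(\<lambda>i. LINT x|lborel. exp (- (z * of_real x)) * g i x) sums
     (LINT x|lborel. (\<Sum>i. exp (- (z * of_real x)) * g i x))"
  proof (rule sums_integral)
    show "integrable lborel (\<lambda>x. exp (- (z * of_real x)) * g i x)" for i
      by (rule integrable_exp_mult[OF g z])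
    show "AE x in lborel. summable (\<lambda>i. norm (exp (- (z * of_real x)) * g i x))"
      using ae by eventually_elim (rule summable_comparison_test', use e in auto)
    show "summable (\<lambda>i. LINT x|lborel. norm (exp (- (z * of_real x)) * g i x))"
    proof (rule summable_comparison_test'[OF sm, of 0])
      fix i
      have "(LINT x|lborel. norm (exp (- (z * of_real x)) * g i x)) \<le> (LINT x|lborel. norm (g i x))"
        using e integrable_exp_mult[OF g z] gi by (intro integral_mono) auto
      then show "norm (LINT x|lborel. norm (exp (- (z * of_real x)) * g i x)) \<le> (LINT x|lborel. norm (g i x))"
        by simp
    qed
  qed
  also have "(LINT x|lborel. (\<Sum>i. exp (- (z * of_real x)) * g i x)) = transform (\<lambda>x. \<Sum>i. g i x) z"
    unfolding transform_def
  proof (rule integral_cong_AE)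
    show "AE x in lborel. (\<Sum>i. exp (- (z * of_real x)) * g i x) = exp (- (z * of_real x)) * (\<Sum>i. g i x)"
      using ae by eventually_elim (intro suminf_mult, auto dest: summable_norm_cancel)
  qed (use gi in \<open>auto intro!: borel_measurable_times borel_measurable_suminf simp: borel_measurable_integrable\<close>)
  finally show "(\<lambda>i. transform (g i) z) sums transform (\<lambda>x. \<Sum>i. g i x) z"
    by (simp add: transform_def)
qed

text \<open>
  Multiplication by \<open>F\<close> on the transform side comes from an operator on \<open>L\<close> that enlarges norms by a factor of
  at most \<open>C\<close>. In effect this is a convolution with a finite measure of total variation \<open>C\<close> or less;
  asking only for the image of each \<open>f\<close> avoids naming the measure.
\<close>

definition mult_bound :: "(complex \<Rightarrow> complex) \<Rightarrow> real \<Rightarrow> bool" where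
  "mult_bound F C \<longleftrightarrow> 0 \<le> C \<and> (\<forall>f\<in>L. \<exists>g\<in>L. (\<forall>z\<in>Z. transform g z = F z * transform f z) \<and>
     (LINT x|lborel. norm (g x)) \<le> C * (LINT x|lborel. norm (f x)))"

definition multiplier :: "(complex \<Rightarrow> complex) \<Rightarrow> bool" where
  "multiplier F \<longleftrightarrow> (\<exists>C. mult_bound F C)"

lemma mult_boundI:
  assumes "0 \<le> C"
    and "\<And>f. f \<in> L \<Longrightarrow> h f \<in> L"
    and "\<And>f z. f \<in> L \<Longrightarrow> z \<in> Z \<Longrightarrow> transform (h f) z = F z * transform f z"
    and "\<And>f. f \<in> L \<Longrightarrow> (LINT x|lborel. norm (h f x)) \<le> C * (LINT x|lborel. norm (f x))"
  shows "mult_bound F C"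
  using assms unfolding mult_bound_def by blast

lemma mult_boundE:
  assumes "mult_bound F C"
  obtains h where "\<And>f. f \<in> L \<Longrightarrow> h f \<in> L"
    "\<And>f z. f \<in> L \<Longrightarrow> z \<in> Z \<Longrightarrow> transform (h f) z = F z * transform f z"
    "\<And>f. f \<in> L \<Longrightarrow> (LINT x|lborel. norm (h f x)) \<le> C * (LINT x|lborel. norm (f x))"
  using assms unfolding mult_bound_def bex_simps Bex_def by (auto dest!: bchoice)

lemma mult_bound_nonneg: "mult_bound F C \<Longrightarrow> 0 \<le> C"
  by (simp add: mult_bound_def)

lemma mult_bound_cong:
  assumes "mult_bound F C" "\<And>z. z \<in> Z \<Longrightarrow> G z = F z"
  shows "mult_bound G C"
  using assms unfolding mult_bound_def by simp

lemma mult_bound_mono: "mult_bound F C \<Longrightarrow> C \<le> D \<Longrightarrow> mult_bound F D"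
  unfolding mult_bound_def
  by (meson Bochner_Integration.integral_nonneg mult_right_mono norm_ge_zero order_trans)

lemma mult_bound_const: "mult_bound (\<lambda>_. c) (norm c)"
  by (rule mult_boundI[where h = "\<lambda>f x. c * f x"])
     (auto intro: L_cmult simp: transform_cmult norm_mult)

lemma mult_bound_add:
  assumes "mult_bound F C" "mult_bound G D"
  shows "mult_bound (\<lambda>z. F z + G z) (C + D)"
proof -
  from assms(1) obtain h where h: "\<And>f. f \<in> L \<Longrightarrow> h f \<in> L"
    "\<And>f z. f \<in> L \<Longrightarrow> z \<in> Z \<Longrightarrow> transform (h f) z = F z * transform f z"
    "\<And>f. f \<in> L \<Longrightarrow> (LINT x|lborel. norm (h f x)) \<le> C * (LINT x|lborel. norm (f x))"
    by (rule mult_boundE) blast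
  from assms(2) obtain k where k: "\<And>f. f \<in> L \<Longrightarrow> k f \<in> L"
    "\<And>f z. f \<in> L \<Longrightarrow> z \<in> Z \<Longrightarrow> transform (k f) z = G z * transform f z"
    "\<And>f. f \<in> L \<Longrightarrow> (LINT x|lborel. norm (k f x)) \<le> D * (LINT x|lborel. norm (f x))"
    by (rule mult_boundE) blast
  show ?thesis
  proof (rule mult_boundI[where h = "\<lambda>f x. h f x + k f x"])
    fix f assume f: "f \<in> L"
    have "(LINT x|lborel. norm (h f x + k f x)) \<le> (LINT x|lborel. norm (h f x) + norm (k f x))"
      using h(1)[OF f] k(1)[OF f] L_integrable
      by (intro integral_mono) (auto intro: norm_triangle_ineq)
    also have "\<dots> = (LINT x|lborel. norm (h f x)) + (LINT x|lborel. norm (k f x))"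
      using h(1)[OF f] k(1)[OF f] L_integrable by (intro Bochner_Integration.integral_add) auto
    also have "\<dots> \<le> (C + D) * (LINT x|lborel. norm (f x))"
      using h(3)[OF f] k(3)[OF f] by (simp add: distrib_right)
    finally show "(LINT x|lborel. norm (h f x + k f x)) \<le> (C + D) * (LINT x|lborel. norm (f x))" .
  qed (use h k assms mult_bound_nonneg in \<open>auto simp: L_add transform_add distrib_right\<close>)
qed

lemma mult_bound_mult:
  assumes "mult_bound F C" "mult_bound G D"
  shows "mult_bound (\<lambda>z. F z * G z) (C * D)"
proof -
  from assms(1) obtain h where h: "\<And>f. f \<in> L \<Longrightarrow> h f \<in> L"
    "\<And>f z. f \<in> L \<Longrightarrow> z \<in> Z \<Longrightarrow> transform (h f) z = F z * transform f z"
    "\<And>f. f \<in> L \<Longrightarrow> (LINT x|lborel. norm (h f x)) \<le> C * (LINT x|lborel. norm (f x))"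
    by (rule mult_boundE) blast
  from assms(2) obtain k where k: "\<And>f. f \<in> L \<Longrightarrow> k f \<in> L"
    "\<And>f z. f \<in> L \<Longrightarrow> z \<in> Z \<Longrightarrow> transform (k f) z = G z * transform f z"
    "\<And>f. f \<in> L \<Longrightarrow> (LINT x|lborel. norm (k f x)) \<le> D * (LINT x|lborel. norm (f x))"
    by (rule mult_boundE) blast
  show ?thesis
  proof (rule mult_boundI[where h = "\<lambda>f. h (k f)"])
    fix f assume f: "f \<in> L"
    have "(LINT x|lborel. norm (h (k f) x)) \<le> C * (LINT x|lborel. norm (k f x))"
      by (rule h(3)[OF k(1)[OF f]])
    also have "\<dots> \<le> C * (D * (LINT x|lborel. norm (f x)))"
      by (rule mult_left_mono[OF k(3)[OF f]]) (use assms mult_bound_nonneg in auto)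
    finally show "(LINT x|lborel. norm (h (k f) x)) \<le> C * D * (LINT x|lborel. norm (f x))"
      by (simp add: mult_ac)
  qed (use h k assms mult_bound_nonneg in auto)
qed

text \<open>
  Conjugating the operator by a dilation of time preserves its norm. This is why the final constant does
  not depend on the step size.
\<close>

lemma mult_bound_dilate:
  assumes "mult_bound F C" "c > 0"
  shows "mult_bound (\<lambda>z. F (of_real c * z)) C"
proof -
  from assms(1) obtain h where h: "\<And>f. f \<in> L \<Longrightarrow> h f \<in> L"
    "\<And>f z. f \<in> L \<Longrightarrow> z \<in> Z \<Longrightarrow> transform (h f) z = F z * transform f z"
    "\<And>f. f \<in> L \<Longrightarrow> (LINT x|lborel. norm (h f x)) \<le> C * (LINT x|lborel. norm (f x))"
    by (rule mult_boundE) blast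
  show ?thesis
  proof (rule mult_boundI[where h = "\<lambda>f x. h (\<lambda>x. f (c * x)) (1 / c * x)"])
    fix f assume f: "f \<in> L"
    have fc: "(\<lambda>x. f (c * x)) \<in> L" using f assms(2) by (rule L_dilate)
    show "(\<lambda>x. h (\<lambda>x. f (c * x)) (1 / c * x)) \<in> L"
      using h(1)[OF fc] assms(2) by (intro L_dilate) auto
    have "(LINT x|lborel. norm (h (\<lambda>x. f (c * x)) (1 / c * x))) = c * (LINT x|lborel. norm (h (\<lambda>x. f (c * x)) x))"
      using assms(2) by (subst integral_norm_dilate) auto
    also have "\<dots> \<le> c * (C * (LINT x|lborel. norm (f (c * x))))"
      by (rule mult_left_mono[OF h(3)[OF fc]]) (use assms in auto)
    also have "\<dots> = C * (LINT x|lborel. norm (f x))"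
      using assms(2) by (simp add: integral_norm_dilate)
    finally show "(LINT x|lborel. norm (h (\<lambda>x. f (c * x)) (1 / c * x))) \<le> C * (LINT x|lborel. norm (f x))" .
    fix z assume z: "z \<in> Z"
    have "transform (\<lambda>x. h (\<lambda>x. f (c * x)) (1 / c * x)) z = transform (h (\<lambda>x. f (c * x))) (of_real c * z) * of_real c"
      using assms(2) by (subst transform_dilate) (auto simp: field_simps)
    also have "\<dots> = F (of_real c * z) * transform f z"
      using h(2)[OF fc Z_scale[OF z assms(2)]] assms(2) by (simp add: transform_dilate)
    finally show "transform (\<lambda>x. h (\<lambda>x. f (c * x)) (1 / c * x)) z = F (of_real c * z) * transform f z" .
  qed (use assms mult_bound_nonneg in auto)
qed

lemma mult_bound_translation:
  assumes "\<And>t. t \<in> S \<Longrightarrow> t + a \<in> S"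
  shows "mult_bound (\<lambda>z. exp (- (z * of_real a))) 1"
  by (rule mult_boundI[where h = "\<lambda>f x. f (x - a)"])
     (use assms in \<open>auto intro: L_translate simp: transform_translate integral_norm_translate\<close>)

lemma mult_bound_suminf:
  assumes F: "\<And>i. mult_bound (F i) (C i)" and C: "summable C"
    and G: "\<And>z. z \<in> Z \<Longrightarrow> (\<lambda>i. F i z) sums G z"
  shows "mult_bound G (suminf C)"
proof -
  have C0: "0 \<le> C i" for i using F mult_bound_nonneg by blast
  have "\<exists>h. \<forall>i. (\<forall>f\<in>L. h i f \<in> L) \<and> (\<forall>f\<in>L. \<forall>z\<in>Z. transform (h i f) z = F i z * transform f z)
    \<and> (\<forall>f\<in>L. (LINT x|lborel. norm (h i f x)) \<le> C i * (LINT x|lborel. norm (f x)))"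
    by (rule choice, rule allI, rule mult_boundE[OF F]) blast
  then obtain h where h: "\<And>i f. f \<in> L \<Longrightarrow> h i f \<in> L"
    "\<And>i f z. f \<in> L \<Longrightarrow> z \<in> Z \<Longrightarrow> transform (h i f) z = F i z * transform f z"
    "\<And>i f. f \<in> L \<Longrightarrow> (LINT x|lborel. norm (h i f x)) \<le> C i * (LINT x|lborel. norm (f x))"
    by blast
  have sm: "summable (\<lambda>i. LINT x|lborel. norm (h i f x))" if f: "f \<in> L" for f
    by (rule summable_comparison_test'[OF summable_mult2[OF C], of 0]) (use h(3)[OF f] in auto)
  show ?thesis
  proof (rule mult_boundI[where h = "\<lambda>f x. \<Sum>i. h i f x"])
    fix f assume f: "f \<in> L"
    note s = L_suminf[OF h(1)[OF f] sm[OF f]]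
    show "(\<lambda>x. \<Sum>i. h i f x) \<in> L" by (rule s(1))
    have "(LINT x|lborel. norm (\<Sum>i. h i f x)) \<le> (\<Sum>i. LINT x|lborel. norm (h i f x))" by (rule s(3))
    also have "\<dots> \<le> (\<Sum>i. C i * (LINT x|lborel. norm (f x)))"
      by (intro suminf_le h(3) f sm summable_mult2 C)
    also have "\<dots> = suminf C * (LINT x|lborel. norm (f x))"
      by (rule suminf_mult2[symmetric]) (rule C)
    finally show "(LINT x|lborel. norm (\<Sum>i. h i f x)) \<le> suminf C * (LINT x|lborel. norm (f x))" .
    fix z assume z: "z \<in> Z"
    have "(\<lambda>i. transform (h i f) z) sums (G z * transform f z)"
      using sums_mult2[OF G[OF z]] by (simp add: h(2)[OF f z])
    then show "transform (\<lambda>x. \<Sum>i. h i f x) z = G z * transform f z"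
      using s(2)[OF z] sums_unique2 by blast
  qed (use C C0 suminf_nonneg in auto)
qed

lemma mult_bound_convolution:
  assumes \<kappa>: "integrable lborel \<kappa>" and \<kappa>0: "\<And>t. t < 0 \<Longrightarrow> \<kappa> t = 0"
  shows "mult_bound (transform \<kappa>) (LINT t|lborel. norm (\<kappa> t))"
proof (rule mult_boundI[where h = "\<lambda>f x. LINT y|lborel. \<kappa> y * f (x - y)"])
  fix f assume f: "f \<in> L"
  have [measurable]: "\<kappa> \<in> borel_measurable borel" using \<kappa> by auto
  have [measurable]: "f \<in> borel_measurable borel" using f by (rule L_measurable)
  let ?H = "\<lambda>y x. \<kappa> y * f (x - y)"
  have fi: "integrable lborel f" using f by (rule L_integrable)
  have H: "integrable (lborel \<Otimes>\<^sub>M lborel) (case_prod ?H)"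
  proof (rule lborel_pair.Fubini_integrable)
    show "integrable lborel (\<lambda>y. LINT x|lborel. norm (case_prod ?H (y, x)))"
      using \<kappa> by (simp add: norm_mult integral_norm_translate)
    show "AE y in lborel. integrable lborel (\<lambda>x. case_prod ?H (y, x))"
      using integrable_translate[OF fi] by simp
  qed measurable
  have zero: "?H y x = 0" if "x \<notin> S" for x y
  proof (cases "y < 0")
    case False
    then have "x - y \<notin> S" using S_add[of "x - y" y] that by auto
    then show ?thesis using L_zero[OF f] by simp
  qed (simp add: \<kappa>0)
  have "integrable lborel (\<lambda>x. LINT y|lborel. ?H y x)"
    using lborel_pair.integrable_snd[OF H] .
  then show g: "(\<lambda>x. LINT y|lborel. ?H y x) \<in> L"
    by (simp add: L_def zero)
  have H': "integrable (lborel \<Otimes>\<^sub>M lborel) (case_prod (\<lambda>y x. norm (?H y x)))"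
    using integrable_norm[OF H] by (simp add: case_prod_unfold)
  have "(LINT x|lborel. norm (LINT y|lborel. ?H y x)) \<le> (LINT x|lborel. LINT y|lborel. norm (?H y x))"
    using L_integrable[OF g] lborel_pair.integrable_snd[OF H'] by (intro integral_mono) auto
  also have "\<dots> = (LINT y|lborel. LINT x|lborel. norm (?H y x))"
    by (rule lborel_pair.Fubini_integral[OF H'])
  also have "\<dots> = (LINT t|lborel. norm (\<kappa> t)) * (LINT x|lborel. norm (f x))"
    by (simp add: norm_mult integral_norm_translate)
  finally show "(LINT x|lborel. norm (LINT y|lborel. ?H y x)) \<le> (LINT t|lborel. norm (\<kappa> t)) * (LINT x|lborel. norm (f x))" .
  fix z assume z: "z \<in> Z"
  have E: "integrable (lborel \<Otimes>\<^sub>M lborel) (case_prod (\<lambda>y x. exp (- (z * of_real x)) * ?H y x))"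
    by (rule Bochner_Integration.integrable_bound[OF H])
       (use norm_exp_mult_le[OF z] zero in auto)
  have "transform (\<lambda>x. LINT y|lborel. ?H y x) z = (LINT x|lborel. LINT y|lborel. exp (- (z * of_real x)) * ?H y x)"
    by (simp add: transform_def)
  also have "\<dots> = (LINT y|lborel. LINT x|lborel. exp (- (z * of_real x)) * ?H y x)"
    by (rule lborel_pair.Fubini_integral[OF E])
  also have "\<dots> = (LINT y|lborel. transform (\<lambda>x. \<kappa> y * f (x - y)) z)"
    by (simp add: transform_def)
  also have "\<dots> = (LINT y|lborel. (exp (- (z * of_real y)) * \<kappa> y) * transform f z)"
    unfolding transform_cmult transform_translate by (simp add: mult_ac)
  also have "\<dots> = transform \<kappa> z * transform f z"
    by (simp add: transform_def)
  finally show "transform (\<lambda>x. LINT y|lborel. ?H y x) z = transform \<kappa> z * transform f z" .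
qed simp

end

section \<open>Fractional powers as multipliers\<close>

context transform_domain
begin

lemma multiplier_cong: "multiplier F \<Longrightarrow> (\<And>z. z \<in> Z \<Longrightarrow> G z = F z) \<Longrightarrow> multiplier G"
  unfolding multiplier_def using mult_bound_cong by blast

lemma multiplier_const [intro]: "multiplier (\<lambda>_. c)"
  unfolding multiplier_def using mult_bound_const by blast

lemma multiplier_add: "multiplier F \<Longrightarrow> multiplier G \<Longrightarrow> multiplier (\<lambda>z. F z + G z)"
  unfolding multiplier_def using mult_bound_add by blast

lemma multiplier_mult: "multiplier F \<Longrightarrow> multiplier G \<Longrightarrow> multiplier (\<lambda>z. F z * G z)"
  unfolding multiplier_def using mult_bound_mult by blast

lemma multiplier_cmult: "multiplier F \<Longrightarrow> multiplier (\<lambda>z. c * F z)"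
  by (rule multiplier_mult[OF multiplier_const])

lemma multiplier_diff: "multiplier F \<Longrightarrow> multiplier G \<Longrightarrow> multiplier (\<lambda>z. F z - G z)"
  using multiplier_add[OF _ multiplier_cmult[of G "-1"]] by simp

lemma multiplier_power: "multiplier F \<Longrightarrow> multiplier (\<lambda>z. F z ^ n)"
  by (induction n) (auto intro: multiplier_mult)

lemma multiplier_sum: "(\<And>i. i \<in> A \<Longrightarrow> multiplier (F i)) \<Longrightarrow> multiplier (\<lambda>z. \<Sum>i\<in>A. F i z)"
  by (induction A rule: infinite_finite_induct) (auto intro: multiplier_add)

lemma multiplier_dilate: "multiplier F \<Longrightarrow> c > 0 \<Longrightarrow> multiplier (\<lambda>z. F (of_real c * z))"
  unfolding multiplier_def using mult_bound_dilate by blast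

lemma multiplier_translation: "(\<And>t. t \<in> S \<Longrightarrow> t + a \<in> S) \<Longrightarrow> multiplier (\<lambda>z. exp (- (z * of_real a)))"
  unfolding multiplier_def using mult_bound_translation by blast

lemma mult_bound_power: "mult_bound F C \<Longrightarrow> mult_bound (\<lambda>z. F z ^ n) (C ^ n)"
  by (induction n) (use mult_bound_const[of 1] in \<open>auto intro: mult_bound_mult\<close>)

lemma mult_bound_cmult: "mult_bound F C \<Longrightarrow> mult_bound (\<lambda>z. c * F z) (norm c * C)"
  by (rule mult_bound_mult[OF mult_bound_const])

lemma transform_gamma_kernel: "transform (gamma_kernel s 1) z = gamma_transform s (1 + z)"
  unfolding transform_def gamma_transform_def
  by (intro Bochner_Integration.integral_cong)
     (simp_all add: gamma_kernel_def algebra_simps exp_add[symmetric] flip: exp_add)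

lemma integral_norm_gamma_kernel:
  assumes "s > 0"
  shows "(LINT t|lborel. norm (gamma_kernel s 1 t)) = Gamma s"
proof -
  have "gamma_kernel s 1 t = of_real (norm (gamma_kernel s 1 t))" for t
    by (simp add: gamma_kernel_def norm_mult indicator_def flip: exp_of_real of_real_minus)
  then have "complex_of_real (LINT t|lborel. norm (gamma_kernel s 1 t)) = gamma_transform s 1"
    unfolding gamma_transform_def by (subst integral_complex_of_real[symmetric]) presburger
  then show ?thesis using gamma_transform_1[OF assms] by simp
qed

lemma mult_bound_resolvent_powr:
  assumes s: "s > 0"
  shows "mult_bound (\<lambda>z. (1 + z) powr (- of_real s)) 1"
proof -
  have G: "Gamma s > 0" using s by (rule Gamma_real_pos)
  have "mult_bound (transform (gamma_kernel s 1)) (Gamma s)"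
    using mult_bound_convolution[of "gamma_kernel s 1"] integrable_gamma_kernel[OF s, of 1] integral_norm_gamma_kernel[OF s]
    by (simp add: gamma_kernel_def)
  from mult_bound_cmult[OF this, of "1 / of_real (Gamma s)"]
  have "mult_bound (\<lambda>z. 1 / of_real (Gamma s) * transform (gamma_kernel s 1) z) 1"
    using G by (simp add: norm_divide)
  then show ?thesis
  proof (rule mult_bound_cong)
    fix z assume "z \<in> Z"
    then have "Re (1 + z) > 0" using Z_Re[of z] by simp
    then show "(1 + z) powr (- of_real s) = 1 / of_real (Gamma s) * transform (gamma_kernel s 1) z"
      using G gamma_transform_eq[OF s, of "1 + z"] by (simp add: transform_gamma_kernel)
  qed
qed

lemma one_plus_nonzero: "z \<in> Z \<Longrightarrow> 1 + z \<noteq> 0"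
  using Z_Re[of z] by (auto simp: complex_eq_iff)

lemma one_minus_resolvent: "z \<in> Z \<Longrightarrow> 1 - 1 / (1 + z) = z / (1 + z)"
  using one_plus_nonzero[of z] by (simp add: divide_simps)

lemma norm_one_plus_ge: "z \<in> Z \<Longrightarrow> 1 \<le> norm (1 + z)"
  using Z_Re[of z] complex_Re_le_cmod[of "1 + z"] by simp

lemma mult_bound_resolvent: "mult_bound (\<lambda>z. 1 / (1 + z)) 1"
  by (rule mult_bound_cong[OF mult_bound_resolvent_powr[of 1]])
     (auto simp: powr_minus_divide one_plus_nonzero)

lemma multiplier_resolvent: "multiplier (\<lambda>z. 1 / (1 + z))"
  unfolding multiplier_def using mult_bound_resolvent by blast

text \<open>
  Test the operator on \<open>exp (- t)\<close>, whose transform \<open>1 / (1 + z)\<close> has no zeros.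
\<close>

lemma multiplier_growth:
  assumes "multiplier F"
  obtains C where "\<And>z. z \<in> Z \<Longrightarrow> norm (F z) \<le> C * norm (1 + z)"
proof -
  from assms obtain C where F: "mult_bound F C" by (auto simp: multiplier_def)
  from F obtain h where h: "\<And>f. f \<in> L \<Longrightarrow> h f \<in> L"
    "\<And>f z. f \<in> L \<Longrightarrow> z \<in> Z \<Longrightarrow> transform (h f) z = F z * transform f z"
    by (rule mult_boundE) blast
  let ?k = "gamma_kernel 1 1"
  have k: "?k \<in> L"
    using integrable_gamma_kernel[of 1 1] S_add[OF zero_in_S] by (force simp: L_def gamma_kernel_def indicator_def)
  show ?thesis
  proof (rule that)
    fix z assume z: "z \<in> Z"
    have "Re (1 + z) > 0" using Z_Re[OF z] by simp
    then have "transform ?k z = 1 / (1 + z)"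
      using gamma_transform_eq[of 1 "1 + z"] by (simp add: transform_gamma_kernel powr_minus_divide one_plus_nonzero[OF z])
    then have "F z = transform (h ?k) z * (1 + z)"
      using h(2)[OF k z] one_plus_nonzero[OF z] by simp
    then show "norm (F z) \<le> (LINT t|lborel. norm (h ?k t)) * norm (1 + z)"
      using norm_transform_le[OF h(1)[OF k] z] by (simp add: norm_mult mult_right_mono)
  qed
qed

text \<open>
  The binomial coefficients of a positive exponent are absolutely summable, so norm \<open>1\<close> suffices for
  convergence of the series in the algebra of multipliers, even though \<open>1 - W\<close> may have zeros.
\<close>

lemma multiplier_binomial_series:
  assumes W: "mult_bound W 1" and W1: "\<And>z. z \<in> Z \<Longrightarrow> norm (W z) \<le> 1" and a: "a > 0"
  shows "multiplier (\<lambda>z. (1 - W z) powr of_real a)"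
proof -
  have "mult_bound (\<lambda>z. (1 - W z) powr of_real a) (\<Sum>m. \<bar>grunwald_coeff a m\<bar>)"
  proof (rule mult_bound_suminf)
    show "mult_bound (\<lambda>z. of_real (grunwald_coeff a m) * W z ^ m) \<bar>grunwald_coeff a m\<bar>" for m
      using mult_bound_cmult[OF mult_bound_power[OF W], of "of_real (grunwald_coeff a m)" m] by simp
  qed (use summable_abs_grunwald_coeff[OF a] grunwald_coeff_sums[OF a W1] in auto)
  then show ?thesis by (auto simp: multiplier_def)
qed

text \<open>
  The symbol is \<open>(z / (1 + z))\<^sup>s (1 + z)\<^sup>s\<^sup>-\<^sup>r\<close>. Its second factor belongs to a Gamma density and its first is
  \<open>(1 - 1 / (1 + z))\<^sup>s\<close>, a binomial series.
\<close>

lemma multiplier_powr_quotient: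
  assumes "0 \<le> s" "s \<le> r"
  shows "multiplier (\<lambda>z. z powr of_real s * (1 + z) powr (- of_real r))"
proof -
  have 1: "multiplier (\<lambda>z. z powr of_real s * (1 + z) powr (- of_real s))"
  proof (cases "s = 0")
    case True
    show ?thesis
      by (rule multiplier_cong[OF multiplier_const[of 1]]) (auto simp: True Z_nonzero one_plus_nonzero)
  next
    case False
    have "multiplier (\<lambda>z. (1 - 1 / (1 + z)) powr of_real s)"
    proof (rule multiplier_binomial_series[OF mult_bound_resolvent])
      show "norm (1 / (1 + z)) \<le> 1" if "z \<in> Z" for z
        using norm_one_plus_ge[OF that] one_plus_nonzero[OF that] by (simp add: norm_divide divide_simps)
    qed (use False assms in auto)
    then show ?thesis
    proof (rule multiplier_cong)
      fix z assume z: "z \<in> Z"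
      show "z powr of_real s * (1 + z) powr (- of_real s) = (1 - 1 / (1 + z)) powr of_real s"
        using powr_divide_halfplane(2)[of "1 + z" z "of_real s"] Z_Re[OF z] by (simp add: one_minus_resolvent[OF z])
    qed
  qed
  have 2: "multiplier (\<lambda>z. (1 + z) powr (- of_real (r - s)))"
  proof (cases "r = s")
    case True
    show ?thesis
      by (rule multiplier_cong[OF multiplier_const[of 1]]) (auto simp: True one_plus_nonzero)
  next
    case False
    then show ?thesis using mult_bound_resolvent_powr[of "r - s"] assms by (auto simp: multiplier_def)
  qed
  show ?thesis
    by (rule multiplier_cong[OF multiplier_mult[OF 1 2]])
       (simp add: mult.assoc flip: powr_add)
qed

lemma mult_bound_exp: "0 \<le> a \<Longrightarrow> mult_bound (\<lambda>z. exp (- (z * of_real a))) 1"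
  by (rule mult_bound_translation) (rule S_add)

lemma norm_exp_le: "z \<in> Z \<Longrightarrow> 0 \<le> a \<Longrightarrow> norm (exp (- (z * of_real a))) \<le> 1"
  using Z_Re[of z] by simp

lemma multiplier_one_minus_exp_powr: "a > 0 \<Longrightarrow> multiplier (\<lambda>z. (1 - exp (- z)) powr of_real a)"
  using multiplier_binomial_series[of "\<lambda>z. exp (- (z * of_real 1))" a] mult_bound_exp[of 1] norm_exp_le[of _ 1] by simp

end

section \<open>Symbols with moments\<close>

text \<open>
  The kernel of the integral remainder in Taylor's formula for \<open>exp (- a z)\<close>.
\<close>

definition truncated_power :: "real \<Rightarrow> nat \<Rightarrow> real \<Rightarrow> complex" where
  "truncated_power a n t = indicator {0..a} t *\<^sub>R of_real ((a - t) ^ n / fact n)"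

lemma integrable_truncated_power: "integrable lborel (truncated_power a n)"
proof -
  have "set_integrable lborel {0..a} (\<lambda>t. complex_of_real ((a - t) ^ n / fact n))"
    by (intro borel_integrable_atLeastAtMost' continuous_intros) auto
  then show ?thesis by (simp add: set_integrable_def truncated_power_def[abs_def])
qed

lemma transform_truncated_power_0:
  assumes "0 \<le> a"
  shows "z * transform (truncated_power a 0) z = 1 - exp (- (z * of_real a))"
proof -
  have "z * transform (truncated_power a 0) z = (LINT t|lborel. indicator {0..a} t *\<^sub>R (z * exp (- (z * of_real t))))"
    unfolding transform_def integral_mult_right_zero[symmetric]
    by (intro Bochner_Integration.integral_cong) (auto simp: truncated_power_def indicator_def)
  also have "\<dots> = (- exp (- (z * of_real a))) - (- exp (- (z * of_real 0)))"
  proof (rule integral_FTC_atLeastAtMost[OF assms])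
    fix t :: real
    show "((\<lambda>t. - exp (- (z * complex_of_real t))) has_vector_derivative z * exp (- (z * of_real t))) (at t within {0..a})"
      by (rule has_vector_derivative_real_field) (auto intro!: derivative_eq_intros)
  qed (intro continuous_intros, simp_all?)
  finally show ?thesis by simp
qed

lemma transform_truncated_power_Suc:
  assumes "0 \<le> a"
  shows "transform (truncated_power a n) z = of_real (a ^ Suc n / fact (Suc n)) - z * transform (truncated_power a (Suc n)) z"
proof -
  have i: "integrable lborel (\<lambda>t. exp (- (z * of_real t)) * truncated_power a n t)" for n
  proof -
    have "set_integrable lborel {0..a} (\<lambda>t. exp (- (z * of_real t)) * complex_of_real ((a - t) ^ n / fact n))"
      by (intro borel_integrable_atLeastAtMost' continuous_intros) auto
    then show ?thesis by (simp add: set_integrable_def truncated_power_def[abs_def] mult.commute)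
  qed
  have "transform (truncated_power a n) z + z * transform (truncated_power a (Suc n)) z =
     (LINT t|lborel. exp (- (z * of_real t)) * truncated_power a n t + z * (exp (- (z * of_real t)) * truncated_power a (Suc n) t))"
    unfolding transform_def using i by simp
  also have "\<dots> = (LINT t|lborel. indicator {0..a} t *\<^sub>R (exp (- (z * of_real t)) * of_real ((a - t) ^ n / fact n) +
       z * (exp (- (z * of_real t)) * of_real ((a - t) ^ Suc n / fact (Suc n)))))"
    by (intro Bochner_Integration.integral_cong) (auto simp: truncated_power_def indicator_def)
  also have "\<dots> = (- (of_real ((a - a) ^ Suc n / fact (Suc n)) * exp (- (z * of_real a)))) -
      (- (of_real ((a - 0) ^ Suc n / fact (Suc n)) * exp (- (z * of_real 0))))"
  proof (rule integral_FTC_atLeastAtMost[OF assms])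
    fix t :: real
    have alg: "- (q * (- z * e) + complex_of_real (- r) * e) = e * of_real r + z * (e * q)" for q e r
      by (simp add: algebra_simps)
    have 1: "((\<lambda>t. (a - t) ^ Suc n / fact (Suc n)) has_real_derivative - ((a - t) ^ n / fact n)) (at t within {0..a})"
      by (rule derivative_eq_intros refl | simp)+
    have 2: "((\<lambda>t. exp (- (z * complex_of_real t))) has_vector_derivative (- z * exp (- (z * of_real t)))) (at t within {0..a})"
      by (rule has_vector_derivative_real_field) (auto intro!: derivative_eq_intros)
    show "((\<lambda>t. - (of_real ((a - t) ^ Suc n / fact (Suc n)) * exp (- (z * complex_of_real t)))) has_vector_derivative
        (exp (- (z * of_real t)) * of_real ((a - t) ^ n / fact n) +
         z * (exp (- (z * of_real t)) * of_real ((a - t) ^ Suc n / fact (Suc n))))) (at t within {0..a})"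
      by (rule has_vector_derivative_eq_rhs[OF has_vector_derivative_minus[OF
            has_vector_derivative_mult[OF has_vector_derivative_of_real[OF 1] 2]] alg])
  qed (intro continuous_intros, simp_all?)
  finally show ?thesis by (simp add: eq_diff_eq)
qed

context transform_domain
begin

text \<open>
  \<open>F\<close> has a Taylor expansion of order \<open>n\<close> at \<open>0\<close> all of whose successive quotients are multipliers. For the
  transform of a measure this holds if the measure has \<open>n\<close> absolute moments: the quotients are the transforms of
  iterated tail integrals.
\<close>

primrec has_moments :: "nat \<Rightarrow> (complex \<Rightarrow> complex) \<Rightarrow> bool" where
  "has_moments 0 F \<longleftrightarrow> multiplier F"
| "has_moments (Suc n) F \<longleftrightarrow> multiplier F \<and> (\<exists>a G. has_moments n G \<and> (\<forall>z\<in>Z. F z = a + z * G z))"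

lemma has_moments_multiplier: "has_moments n F \<Longrightarrow> multiplier F"
  by (cases n) auto

lemma has_moments_Suc: "has_moments (Suc n) F \<Longrightarrow> has_moments n F"
proof (induction n arbitrary: F)
  case (Suc n)
  then obtain a G where "has_moments (Suc n) G" "\<forall>z\<in>Z. F z = a + z * G z" "multiplier F"
    by (auto simp only: has_moments.simps(2)[of "Suc n"])
  with Suc.IH[of G] show ?case by (auto simp only: has_moments.simps(2)[of n])
qed simp

lemma has_moments_cong: "has_moments n F \<Longrightarrow> (\<And>z. z \<in> Z \<Longrightarrow> G z = F z) \<Longrightarrow> has_moments n G"
  by (cases n) (auto intro: multiplier_cong)

lemma has_moments_const: "has_moments n (\<lambda>_. c)"
  by (induction n arbitrary: c) (auto intro!: exI[of _ "\<lambda>_. 0"])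

lemma has_moments_add: "has_moments n F \<Longrightarrow> has_moments n G \<Longrightarrow> has_moments n (\<lambda>z. F z + G z)"
proof (induction n arbitrary: F G)
  case (Suc n)
  from Suc.prems obtain a F' b G' where *: "has_moments n F'" "\<forall>z\<in>Z. F z = a + z * F' z"
    "has_moments n G'" "\<forall>z\<in>Z. G z = b + z * G' z" by auto
  from Suc.IH[OF *(1,3)] have "has_moments n (\<lambda>z. F' z + G' z)" .
  moreover have "\<forall>z\<in>Z. F z + G z = (a + b) + z * (F' z + G' z)" using * by (simp add: algebra_simps)
  ultimately show ?case using Suc.prems by (auto intro: multiplier_add)
qed (auto intro: multiplier_add)

lemma has_moments_mult: "has_moments n F \<Longrightarrow> has_moments n G \<Longrightarrow> has_moments n (\<lambda>z. F z * G z)"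
proof (induction n arbitrary: F G)
  case (Suc n)
  from Suc.prems obtain a F' b G' where *: "has_moments n F'" "\<forall>z\<in>Z. F z = a + z * F' z"
    "has_moments n G'" "\<forall>z\<in>Z. G z = b + z * G' z" by auto
  have "has_moments n (\<lambda>z. F' z * G z + a * G' z)"
    by (intro has_moments_add Suc.IH * has_moments_const has_moments_Suc[OF Suc.prems(2)])
  moreover have "\<forall>z\<in>Z. F z * G z = (a * b) + z * (F' z * G z + a * G' z)" using * by (simp add: algebra_simps)
  ultimately show ?case using Suc.prems by (auto intro: multiplier_mult)
qed (auto intro: multiplier_mult)

lemma has_moments_diff: "has_moments n F \<Longrightarrow> has_moments n G \<Longrightarrow> has_moments n (\<lambda>z. F z - G z)"
  using has_moments_add[OF _ has_moments_mult[OF has_moments_const[of n "-1"]], of F G] by simp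

lemma has_moments_power: "has_moments n F \<Longrightarrow> has_moments n (\<lambda>z. F z ^ k)"
  by (induction k) (auto intro: has_moments_mult has_moments_const)

lemma has_moments_sum: "(\<And>i. i \<in> A \<Longrightarrow> has_moments n (F i)) \<Longrightarrow> has_moments n (\<lambda>z. \<Sum>i\<in>A. F i z)"
  by (induction A rule: infinite_finite_induct) (auto intro: has_moments_add has_moments_const)

lemma has_moments_dilate: "has_moments n F \<Longrightarrow> c > 0 \<Longrightarrow> has_moments n (\<lambda>z. F (of_real c * z))"
proof (induction n arbitrary: F)
  case (Suc n)
  from Suc.prems obtain a F' where *: "has_moments n F'" "\<forall>z\<in>Z. F z = a + z * F' z" by auto
  have "has_moments n (\<lambda>z. of_real c * F' (of_real c * z))"
    by (intro has_moments_mult has_moments_const Suc.IH * Suc.prems)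
  moreover have "\<forall>z\<in>Z. F (of_real c * z) = a + z * (of_real c * F' (of_real c * z))"
    using * Z_scale Suc.prems by simp
  ultimately show ?case using Suc.prems by (auto intro: multiplier_dilate)
qed (auto intro: multiplier_dilate)

lemma multiplier_truncated_power: "multiplier (transform (truncated_power a n))"
  using mult_bound_convolution[OF integrable_truncated_power, of a n]
  by (auto simp: multiplier_def truncated_power_def)

lemma has_moments_truncated_power:
  assumes "0 \<le> a"
  shows "has_moments n (transform (truncated_power a m))"
proof (induction n arbitrary: m)
  case (Suc n)
  have "has_moments n (\<lambda>z. - 1 * transform (truncated_power a (Suc m)) z)"
    by (intro has_moments_mult has_moments_const Suc)
  moreover have "\<forall>z\<in>Z. transform (truncated_power a m) z = of_real (a ^ Suc m / fact (Suc m)) + z * (- 1 * transform (truncated_power a (Suc m)) z)"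
    using transform_truncated_power_Suc[OF assms, of m] by simp
  ultimately show ?case using multiplier_truncated_power by (simp only: has_moments.simps) blast
qed (simp add: multiplier_truncated_power)

lemma has_moments_exp:
  assumes "0 \<le> a"
  shows "has_moments n (\<lambda>z. exp (- (z * of_real a)))"
proof (cases n)
  case 0
  then show ?thesis using mult_bound_exp[OF assms] by (auto simp: multiplier_def)
next
  case (Suc n)
  have "has_moments n (\<lambda>z. - 1 * transform (truncated_power a 0) z)"
    by (intro has_moments_mult has_moments_const has_moments_truncated_power assms)
  moreover have "\<forall>z\<in>Z. exp (- (z * of_real a)) = 1 + z * (- 1 * transform (truncated_power a 0) z)"
    using transform_truncated_power_0[OF assms] by simp
  ultimately show ?thesis using mult_bound_exp[OF assms] Suc
    by (simp only: has_moments.simps multiplier_def) blast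
qed

lemma has_moments_exp_quotient: "has_moments n (\<lambda>z. (1 - exp (- z)) / z)"
proof (rule has_moments_cong[OF has_moments_truncated_power[of 1 n 0]])
  fix z assume "z \<in> Z"
  then have "z * transform (truncated_power 1 0) z / z = transform (truncated_power 1 0) z"
    using Z_nonzero[of z] by (intro nonzero_mult_div_cancel_left) auto
  then show "(1 - exp (- z)) / z = transform (truncated_power 1 0) z"
    using transform_truncated_power_0[of 1 z] by simp
qed simp

lemma at_0_within_Z_nontrivial: "at 0 within Z \<noteq> bot"
proof -
  have "(\<lambda>n. \<i> * of_real (1 / real (Suc n))) \<longlonglongrightarrow> \<i> * of_real 0"
    by (rule tendsto_mult[OF tendsto_const tendsto_of_real[OF LIMSEQ_Suc[OF lim_1_over_n]]])
  moreover have "\<i> * of_real (1 / real (Suc n)) \<in> Z - {0}" for n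
  proof -
    have "\<i> * of_real (1 / real (Suc n)) \<in> Z" by (rule Z_imaginary) simp
    then show ?thesis using Z_nonzero by blast
  qed
  ultimately have "0 islimpt Z"
    unfolding islimpt_sequential by (intro exI[of _ "\<lambda>n. \<i> * of_real (1 / real (Suc n))"]) simp
  then show ?thesis by (simp add: trivial_limit_within)
qed

lemma multiplier_times_z_tendsto_0:
  assumes "multiplier G"
  shows "((\<lambda>z. z * G z) \<longlongrightarrow> 0) (at 0 within Z)"
proof -
  obtain C where C: "\<And>z. z \<in> Z \<Longrightarrow> norm (G z) \<le> C * norm (1 + z)"
    using multiplier_growth[OF assms] by blast
  show ?thesis
  proof (rule Lim_null_comparison)
    show "\<forall>\<^sub>F z in at 0 within Z. norm (z * G z) \<le> norm z * (C * norm (1 + z))"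
      unfolding eventually_at_filter
      by (intro always_eventually) (auto simp: norm_mult intro!: mult_left_mono C)
    show "((\<lambda>z. norm z * (C * norm (1 + z))) \<longlongrightarrow> 0) (at 0 within Z)"
      by (auto intro!: tendsto_eq_intros)
  qed
qed

text \<open>
  A zero of order \<open>n\<close> annihilates the Taylor coefficients, so that the last quotient in the expansion is
  \<open>F / z\<^sup>n\<close>. With \<open>(1 + z) / z\<close> in place of \<open>1 / z\<close> the statement is stronger at high frequencies, and the
  induction stays simple: \<open>F z = z G z\<close> gives \<open>(1 + z) / z * F z = G z + F z\<close>, which has one moment less and a zero
  of one order less.
\<close>

theorem multiplier_divide_zero:
  assumes "has_moments n F" "F \<in> O[at 0 within Z](\<lambda>z. z ^ n)"
  shows "multiplier (\<lambda>z. ((1 + z) / z) ^ n * F z)"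
  using assms
proof (induction n arbitrary: F)
  case (Suc n)
  from Suc.prems obtain a G where G: "has_moments n G" and F: "\<And>z. z \<in> Z \<Longrightarrow> F z = a + z * G z" by auto
  have ev: "\<forall>\<^sub>F z in at 0 within Z. z \<in> Z \<and> z \<noteq> 0"
    by (simp add: eventually_at_filter)
  have "((\<lambda>z. z ^ Suc n) \<longlongrightarrow> 0) (at 0 within Z)" by (auto intro!: tendsto_eq_intros)
  then have F0: "(F \<longlongrightarrow> 0) (at 0 within Z)"
  proof -
    assume "((\<lambda>z. z ^ Suc n) \<longlongrightarrow> 0) (at 0 within Z)"
    then have "(\<lambda>z. z ^ Suc n) \<in> o[at 0 within Z](\<lambda>_. 1)" by (intro smalloI_tendsto) auto
    with Suc.prems(2) have "F \<in> o[at 0 within Z](\<lambda>_. 1)" by (rule landau_o.big_small_trans)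
    from smalloD_tendsto[OF this] show ?thesis by simp
  qed
  have "((\<lambda>z. a + z * G z) \<longlongrightarrow> 0) (at 0 within Z)"
    by (rule Lim_transform_eventually[OF F0]) (use ev in eventually_elim, simp add: F)
  moreover have "((\<lambda>z. a + z * G z) \<longlongrightarrow> a + 0) (at 0 within Z)"
    by (intro tendsto_add tendsto_const multiplier_times_z_tendsto_0 has_moments_multiplier[OF G])
  ultimately have "a = 0"
    using tendsto_unique[OF at_0_within_Z_nontrivial] by fastforce
  then have F: "F z = z * G z" if "z \<in> Z" for z using F that by simp
  have "(\<lambda>z. F z / z) \<in> O[at 0 within Z](\<lambda>z. z ^ Suc n / z)"
    using Suc.prems(2) by (rule landau_o.big.divide_right[rotated]) (use ev in eventually_elim, simp)
  also have "(\<lambda>z. F z / z) \<in> O[at 0 within Z](\<lambda>z. z ^ Suc n / z) \<longleftrightarrow> G \<in> O[at 0 within Z](\<lambda>z. z ^ n)"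
    by (rule landau_o.big.cong_ex; use ev in eventually_elim; simp add: F)
  finally have GO: "G \<in> O[at 0 within Z](\<lambda>z. z ^ n)" .
  have "(\<lambda>z::complex. z ^ Suc n) \<in> O[at 0 within Z](\<lambda>z. z ^ n)"
  proof -
    have "(\<lambda>z::complex. z) \<in> O[at 0 within Z](\<lambda>_. 1)"
      by (rule bigoI_tendsto[where c = 0]) (auto intro!: tendsto_eq_intros)
    from landau_o.big.mult[OF this landau_o.big_refl[of "\<lambda>z. z ^ n"]] show ?thesis by simp
  qed
  with Suc.prems(2) have "F \<in> O[at 0 within Z](\<lambda>z. z ^ n)" by (rule landau_o.big_trans)
  with GO have "(\<lambda>z. G z + F z) \<in> O[at 0 within Z](\<lambda>z. z ^ n)" by (rule sum_in_bigo)
  then have "multiplier (\<lambda>z. ((1 + z) / z) ^ n * (G z + F z))"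
    by (intro Suc.IH has_moments_add G has_moments_Suc[OF Suc.prems(1)])
  then show ?case
  proof (rule multiplier_cong)
    fix z assume z: "z \<in> Z"
    have "((1 + z) / z) ^ Suc n * F z = ((1 + z) / z) ^ n * ((1 + z) / z * z * G z)"
      by (simp only: F[OF z] power_Suc mult_ac)
    also have "(1 + z) / z * z = 1 + z" using Z_nonzero[OF z] by simp
    also have "(1 + z) * G z = G z + F z" by (simp add: F[OF z] distrib_right)
    finally show "((1 + z) / z) ^ Suc n * F z = ((1 + z) / z) ^ n * (G z + F z)" .
  qed
qed simp

text \<open>
  \<open>1 / (1 + z)\<close> cuts off high frequencies and \<open>z / (1 + z)\<close> cuts off low frequencies. They add up to \<open>1\<close>, so a
  large power of their sum contains a sufficient power of one of them in every term.
\<close>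

lemma multiplier_of_low_high:
  assumes "multiplier (\<lambda>z. (1 / (1 + z)) ^ a * F z)" "multiplier (\<lambda>z. (z / (1 + z)) ^ b * F z)"
  shows "multiplier F"
proof -
  have y: "multiplier (\<lambda>z. z / (1 + z))"
    by (rule multiplier_cong[OF multiplier_diff[OF multiplier_const[of 1] multiplier_resolvent]])
       (simp add: one_minus_resolvent)
  have 1: "multiplier G" if "multiplier (\<lambda>z. 1 / (1 + z) * G z)" "multiplier (\<lambda>z. (z / (1 + z)) ^ b * G z)" for G b
    using that(2)
  proof (induction b)
    case (Suc b)
    have "multiplier (\<lambda>z. (z / (1 + z)) ^ b * (1 / (1 + z) * G z) + (z / (1 + z)) ^ Suc b * G z)"
      by (intro multiplier_add multiplier_mult multiplier_power y that Suc.prems)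
    then have "multiplier (\<lambda>z. (z / (1 + z)) ^ b * G z)"
    proof (rule multiplier_cong)
      fix z assume z: "z \<in> Z"
      have "1 / (1 + z) + z / (1 + z) = 1" using one_minus_resolvent[OF z] by (simp add: algebra_simps)
      then have "(z / (1 + z)) ^ b * G z = (z / (1 + z)) ^ b * G z * (1 / (1 + z) + z / (1 + z))" by simp
      then show "(z / (1 + z)) ^ b * G z = (z / (1 + z)) ^ b * (1 / (1 + z) * G z) + (z / (1 + z)) ^ Suc b * G z"
        by (simp only: distrib_left power_Suc mult_ac)
    qed
    then show ?case by (rule Suc.IH)
  qed simp
  show ?thesis using assms(1)
  proof (induction a)
    case (Suc a)
    have "multiplier (\<lambda>z. (1 / (1 + z)) ^ a * F z)"
    proof (rule 1)
      show "multiplier (\<lambda>z. 1 / (1 + z) * ((1 / (1 + z)) ^ a * F z))"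
        using Suc.prems by (simp only: power_Suc mult.assoc)
      have "multiplier (\<lambda>z. (1 / (1 + z)) ^ a * ((z / (1 + z)) ^ b * F z))"
        by (intro multiplier_mult multiplier_power multiplier_resolvent assms)
      then show "multiplier (\<lambda>z. (z / (1 + z)) ^ b * ((1 / (1 + z)) ^ a * F z))"
        by (simp only: mult_ac)
    qed
    then show ?case by (rule Suc.IH)
  qed simp
qed

end

section \<open>Fractional splines\<close>

text \<open>
  \<open>exp (- z)\<close> lies in the closed unit disc, which touches the line \<open>Re = 1\<close> only in the point \<open>1\<close>.
\<close>

lemma Re_one_minus_exp:
  fixes z :: complex
  assumes "0 \<le> Re z" "1 - exp (- z) \<noteq> 0"
  shows "0 < Re (1 - exp (- z))"
proof (rule ccontr)
  assume "\<not> 0 < Re (1 - exp (- z))"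
  then have 1: "1 \<le> Re (exp (- z))" by simp
  have 2: "norm (exp (- z)) \<le> 1" using assms(1) by simp
  have "Re (exp (- z)) = 1" using 1 2 complex_Re_le_cmod[of "exp (- z)"] by linarith
  moreover have "Im (exp (- z)) = 0"
    using 2 power_mono[OF 2, of 2] calculation cmod_power2[of "exp (- z)"] by simp
  ultimately have "exp (- z) = 1" by (simp add: complex_eq_iff)
  then show False using assms(2) by simp
qed

text \<open>
  The Taylor polynomial of \<open>x\<^sup>a\<close> at \<open>x = 1\<close> of degree less than \<open>D\<close>.
\<close>

definition taylor_powr :: "real \<Rightarrow> nat \<Rightarrow> complex \<Rightarrow> complex" where
  "taylor_powr a D x = (\<Sum>m<D. of_real (grunwald_coeff a m) * (1 - x) ^ m)"

lemma taylor_powr_remainder_sums: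
  assumes a: "a > 0" and x: "norm (1 - x) \<le> 1"
  shows "(\<lambda>m. (1 - x) ^ D * (of_real (grunwald_coeff a (m + D)) * (1 - x) ^ m)) sums
    (x powr of_real a - taylor_powr a D x)"
proof -
  have "(\<lambda>m. of_real (grunwald_coeff a m) * (1 - x) ^ m) sums (x powr of_real a)"
    using grunwald_coeff_sums[OF a x] by simp
  from sums_split_initial_segment[OF this, of D]
  show ?thesis by (simp add: taylor_powr_def power_add mult_ac)
qed

lemma norm_taylor_powr_remainder:
  assumes a: "a > 0" and x: "norm (1 - x) \<le> 1"
  shows "norm (x powr of_real a - taylor_powr a D x) \<le> (\<Sum>m. \<bar>grunwald_coeff a (m + D)\<bar>) * norm (1 - x) ^ D"
proof -
  have s: "summable (\<lambda>m. \<bar>grunwald_coeff a (m + D)\<bar> * norm (1 - x) ^ D)"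
    using summable_ignore_initial_segment[OF summable_abs_grunwald_coeff[OF a], of D] by (rule summable_mult2)
  have le: "norm ((1 - x) ^ D * (of_real (grunwald_coeff a (m + D)) * (1 - x) ^ m)) \<le> \<bar>grunwald_coeff a (m + D)\<bar> * norm (1 - x) ^ D" for m
  proof -
    have "norm (1 - x) ^ m \<le> 1" using x by (simp add: power_le_one)
    then have "\<bar>grunwald_coeff a (m + D)\<bar> * norm (1 - x) ^ D * norm (1 - x) ^ m \<le> \<bar>grunwald_coeff a (m + D)\<bar> * norm (1 - x) ^ D * 1"
      by (intro mult_left_mono) auto
    then show ?thesis by (simp add: norm_mult norm_power mult_ac)
  qed
  have "norm (x powr of_real a - taylor_powr a D x) = norm (\<Sum>m. (1 - x) ^ D * (of_real (grunwald_coeff a (m + D)) * (1 - x) ^ m))"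
    using taylor_powr_remainder_sums[OF a x, of D] by (simp add: sums_iff)
  also have "\<dots> \<le> (\<Sum>m. \<bar>grunwald_coeff a (m + D)\<bar> * norm (1 - x) ^ D)"
    by (rule norm_suminf_le[OF le s])
  also have "\<dots> = (\<Sum>m. \<bar>grunwald_coeff a (m + D)\<bar>) * norm (1 - x) ^ D"
    by (rule suminf_mult2[symmetric, OF summable_ignore_initial_segment[OF summable_abs_grunwald_coeff[OF a]]])
  finally show ?thesis .
qed

text \<open>
  The transform of the indicator function of the unit interval.
\<close>

definition box_symbol :: "complex \<Rightarrow> complex" where
  "box_symbol z = (1 - exp (- z)) / z"

text \<open>
  The transform of the average of two point masses, the refinement mask of \<open>box_symbol\<close>: it is the quotient of
  \<open>box_symbol (2 z)\<close> and \<open>box_symbol z\<close>.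
\<close>

definition mean_symbol :: "complex \<Rightarrow> complex" where
  "mean_symbol z = (1 + exp (- z)) / 2"

text \<open>
  The symbol of a fractional B-spline. On the right half-plane it equals \<open>box_symbol z powr a\<close>; with the
  two powers apart it is visibly a product of the Gruenwald generating function and a fractional integral.
\<close>

definition spline_symbol :: "real \<Rightarrow> complex \<Rightarrow> complex" where
  "spline_symbol a z = (1 - exp (- z)) powr of_real a * z powr (- of_real a)"

definition spline_defect :: "real \<Rightarrow> nat \<Rightarrow> complex \<Rightarrow> complex" where
  "spline_defect a D z = spline_symbol a z - taylor_powr a D (box_symbol z)"

lemma spline_symbol_eq_powr:
  assumes "0 \<le> Re z"
  shows "spline_symbol a z = box_symbol z powr of_real a"
proof (cases "1 - exp (- z) = 0")
  case False
  show ?thesis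
    unfolding spline_symbol_def box_symbol_def
    by (rule powr_divide_halfplane(1)[symmetric, OF Re_one_minus_exp[OF assms False] assms])
qed (simp add: spline_symbol_def box_symbol_def)

lemma spline_symbol_refinement:
  assumes z: "0 \<le> Re z"
  shows "spline_symbol a (2 * z) = mean_symbol z powr of_real a * spline_symbol a z"
proof -
  \<comment> \<open>At a zero of \<open>w\<close> both sides vanish; elsewhere \<open>Re w > 0\<close>, so that the powers are multiplicative.\<close>
  define w where "w = 1 - exp (- z)"
  have eq: "1 - exp (- (2 * z)) = 2 * (w * mean_symbol z)"
    by (simp add: w_def mean_symbol_def algebra_simps flip: exp_double exp_add)
  show ?thesis
  proof (cases "w = 0")
    case True
    then show ?thesis using eq by (simp add: spline_symbol_def w_def)
  next
    case False
    have Rw: "Re w > 0" unfolding w_def by (rule Re_one_minus_exp[OF z]) (use False w_def in simp)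
    have "\<bar>Re (exp (- z))\<bar> \<le> 1" using abs_Re_le_cmod[of "exp (- z)"] z by (simp add: order_trans)
    then have Rv: "Re (mean_symbol z) \<ge> 0" by (simp add: mean_symbol_def)
    have "\<bar>Re (exp (- (2 * z)))\<bar> \<le> 1" using abs_Re_le_cmod[of "exp (- (2 * z))"] z by (simp add: order_trans)
    then have "Re (1 - exp (- (2 * z))) \<ge> 0" by simp
    then have R2: "Re (w * mean_symbol z) \<ge> 0" unfolding eq by simp
    have "spline_symbol a (2 * z) = (2 powr of_real a * (w powr of_real a * mean_symbol z powr of_real a)) *
       (2 powr (- of_real a) * z powr (- of_real a))"
      unfolding spline_symbol_def eq
      using powr_mult_halfplane[OF _ R2, of 2] powr_mult_halfplane[OF Rw Rv] powr_mult_halfplane[OF _ z, of 2] by simp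
    also have "\<dots> = (2 powr of_real a * 2 powr (- of_real a)) * (mean_symbol z powr of_real a * (w powr of_real a * z powr (- of_real a)))"
      by (simp only: mult_ac)
    also have "(2::complex) powr of_real a * 2 powr (- of_real a) = 1" by (simp flip: powr_add)
    finally show ?thesis by (simp add: spline_symbol_def w_def)
  qed
qed

lemma norm_one_minus_box_symbol:
  assumes "z \<noteq> 0"
  shows "norm (1 - box_symbol z) \<le> exp \<bar>Re z\<bar> * norm z"
proof -
  have "norm (exp (- z) - (\<Sum>k\<le>1. (- z) ^ k / fact k)) \<le> exp \<bar>Re (- z)\<bar> * norm (- z) ^ Suc 1 / fact 1"
    by (rule Taylor_exp)
  then have "norm (exp (- z) - 1 + z) \<le> exp \<bar>Re z\<bar> * (norm z)\<^sup>2"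
    by (simp add: algebra_simps power2_eq_square)
  moreover have "1 - box_symbol z = (exp (- z) - 1 + z) / z"
    using assms by (simp add: box_symbol_def field_simps)
  ultimately show ?thesis
    using assms by (simp add: norm_divide divide_le_eq power2_eq_square mult.assoc)
qed

lemma bigo_power_mono:
  assumes "m \<le> n"
  shows "(\<lambda>z::complex. z ^ n) \<in> O[at 0 within A](\<lambda>z. z ^ m)"
proof -
  have "(\<lambda>z::complex. z ^ (n - m)) \<in> O[at 0 within A](\<lambda>_. 1)"
    by (rule bigoI_tendsto[where c = "0 ^ (n - m)"]) (auto intro!: tendsto_eq_intros)
  from landau_o.big.mult[OF this landau_o.big_refl[of "\<lambda>z. z ^ m"]] show ?thesis
    using assms by (simp flip: power_add)
qed

lemma tendsto_0_of_bigo_z: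
  assumes "f \<in> O[at 0 within A](\<lambda>z::complex. z)"
  shows "(f \<longlongrightarrow> 0) (at 0 within A)"
proof -
  have "((\<lambda>z::complex. z) \<longlongrightarrow> 0) (at 0 within A)" by (rule tendsto_ident_at)
  then have "(\<lambda>z::complex. z) \<in> o[at 0 within A](\<lambda>_. 1)" by (intro smalloI_tendsto) auto
  with assms have "f \<in> o[at 0 within A](\<lambda>_. 1)" by (rule landau_o.big_small_trans)
  from smalloD_tendsto[OF this] show ?thesis by simp
qed

lemma one_minus_box_symbol_bigo: "(\<lambda>z. 1 - box_symbol z) \<in> O[at 0 within A](\<lambda>z. z)"
proof (rule bigoI)
  show "\<forall>\<^sub>F z in at 0 within A. norm (1 - box_symbol z) \<le> exp 1 * norm z"
    unfolding eventually_at
  proof (intro exI[of _ 1] conjI ballI impI)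
    fix z :: complex assume z: "z \<noteq> 0 \<and> dist z 0 < 1"
    then have "\<bar>Re z\<bar> \<le> 1" using abs_Re_le_cmod[of z] by simp
    then have "exp \<bar>Re z\<bar> * norm z \<le> exp 1 * norm z" by (intro mult_right_mono) auto
    then show "norm (1 - box_symbol z) \<le> exp 1 * norm z"
      using norm_one_minus_box_symbol[of z] z by (auto intro: order_trans)
  qed simp
qed

lemma box_symbol_bigo: "box_symbol \<in> O[at 0 within A](\<lambda>_. 1)"
proof -
  have "((\<lambda>z. 1 - (1 - box_symbol z)) \<longlongrightarrow> 1 - 0) (at 0 within A)"
    by (intro tendsto_diff tendsto_const tendsto_0_of_bigo_z one_minus_box_symbol_bigo)
  then show ?thesis by (intro bigoI_tendsto[where c = 1]) auto
qed

lemma one_minus_mean_symbol: "z \<noteq> 0 \<Longrightarrow> 1 - mean_symbol z = z * (box_symbol z / 2)"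
  by (simp add: mean_symbol_def box_symbol_def field_simps)

lemma one_minus_mean_symbol_bigo: "(\<lambda>z. 1 - mean_symbol z) \<in> O[at 0 within A](\<lambda>z. z)"
proof -
  have "(\<lambda>z. z * (box_symbol z / 2)) \<in> O[at 0 within A](\<lambda>z. z * 1)"
    by (intro landau_o.big.mult landau_o.big_refl) (use box_symbol_bigo in simp)
  moreover have "\<forall>\<^sub>F z in at 0 within A. z * (box_symbol z / 2) = 1 - mean_symbol z"
    unfolding eventually_at_filter
    by (intro always_eventually) (auto simp: box_symbol_def mean_symbol_def field_simps)
  ultimately show ?thesis using landau_o.big.in_cong by fastforce
qed

lemma taylor_powr_remainder_bigo:
  assumes a: "a > 0" and f: "(\<lambda>z. 1 - f z) \<in> O[at 0 within A](\<lambda>z. z)"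
  shows "(\<lambda>z. f z powr of_real a - taylor_powr a D (f z)) \<in> O[at 0 within A](\<lambda>z. z ^ D)"
proof -
  have "((\<lambda>z. norm (1 - f z)) \<longlongrightarrow> 0) (at 0 within A)"
    using tendsto_0_of_bigo_z[OF f] by (rule tendsto_norm_zero)
  then have "\<forall>\<^sub>F z in at 0 within A. norm (1 - f z) < 1"
    by (rule order_tendstoD) simp
  then have "\<forall>\<^sub>F z in at 0 within A. norm (f z powr of_real a - taylor_powr a D (f z))
      \<le> (\<Sum>m. \<bar>grunwald_coeff a (m + D)\<bar>) * norm ((1 - f z) ^ D)"
    by eventually_elim (use norm_taylor_powr_remainder[OF a] in \<open>simp add: norm_power\<close>)
  then have "(\<lambda>z. f z powr of_real a - taylor_powr a D (f z)) \<in> O[at 0 within A](\<lambda>z. (1 - f z) ^ D)"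
    by (rule bigoI)
  also have "(\<lambda>z. (1 - f z) ^ D) \<in> O[at 0 within A](\<lambda>z. z ^ D)"
    using f by (rule landau_o.big_power)
  finally show ?thesis .
qed

lemma powr_times_power:
  fixes z :: complex
  assumes "z \<noteq> 0"
  shows "z ^ n * z powr s = z powr (of_nat n + s)"
  using assms by (simp add: powr_add powr_nat')

context transform_domain
begin

lemma spline_defect_bigo:
  assumes a: "a > 0"
  shows "spline_defect a D \<in> O[at 0 within Z](\<lambda>z. z ^ D)"
proof -
  have "(\<lambda>z. box_symbol z powr of_real a - taylor_powr a D (box_symbol z)) \<in> O[at 0 within Z](\<lambda>z. z ^ D)"
    by (rule taylor_powr_remainder_bigo[OF a one_minus_box_symbol_bigo])
  moreover have "\<forall>\<^sub>F z in at 0 within Z. box_symbol z powr of_real a - taylor_powr a D (box_symbol z) = spline_defect a D z"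
    by (simp add: eventually_at_filter spline_defect_def spline_symbol_eq_powr Z_Re)
  ultimately show ?thesis using landau_o.big.in_cong by fastforce
qed

lemma filterlim_scale_within_Z:
  assumes "c > 0"
  shows "filterlim (\<lambda>z. of_real c * z) (at 0 within Z) (at 0 within Z)"
  unfolding filterlim_at
proof
  show "\<forall>\<^sub>F z in at 0 within Z. of_real c * z \<in> Z \<and> of_real c * z \<noteq> 0"
    using assms by (simp add: eventually_at_filter Z_scale)
  show "((\<lambda>z. of_real c * z) \<longlongrightarrow> 0) (at 0 within Z)"
    by (auto intro!: tendsto_eq_intros)
qed

lemma bigo_dilate:
  assumes "F \<in> O[at 0 within Z](\<lambda>z. z ^ n)" "c > 0"
  shows "(\<lambda>z. F (of_real c * z)) \<in> O[at 0 within Z](\<lambda>z. z ^ n)"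
proof -
  have "(\<lambda>z. F (of_real c * z)) \<in> O[at 0 within Z](\<lambda>z. (of_real c * z) ^ n)"
    by (rule landau_o.big.compose[OF assms(1) filterlim_scale_within_Z[OF assms(2)]])
  then show ?thesis using assms(2) by (simp add: power_mult_distrib)
qed

lemma has_moments_box_symbol: "has_moments n box_symbol"
  using has_moments_exp_quotient[of n] by (simp add: box_symbol_def[abs_def])

lemma has_moments_mean_symbol: "has_moments n mean_symbol"
proof -
  have "has_moments n (\<lambda>z. (1 + exp (- (z * of_real 1))) * (1 / 2))"
    by (intro has_moments_mult has_moments_add has_moments_const has_moments_exp) simp
  then show ?thesis by (simp add: mean_symbol_def[abs_def])
qed

lemma has_moments_taylor_powr: "has_moments n F \<Longrightarrow> has_moments n (\<lambda>z. taylor_powr a D (F z))"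
  unfolding taylor_powr_def
  by (intro has_moments_sum has_moments_mult has_moments_power has_moments_diff has_moments_const)

lemma norm_mean_symbol: "z \<in> Z \<Longrightarrow> norm (mean_symbol z) \<le> 1"
  using norm_triangle_ineq[of 1 "exp (- z)"] norm_exp_le[of z 1]
  by (simp add: mean_symbol_def norm_divide del: norm_exp_eq_Re)

lemma mult_bound_one_minus_mean_symbol: "mult_bound (\<lambda>z. 1 - mean_symbol z) 1"
proof -
  have "mult_bound (\<lambda>z. 1 / 2 * (1 + (- 1) * exp (- (z * of_real 1)))) (norm (1 / 2 :: complex) * (norm (1 :: complex) + norm (- 1 :: complex) * 1))"
    by (intro mult_bound_cmult mult_bound_add mult_bound_const mult_bound_exp) simp
  moreover have "1 / 2 * (1 + (- 1) * exp (- (z * of_real 1))) = 1 - mean_symbol z" for z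
    by (simp add: mean_symbol_def field_simps)
  ultimately show ?thesis by (simp only: norm_one) simp
qed

lemma norm_one_minus_mean_symbol: "z \<in> Z \<Longrightarrow> norm (1 - mean_symbol z) \<le> 1"
  using norm_triangle_ineq4[of 1 "exp (- z)"] norm_exp_le[of z 1]
  by (simp add: mean_symbol_def norm_divide field_simps del: norm_exp_eq_Re)

lemma multiplier_mean_symbol_powr: "a > 0 \<Longrightarrow> multiplier (\<lambda>z. mean_symbol z powr of_real a)"
  using multiplier_binomial_series[OF mult_bound_one_minus_mean_symbol norm_one_minus_mean_symbol, of a] by simp

text \<open>
  The remainder of the binomial series is \<open>(1 - v)\<^sup>D\<close> times another absolutely convergent series in \<open>1 - v\<close>, for
  \<open>v = mean_symbol\<close>, and \<open>1 - v = z * box_symbol z / 2\<close> is divisible by \<open>z\<close>. This argument is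
  not available for \<open>box_symbol\<close>, since \<open>1 - box_symbol\<close> belongs to a measure of total variation \<open>2\<close>.
\<close>

lemma multiplier_mean_symbol_remainder:
  assumes a: "a > 0"
  shows "multiplier (\<lambda>z. (mean_symbol z powr of_real a - taylor_powr a D (mean_symbol z)) / z ^ D)"
proof -
  let ?R = "\<lambda>z. \<Sum>m. of_real (grunwald_coeff a (m + D)) * (1 - mean_symbol z) ^ m"
  note sm = summable_ignore_initial_segment[OF summable_abs_grunwald_coeff[OF a], of D]
  have Rs: "(\<lambda>m. of_real (grunwald_coeff a (m + D)) * (1 - mean_symbol z) ^ m) sums ?R z" if z: "z \<in> Z" for z
  proof (rule summable_sums, rule summable_comparison_test'[OF sm, of 0])
    fix m
    show "norm (of_real (grunwald_coeff a (m + D)) * (1 - mean_symbol z) ^ m) \<le> \<bar>grunwald_coeff a (m + D)\<bar>"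
      using norm_one_minus_mean_symbol[OF z] by (simp add: norm_mult norm_power mult_left_le power_le_one)
  qed
  have "mult_bound ?R (\<Sum>m. \<bar>grunwald_coeff a (m + D)\<bar>)"
  proof (rule mult_bound_suminf[OF _ sm Rs])
    show "mult_bound (\<lambda>z. of_real (grunwald_coeff a (m + D)) * (1 - mean_symbol z) ^ m) \<bar>grunwald_coeff a (m + D)\<bar>" for m
      using mult_bound_cmult[OF mult_bound_power[OF mult_bound_one_minus_mean_symbol], of "of_real (grunwald_coeff a (m + D))" m]
      by simp
  qed
  then have "multiplier ?R" by (auto simp: multiplier_def)
  then have "multiplier (\<lambda>z. (box_symbol z * (1 / 2)) ^ D * ?R z)"
    by (intro multiplier_mult multiplier_power multiplier_const has_moments_multiplier[OF has_moments_box_symbol])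
  then show ?thesis
  proof (rule multiplier_cong)
    fix z assume z: "z \<in> Z"
    have "mean_symbol z powr of_real a - taylor_powr a D (mean_symbol z) = (1 - mean_symbol z) ^ D * ?R z"
      using taylor_powr_remainder_sums[OF a norm_one_minus_mean_symbol[OF z], of D] sums_mult[OF Rs[OF z], of "(1 - mean_symbol z) ^ D"]
      by (rule sums_unique2)
    also have "\<dots> = z ^ D * ((box_symbol z * (1 / 2)) ^ D * ?R z)"
      by (simp only: one_minus_mean_symbol[OF Z_nonzero[OF z]] power_mult_distrib) (simp add: power_divide)
    finally show "(mean_symbol z powr of_real a - taylor_powr a D (mean_symbol z)) / z ^ D = (box_symbol z * (1 / 2)) ^ D * ?R z"
      using Z_nonzero[OF z] by simp
  qed
qed

text \<open>
  The spline symbol satisfies the refinement equation exactly; its Taylor polynomial fails it by this much.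
\<close>

definition refinement_defect :: "real \<Rightarrow> nat \<Rightarrow> complex \<Rightarrow> complex" where
  "refinement_defect a D z = spline_defect a D (2 * z) - mean_symbol z powr of_real a * spline_defect a D z"

text \<open>
  Up to the remainder of \<open>v\<^sup>a\<close> for \<open>v = mean_symbol\<close>, the defect is \<open>P (v z) P (u z) - P (u (2 z))\<close> with \<open>P\<close> the Taylor
  polynomial and \<open>u = box_symbol\<close>. That expression has moments of all orders, and it vanishes to order \<open>D\<close> because each
  \<open>P\<close> agrees to this order with the power function, which is multiplicative.
\<close>

lemma multiplier_refinement_defect:
  assumes a: "a > 0"
  shows "multiplier (\<lambda>z. refinement_defect a D z / z ^ D)"
proof -
  let ?V = "\<lambda>z. mean_symbol z powr of_real a"
  let ?P = "taylor_powr a D"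
  define B where "B = (\<lambda>z. ?P (mean_symbol z) * ?P (box_symbol z) - ?P (box_symbol (of_real 2 * z)))"
  have split: "refinement_defect a D z = (?V z - ?P (mean_symbol z)) * ?P (box_symbol z) + B z" if "z \<in> Z" for z
    using spline_symbol_refinement[OF Z_Re[OF that], of a]
    by (simp add: refinement_defect_def spline_defect_def B_def algebra_simps)
  have mB: "has_moments D B"
    unfolding B_def
    by (intro has_moments_diff has_moments_mult has_moments_taylor_powr has_moments_box_symbol has_moments_mean_symbol
        has_moments_dilate) simp
  have V1: "?V \<in> O[at 0 within Z](\<lambda>_. 1)"
  proof (rule bigoI[where c = 1])
    have "norm (?V z) \<le> 1" if "z \<in> Z" for z
      using norm_mean_symbol[OF that] a by (simp add: norm_powr_real_powr' powr_le1)
    then show "\<forall>\<^sub>F z in at 0 within Z. norm (?V z) \<le> 1 * norm (1::complex)"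
      by (simp add: eventually_at_filter)
  qed
  have P1: "(\<lambda>z. ?P (box_symbol z)) \<in> O[at 0 within Z](\<lambda>_. 1)"
  proof -
    have "(\<lambda>z. of_real (grunwald_coeff a m) * (1 - box_symbol z) ^ m) \<in> O[at 0 within Z](\<lambda>_. 1)" for m
    proof -
      have "(\<lambda>z. of_real (grunwald_coeff a m) * (1 - box_symbol z) ^ m) \<in> O[at 0 within Z](\<lambda>z. 1 * z ^ m)"
        by (intro landau_o.big.mult landau_o.big_power one_minus_box_symbol_bigo) simp
      also have "(\<lambda>z::complex. 1 * z ^ m) \<in> O[at 0 within Z](\<lambda>z. z ^ 0)"
        using bigo_power_mono[of 0 m] by simp
      finally show ?thesis by simp
    qed
    then show ?thesis unfolding taylor_powr_def by (intro big_sum_in_bigo)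
  qed
  have "(\<lambda>z. spline_defect a D (of_real 2 * z) - ?V z * spline_defect a D z - (?V z - ?P (mean_symbol z)) * ?P (box_symbol z))
     \<in> O[at 0 within Z](\<lambda>z. z ^ D)"
  proof (intro sum_in_bigo)
    show "(\<lambda>z. spline_defect a D (of_real 2 * z)) \<in> O[at 0 within Z](\<lambda>z. z ^ D)"
      by (intro bigo_dilate spline_defect_bigo a) simp
    show "(\<lambda>z. ?V z * spline_defect a D z) \<in> O[at 0 within Z](\<lambda>z. z ^ D)"
      using landau_o.big.mult[OF V1 spline_defect_bigo[OF a, of D]] by simp
    show "(\<lambda>z. (?V z - ?P (mean_symbol z)) * ?P (box_symbol z)) \<in> O[at 0 within Z](\<lambda>z. z ^ D)"
      using landau_o.big.mult[OF taylor_powr_remainder_bigo[OF a one_minus_mean_symbol_bigo, of D] P1] by simp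
  qed
  moreover have "\<forall>\<^sub>F z in at 0 within Z. spline_defect a D (of_real 2 * z) - ?V z * spline_defect a D z
      - (?V z - ?P (mean_symbol z)) * ?P (box_symbol z) = B z"
    using split by (simp add: eventually_at_filter refinement_defect_def algebra_simps)
  ultimately have "B \<in> O[at 0 within Z](\<lambda>z. z ^ D)"
    using landau_o.big.in_cong by fastforce
  then have "multiplier (\<lambda>z. (1 / (1 + z)) ^ D * (((1 + z) / z) ^ D * B z))"
    by (intro multiplier_mult multiplier_power multiplier_resolvent multiplier_divide_zero mB)
  then have "multiplier (\<lambda>z. (?V z - ?P (mean_symbol z)) / z ^ D * ?P (box_symbol z) + (1 / (1 + z)) ^ D * (((1 + z) / z) ^ D * B z))"
    by (rule multiplier_add[OF multiplier_mult[OF multiplier_mean_symbol_remainder[OF a]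
        has_moments_multiplier[OF has_moments_taylor_powr[OF has_moments_box_symbol]]]])
  then show ?thesis
  proof (rule multiplier_cong)
    fix z assume z: "z \<in> Z"
    have "(1 / (1 + z)) ^ D * (((1 + z) / z) ^ D * B z) = B z / z ^ D"
      using one_plus_nonzero[OF z] Z_nonzero[OF z] by (simp add: power_divide)
    then show "refinement_defect a D z / z ^ D =
       (?V z - ?P (mean_symbol z)) / z ^ D * ?P (box_symbol z) + (1 / (1 + z)) ^ D * (((1 + z) / z) ^ D * B z)"
      by (simp add: split[OF z] add_divide_distrib)
  qed
qed

primrec refinement_product :: "real \<Rightarrow> nat \<Rightarrow> complex \<Rightarrow> complex" where
  "refinement_product a 0 z = 1"
| "refinement_product a (Suc n) z = refinement_product a n z * mean_symbol (of_real ((1/2) ^ Suc n) * z) powr of_real a"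

lemma mult_bound_refinement_product:
  assumes "mult_bound (\<lambda>z. mean_symbol z powr of_real a) C"
  shows "mult_bound (refinement_product a n) (C ^ n)"
proof (induction n)
  case 0
  then show ?case using mult_bound_const[of 1] by simp
next
  case (Suc n)
  have "mult_bound (\<lambda>z. refinement_product a n z * mean_symbol (of_real ((1/2) ^ Suc n) * z) powr of_real a) (C ^ n * C)"
    by (rule mult_bound_mult[OF Suc mult_bound_dilate[OF assms]]) simp
  then show ?case by (simp add: mult.commute)
qed

lemma norm_refinement_product: "a > 0 \<Longrightarrow> z \<in> Z \<Longrightarrow> norm (refinement_product a n z) \<le> 1"
proof (induction n)
  case (Suc n)
  have "of_real ((1/2) ^ Suc n) * z \<in> Z" using Suc.prems by (intro Z_scale) auto
  from norm_mean_symbol[OF this] show ?case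
    using Suc by (simp add: norm_mult norm_powr_real_powr' powr_le1 mult_le_one)
qed simp

lemma spline_defect_telescope:
  "(\<Sum>i<n. refinement_product a i z * refinement_defect a D (of_real ((1/2) ^ Suc i) * z)) =
    spline_defect a D z - refinement_product a n z * spline_defect a D (of_real ((1/2) ^ n) * z)"
proof (induction n)
  case (Suc n)
  have "2 * (of_real ((1/2) ^ Suc n) * z) = of_real ((1/2) ^ n) * z" by simp
  then show ?case using Suc by (simp only: sum.lessThan_Suc refinement_defect_def refinement_product.simps) (simp add: algebra_simps)
qed simp

text \<open>
  In the telescoped sum the dilation by \<open>2\<^sup>-\<^sup>i\<close> contributes a factor \<open>2\<^sup>-\<^sup>i\<^sup>D\<close> upon division by \<open>z\<^sup>D\<close>, which
  outweighs the growth \<open>C\<^sup>i\<close> of the norms of the refinement products.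
\<close>

lemma multiplier_spline_defect_divide_power:
  assumes a: "a > 0" and D: "D > 0" and C: "mult_bound (\<lambda>z. mean_symbol z powr of_real a) C" "C < 2 ^ D"
  shows "multiplier (\<lambda>z. spline_defect a D z / z ^ D)"
proof -
  from multiplier_refinement_defect[OF a, of D] obtain M where M: "mult_bound (\<lambda>z. refinement_defect a D z / z ^ D) M"
    by (auto simp: multiplier_def)
  define F where "F = (\<lambda>i z. refinement_product a i z * (of_real (((1/2) ^ Suc i) ^ D) *
     (refinement_defect a D (of_real ((1/2) ^ Suc i) * z) / (of_real ((1/2) ^ Suc i) * z) ^ D)))"
  define K where "K = (\<lambda>i::nat. C ^ i * (((1/2) ^ Suc i) ^ D * M))"
  have "mult_bound (\<lambda>z. spline_defect a D z / z ^ D) (suminf K)"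
  proof (rule mult_bound_suminf)
    fix i
    have "mult_bound (F i) (C ^ i * (norm (complex_of_real (((1/2) ^ Suc i) ^ D)) * M))"
      unfolding F_def
      by (intro mult_bound_mult mult_bound_refinement_product C mult_bound_const mult_bound_dilate[OF M]) simp
    then show "mult_bound (F i) (K i)" by (simp add: K_def norm_power norm_mult norm_divide)
  next
    have K: "K = (\<lambda>i. (1/2) ^ D * M * (C / 2 ^ D) ^ i)"
      by (auto simp: K_def fun_eq_iff power_divide power_mult_distrib simp flip: power_mult) (simp add: mult.commute)
    show "summable K"
      unfolding K using C mult_bound_nonneg[OF C(1)] by (intro summable_mult summable_geometric) simp
  next
    fix z assume z: "z \<in> Z"
    have F: "F i z = refinement_product a i z * refinement_defect a D (of_real ((1/2) ^ Suc i) * z) / z ^ D" for i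
    proof -
      have cancel: "of_real (c ^ D) * (x / (of_real c * z) ^ D) = x / z ^ D" if "c \<noteq> 0" for c :: real and x
        using that by (simp add: power_mult_distrib)
      show ?thesis unfolding F_def by (subst cancel) simp_all
    qed
    have zn: "filterlim (\<lambda>n. of_real ((1/2) ^ n) * z) (at 0 within Z) sequentially"
      unfolding filterlim_at
    proof
      show "\<forall>\<^sub>F n in sequentially. of_real ((1/2) ^ n) * z \<in> Z \<and> of_real ((1/2) ^ n) * z \<noteq> 0"
        using Z_scale[OF z, of "(1/2) ^ _"] Z_nonzero[OF z] by simp
      have "(\<lambda>n. of_real ((1/2) ^ n) * z) \<longlonglongrightarrow> of_real 0 * z"
        by (intro tendsto_mult tendsto_of_real tendsto_const LIMSEQ_realpow_zero) auto
      then show "(\<lambda>n. of_real ((1/2) ^ n) * z) \<longlonglongrightarrow> 0" by simp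
    qed
    have "spline_defect a D \<in> O[at 0 within Z](\<lambda>z. z)"
      using landau_o.big_trans[OF spline_defect_bigo[OF a, of D] bigo_power_mono[of 1 D]] D by simp
    then have "(\<lambda>n. spline_defect a D (of_real ((1/2) ^ n) * z)) \<longlonglongrightarrow> 0"
      by (rule filterlim_compose[OF tendsto_0_of_bigo_z zn])
    then have "(\<lambda>n. norm (spline_defect a D (of_real ((1/2) ^ n) * z))) \<longlonglongrightarrow> 0"
      by (rule tendsto_norm_zero)
    then have "(\<lambda>n. refinement_product a n z * spline_defect a D (of_real ((1/2) ^ n) * z)) \<longlonglongrightarrow> 0"
      by (rule Lim_null_comparison[rotated])
         (use norm_refinement_product[OF a z] in \<open>auto simp: norm_mult intro!: mult_left_le_one_le always_eventually\<close>)
    then have "(\<lambda>n. (spline_defect a D z - refinement_product a n z * spline_defect a D (of_real ((1/2) ^ n) * z)) / z ^ D)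
       \<longlonglongrightarrow> (spline_defect a D z - 0) / z ^ D"
      using Z_nonzero[OF z] by (intro tendsto_divide tendsto_diff tendsto_const) auto
    then show "(\<lambda>i. F i z) sums (spline_defect a D z / z ^ D)"
      unfolding sums_def F by (simp only: flip: sum_divide_distrib spline_defect_telescope) simp
  qed
  then show ?thesis by (auto simp: multiplier_def)
qed

text \<open>
  At low frequencies \<open>z\<^sup>-\<^sup>s\<close> is absorbed by the division by \<open>z\<^sup>D\<close>; at high frequencies both summands of the defect
  times \<open>z\<^sup>-\<^sup>s\<close> are multipliers once the singularity at \<open>0\<close> is cut off.
\<close>

lemma multiplier_spline_defect:
  assumes a: "a > 0" and s: "0 \<le> s"
  obtains D where "n \<le> D" "multiplier (\<lambda>z. spline_defect a D z * z powr (- of_real s))"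
proof -
  obtain C where C: "mult_bound (\<lambda>z. mean_symbol z powr of_real a) C"
    using multiplier_mean_symbol_powr[OF a] by (auto simp: multiplier_def)
  \<comment> \<open>Since \<open>D < 2 ^ D\<close>, the bound \<open>C \<le> D\<close> makes the geometric series converge.\<close>
  obtain D :: nat where D: "max (max (real n) (a + s)) (max 1 C) \<le> real D"
    using real_arch_simple by blast
  then have D': "n \<le> D" "a + s \<le> real D" "D > 0" "C \<le> real D" by auto
  have "real D < 2 ^ D" by (rule of_nat_less_two_power)
  then have CD: "C < 2 ^ D" using D' by linarith
  have low: "multiplier (\<lambda>z. (1 / (1 + z)) ^ D * (spline_defect a D z * z powr (- of_real s)))"
  proof (rule multiplier_cong)
    show "multiplier (\<lambda>z. spline_defect a D z / z ^ D * (z powr of_real (real D - s) * (1 + z) powr (- of_real (real D))))"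
      by (intro multiplier_mult multiplier_spline_defect_divide_power[OF a D'(3) C CD] multiplier_powr_quotient)
         (use a s D' in auto)
    fix z assume z: "z \<in> Z"
    have "z powr of_real (real D - s) = z ^ D * z powr (- of_real s)"
      using powr_times_power[OF Z_nonzero[OF z], of D "- of_real s"] by simp
    moreover have "(1 + z) powr (- of_real (real D)) = (1 / (1 + z)) ^ D"
      using one_plus_nonzero[OF z] by (simp add: powr_minus_divide powr_nat' power_divide)
    ultimately show "(1 / (1 + z)) ^ D * (spline_defect a D z * z powr (- of_real s)) =
      spline_defect a D z / z ^ D * (z powr of_real (real D - s) * (1 + z) powr (- of_real (real D)))"
      using Z_nonzero[OF z] by simp
  qed
  have high: "multiplier (\<lambda>z. (z / (1 + z)) ^ D * (spline_defect a D z * z powr (- of_real s)))"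
  proof (rule multiplier_cong)
    show "multiplier (\<lambda>z. (1 - exp (- z)) powr of_real a * (z powr of_real (real D - a - s) * (1 + z) powr (- of_real (real D)))
       - taylor_powr a D (box_symbol z) * (z powr of_real (real D - s) * (1 + z) powr (- of_real (real D))))"
      by (intro multiplier_diff multiplier_mult multiplier_one_minus_exp_powr a multiplier_powr_quotient
          has_moments_multiplier[OF has_moments_taylor_powr[OF has_moments_box_symbol]])
         (use a s D' in auto)
    fix z assume z: "z \<in> Z"
    have 1: "z powr of_real (real D - s) = z ^ D * z powr (- of_real s)"
      using powr_times_power[OF Z_nonzero[OF z], of D "- of_real s"] by simp
    have 2: "z powr of_real (real D - a - s) = z ^ D * (z powr (- of_real a) * z powr (- of_real s))"
      using powr_times_power[OF Z_nonzero[OF z], of D "- of_real a - of_real s"] by (simp add: powr_diff powr_minus_divide algebra_simps)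
    have 3: "(1 + z) powr (- of_real (real D)) = 1 / (1 + z) ^ D"
      using one_plus_nonzero[OF z] by (simp add: powr_minus_divide powr_nat')
    show "(z / (1 + z)) ^ D * (spline_defect a D z * z powr (- of_real s)) =
      (1 - exp (- z)) powr of_real a * (z powr of_real (real D - a - s) * (1 + z) powr (- of_real (real D)))
       - taylor_powr a D (box_symbol z) * (z powr of_real (real D - s) * (1 + z) powr (- of_real (real D)))"
      unfolding 1 2 3 spline_defect_def spline_symbol_def by (simp add: power_divide left_diff_distrib right_diff_distrib diff_divide_distrib mult_ac)
  qed
  show ?thesis
    by (rule that[OF D'(1) multiplier_of_low_high[OF low high]])
qed

end

section \<open>The error symbol of a Gruenwald approximation\<close>

lemma power_series_bigo:
  fixes f :: "complex \<Rightarrow> complex"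
  assumes "\<forall>\<^sub>F z in nhds 0. (\<lambda>j. e j * z ^ (n + j)) sums f z"
  shows "f \<in> O[at 0 within A](\<lambda>z. z ^ n)"
proof -
  from assms obtain r where r: "r > 0" "\<And>z. norm z < r \<Longrightarrow> (\<lambda>j. e j * z ^ (n + j)) sums f z"
    unfolding eventually_nhds_metric by auto
  \<comment> \<open>The terms are bounded at \<open>z = r / 2\<close>, hence dominated by a geometric series for \<open>\<bar>z\<bar> < r / 4\<close>.\<close>
  have "(\<lambda>j. e j * of_real (r / 2) ^ (n + j)) \<longlonglongrightarrow> 0"
    using r(2)[of "of_real (r / 2)"] r(1) by (intro summable_LIMSEQ_zero) (auto simp: sums_iff)
  then have "Bseq (\<lambda>j. e j * of_real (r / 2) ^ (n + j))"
    by (intro convergent_imp_Bseq) (auto simp: convergent_def)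
  then obtain K where K: "K > 0" "\<And>j. norm (e j * of_real (r / 2) ^ (n + j)) \<le> K"
    by (auto elim: BseqE)
  show ?thesis
  proof (rule bigoI)
    show "\<forall>\<^sub>F z in at 0 within A. norm (f z) \<le> (K * 2 / (r / 2) ^ n) * norm (z ^ n)"
      unfolding eventually_at
    proof (intro exI[of _ "r / 4"] conjI ballI impI)
      fix z :: complex assume "z \<noteq> 0 \<and> dist z 0 < r / 4"
      then have z: "norm z < r / 4" by simp
      have le: "norm (e j * z ^ (n + j)) \<le> K / (r / 2) ^ n * norm z ^ n * (1 / 2) ^ j" for j
      proof -
        have "norm (e j * z ^ (n + j)) = norm (e j) * (r / 2) ^ (n + j) * (norm z / (r / 2)) ^ (n + j)"
          using r(1) by (simp add: norm_mult norm_power power_divide)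
        also have "\<dots> \<le> K * (norm z / (r / 2)) ^ (n + j)"
          using K(2)[of j] r(1) by (intro mult_right_mono) (auto simp: norm_mult norm_power norm_divide)
        also have "\<dots> = K / (r / 2) ^ n * norm z ^ n * (norm z / (r / 2)) ^ j"
          by (simp add: power_add power_divide)
        also have "\<dots> \<le> K / (r / 2) ^ n * norm z ^ n * (1 / 2) ^ j"
          using z r(1) K(1) by (intro mult_left_mono power_mono) (auto simp: field_simps)
        finally show ?thesis .
      qed
      have "norm (f z) = norm (\<Sum>j. e j * z ^ (n + j))"
        using r(2)[of z] z r(1) by (simp add: sums_iff)
      also have "\<dots> \<le> (\<Sum>j. K / (r / 2) ^ n * norm z ^ n * (1 / 2) ^ j)"
        by (intro norm_suminf_le le summable_mult summable_geometric) simp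
      also have "\<dots> = K / (r / 2) ^ n * norm z ^ n * 2"
        by (subst suminf_mult) (simp_all add: suminf_geometric)
      finally show "norm (f z) \<le> (K * 2 / (r / 2) ^ n) * norm (z ^ n)"
        by (simp add: norm_power mult_ac)
    qed (use r in simp)
  qed
qed

lemma omega_eq_spline_symbol:
  assumes "0 \<le> Re z" "z \<noteq> 0"
  shows "omega p a z = spline_symbol a z * exp (z * of_real p)"
  using assms spline_symbol_eq_powr[of z a] by (simp add: omega_def box_symbol_def)

lemma powr_scale: "c > 0 \<Longrightarrow> 0 \<le> Re z \<Longrightarrow> (of_real c * z) powr s = of_real c powr s * z powr (s :: complex)"
  by (rule powr_mult_halfplane) auto

context transform_domain
begin

text \<open>
  Each power \<open>box_symbol\<^sup>a\<close> in the symbol is split into its Taylor polynomial and the spline defect. The factor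
  \<open>exp (z P)\<close> is taken out, so that all remaining translations are to the right; on the half-line this forces
  \<open>P = 0\<close>. What the defects leave behind has moments, vanishes to order \<open>N + 1\<close>, and is divided by \<open>z\<^sup>N\<^sup>+\<^sup>\<beta>\<close>.
\<close>

theorem multiplier_grunwald_error:
  assumes a: "a > 0" and \<beta>: "0 < \<beta>" "\<beta> \<le> 1" and approx: "grunwald_approx a N b c p"
    and P: "\<And>j. j \<le> N \<Longrightarrow> c j * p j \<le> P" and P0: "0 \<le> P" and shift: "\<And>t. t \<in> S \<Longrightarrow> t - P \<in> S"
  shows "multiplier (\<lambda>z. ((\<Sum>j\<le>N. of_real (b j) * omega (p j) a (of_real (c j) * z)) - 1) * z powr (- of_real (real N + \<beta>)))"
proof -
  define s where "s = real N + \<beta>"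
  have s0: "0 \<le> s" using \<beta> by (simp add: s_def)
  from approx have c: "\<And>j. j \<le> N \<Longrightarrow> c j > 0" by (simp add: grunwald_approx_def)
  define W where "W = (\<lambda>z. (\<Sum>j\<le>N. of_real (b j) * omega (p j) a (of_real (c j) * z)) - 1)"
  \<comment> \<open>\<open>E j\<close> is the \<open>j\<close>-th shift once \<open>exp (z P)\<close> is taken out; it acts to the right by the choice of \<open>P\<close>.\<close>
  define E where "E = (\<lambda>j (z::complex). exp (- (z * of_real (P - c j * p j))))"
  obtain D where D: "N + 1 \<le> D" and mD: "multiplier (\<lambda>z. spline_defect a D z * z powr (- of_real s))"
    by (rule multiplier_spline_defect[OF a s0])
  define B where "B = (\<lambda>z. (\<Sum>j\<le>N. of_real (b j) * taylor_powr a D (box_symbol (of_real (c j) * z)) * E j z) - exp (- (z * of_real P)))"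
  define X where "X = (\<lambda>z. \<Sum>j\<le>N. of_real (b j) * spline_defect a D (of_real (c j) * z) * E j z)"
  \<comment> \<open>\<open>B\<close> is \<open>W\<close> with Taylor polynomials in place of the spline symbols, and \<open>X\<close> collects the spline defects.\<close>
  have split: "W z = exp (- (z * of_real (- P))) * (X z + B z)" if z: "z \<in> Z" for z
  proof -
    have e: "exp (- (z * of_real (- P))) * E j z = exp (of_real (c j) * z * of_real (p j))" for j
      by (simp add: E_def algebra_simps flip: exp_add)
    have "exp (- (z * of_real (- P))) * (X z + B z) =
       (\<Sum>j\<le>N. of_real (b j) * spline_symbol a (of_real (c j) * z) * (exp (- (z * of_real (- P))) * E j z))
         - exp (- (z * of_real (- P))) * exp (- (z * of_real P))"
      unfolding X_def B_def spline_defect_def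
      by (simp add: sum_distrib_left sum.distrib[symmetric] algebra_simps)
    also have "exp (- (z * of_real (- P))) * exp (- (z * of_real P)) = 1"
      by (simp flip: exp_add)
    also have "(\<Sum>j\<le>N. of_real (b j) * spline_symbol a (of_real (c j) * z) * (exp (- (z * of_real (- P))) * E j z)) =
       (\<Sum>j\<le>N. of_real (b j) * omega (p j) a (of_real (c j) * z))"
    proof (intro sum.cong refl)
      fix j assume "j \<in> {..N}"
      then have "of_real (c j) * z \<in> Z" using c Z_scale[OF z] by simp
      then have "omega (p j) a (of_real (c j) * z) = spline_symbol a (of_real (c j) * z) * exp (of_real (c j) * z * of_real (p j))"
        by (intro omega_eq_spline_symbol Z_Re Z_nonzero)
      then show "of_real (b j) * spline_symbol a (of_real (c j) * z) * (exp (- (z * of_real (- P))) * E j z) =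
          of_real (b j) * omega (p j) a (of_real (c j) * z)"
        by (simp only: e mult.assoc)
    qed
    finally show ?thesis by (simp add: W_def)
  qed
  have mE: "has_moments n (E j)" if "j \<le> N" for n j
    unfolding E_def using P[OF that] by (intro has_moments_exp) simp
  have mX: "multiplier (\<lambda>z. X z * z powr (- of_real s))"
  proof -
    have "multiplier (\<lambda>z. \<Sum>j\<le>N. of_real (b j) * (of_real (c j) powr of_real s *
       (spline_defect a D (of_real (c j) * z) * (of_real (c j) * z) powr (- of_real s))) * E j z)"
      by (intro multiplier_sum multiplier_mult multiplier_const multiplier_dilate[OF mD] c has_moments_multiplier[OF mE]) auto
    then show ?thesis
    proof (rule multiplier_cong)
      fix z assume z: "z \<in> Z"
      have "z powr (- of_real s) = of_real (c j) powr of_real s * (of_real (c j) * z) powr (- of_real s)" if "j \<le> N" for j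
        using c[OF that] by (simp add: powr_scale[OF c[OF that] Z_Re[OF z]] powr_minus_divide)
      then show "X z * z powr (- of_real s) = (\<Sum>j\<le>N. of_real (b j) * (of_real (c j) powr of_real s *
       (spline_defect a D (of_real (c j) * z) * (of_real (c j) * z) powr (- of_real s))) * E j z)"
        unfolding X_def sum_distrib_right by (intro sum.cong) (auto simp: mult_ac)
    qed
  qed
  have mB: "multiplier (\<lambda>z. B z * z powr (- of_real s))"
  proof -
    have hB: "has_moments (N + 1) B"
      unfolding B_def
      by (intro has_moments_diff has_moments_sum has_moments_mult has_moments_const has_moments_taylor_powr
          has_moments_dilate[OF has_moments_box_symbol] c mE has_moments_exp P0) auto
    have bound: "(\<lambda>z. exp (- (z * of_real q))) \<in> O[at 0 within Z](\<lambda>_. 1)" for q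
      by (rule bigoI_tendsto[where c = 1]) (auto intro!: tendsto_eq_intros)
    have "(\<lambda>z. of_real (b j) * spline_defect a D (of_real (c j) * z) * E j z) \<in> O[at 0 within Z](\<lambda>z. z ^ (N + 1))"
      if j: "j \<le> N" for j
    proof -
      have "(\<lambda>z. of_real (b j) * spline_defect a D (of_real (c j) * z) * E j z) \<in> O[at 0 within Z](\<lambda>z. 1 * z ^ D * 1)"
        unfolding E_def
        by (intro landau_o.big.mult bound bigo_dilate spline_defect_bigo a c j) simp
      also have "(\<lambda>z::complex. 1 * z ^ D * 1) \<in> O[at 0 within Z](\<lambda>z. z ^ (N + 1))"
        using bigo_power_mono[OF D] by simp
      finally show ?thesis .
    qed
    then have OX: "X \<in> O[at 0 within Z](\<lambda>z. z ^ (N + 1))"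
      unfolding X_def by (intro big_sum_in_bigo) auto
    \<comment> \<open>The order condition enters only here.\<close>
    have OW: "W \<in> O[at 0 within Z](\<lambda>z. z ^ (N + 1))"
    proof -
      from approx obtain d where "\<forall>\<^sub>F z in nhds 0. (\<lambda>j. d (N + 1 + j) * z ^ (N + 1 + j)) sums W z"
        by (auto simp: grunwald_approx_def W_def)
      then show ?thesis by (rule power_series_bigo)
    qed
    have "(\<lambda>z. exp (- (z * of_real P)) * W z - X z) \<in> O[at 0 within Z](\<lambda>z. z ^ (N + 1))"
      using landau_o.big.mult[OF bound[of P] OW] by (intro sum_in_bigo OX) simp
    moreover have "\<forall>\<^sub>F z in at 0 within Z. exp (- (z * of_real P)) * W z - X z = B z"
      using split by (simp add: eventually_at_filter mult.assoc[symmetric] flip: exp_add)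
    ultimately have OB: "B \<in> O[at 0 within Z](\<lambda>z. z ^ (N + 1))"
      using landau_o.big.in_cong by fastforce
    have "multiplier (\<lambda>z. ((1 + z) / z) ^ (N + 1) * B z * (z powr of_real (real (N + 1) - s) * (1 + z) powr (- of_real (real (N + 1)))))"
      by (intro multiplier_mult[OF multiplier_divide_zero[OF hB OB] multiplier_powr_quotient]) (use \<beta> s_def in auto)
    then show ?thesis
    proof (rule multiplier_cong)
      fix z assume z: "z \<in> Z"
      have 1: "z powr of_real (real (N + 1) - s) = z ^ (N + 1) * z powr (- of_real s)"
        using powr_times_power[OF Z_nonzero[OF z], of "N + 1" "- of_real s"] by simp
      have "(1 + z) powr (- of_real (real n)) = 1 / (1 + z) ^ n" for n
        using one_plus_nonzero[OF z] by (simp add: powr_minus_divide powr_nat')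
      from this[of "N + 1"] have 2: "(1 + z) powr (- of_real (real (N + 1))) = 1 / (1 + z) ^ (N + 1)" .
      show "B z * z powr (- of_real s) = ((1 + z) / z) ^ (N + 1) * B z * (z powr of_real (real (N + 1) - s) * (1 + z) powr (- of_real (real (N + 1))))"
        unfolding 1 2 using one_plus_nonzero[OF z] Z_nonzero[OF z] by (simp add: power_divide del: power_Suc)
    qed
  qed
  have "multiplier (\<lambda>z. exp (- (z * of_real (- P))) * (X z * z powr (- of_real s) + B z * z powr (- of_real s)))"
    by (intro multiplier_mult multiplier_translation multiplier_add mX mB) (use shift in auto)
  then have "multiplier (\<lambda>z. W z * z powr (- of_real s))"
    by (rule multiplier_cong) (simp add: split algebra_simps)
  then show ?thesis by (simp add: W_def s_def)
qed

end

section \<open>Error estimates for Gruenwald approximations\<close>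

context transform_domain
begin

text \<open>
  Approach \<open>0\<close> along the imaginary axis: the transform is continuous by dominated convergence, and \<open>z powr a\<close> tends to \<open>0\<close>.
\<close>

lemma transform_0_eq_0:
  assumes k: "k \<in> L" and f: "f \<in> L" and a: "a > 0"
    and eq: "\<And>z. z \<in> Z \<Longrightarrow> transform k z = z powr of_real a * transform f z"
  shows "transform k 0 = 0"
proof -
  define w where "w = (\<lambda>n. \<i> * of_real (1 / real (Suc n)))"
  have w0: "w \<longlonglongrightarrow> \<i> * of_real 0"
    unfolding w_def by (rule tendsto_mult[OF tendsto_const tendsto_of_real[OF LIMSEQ_Suc[OF lim_1_over_n]]])
  have wZ: "w n \<in> Z" for n unfolding w_def by (rule Z_imaginary) simp
  have "(\<lambda>n. transform k (w n)) \<longlonglongrightarrow> transform k 0"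
    unfolding transform_def
  proof (rule integral_dominated_convergence[where w = "\<lambda>t. norm (k t)"])
    show "AE t in lborel. (\<lambda>n. exp (- (w n * of_real t)) * k t) \<longlonglongrightarrow> exp (- (0 * of_real t)) * k t"
      using w0 by (intro always_eventually allI tendsto_intros) auto
    show "\<And>n. AE t in lborel. norm (exp (- (w n * of_real t)) * k t) \<le> norm (k t)"
      by (intro always_eventually allI norm_exp_mult_le[OF wZ L_zero[OF k]])
  qed (use L_integrable[OF k] L_measurable[OF k] in auto)
  moreover have "(\<lambda>n. transform k (w n)) \<longlonglongrightarrow> 0"
  proof (rule Lim_null_comparison)
    show "\<forall>\<^sub>F n in sequentially. norm (transform k (w n)) \<le> norm (w n powr of_real a) * (LINT t|lborel. norm (f t))"
      by (intro always_eventually allI)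
         (auto simp: eq[OF wZ] norm_mult intro!: mult_left_mono norm_transform_le[OF f wZ])
    have "(\<lambda>n. norm (w n powr of_real a)) \<longlonglongrightarrow> 0"
      by (rule tendsto_norm_zero[OF powr_of_real_tendsto_0[OF a]]) (use w0 in simp)
    from tendsto_mult_right[OF this, of "LINT t|lborel. norm (f t)"]
    show "(\<lambda>n. norm (w n powr of_real a) * (LINT t|lborel. norm (f t))) \<longlonglongrightarrow> 0"
      by (simp add: mult.commute)
  qed
  ultimately show ?thesis by (rule LIMSEQ_unique)
qed

lemma transform_injective:
  assumes k: "k \<in> L" and k': "k' \<in> L" and eq: "\<And>z. z \<in> Z \<Longrightarrow> transform k z = transform k' z" and eq0: "transform k 0 = transform k' 0"
  shows "AE x in lborel. k x = k' x"
proof -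
  have i: "integrable lborel (\<lambda>x. k x - k' x)" using k k' L_integrable by simp
  have "fourier (\<lambda>x. k x - k' x) y = 0" for y
  proof -
    have "fourier (\<lambda>x. k x - k' x) y = transform (\<lambda>x. k x - k' x) (- (\<i> * of_real y))"
      by (simp add: fourier_def transform_def)
    also have "\<dots> = 0"
    proof (cases "y = 0")
      case True
      then show ?thesis using eq0 k k' L_integrable by (simp add: transform_def)
    next
      case False
      then have "- (\<i> * of_real y) \<in> Z" using Z_imaginary[of "- y"] by simp
      then show ?thesis by (simp add: transform_diff[OF k k'] eq)
    qed
    finally show ?thesis .
  qed
  from fourier_injective[OF i this] show ?thesis by eventually_elim simp
qed

lemma grunwald_L:
  assumes a: "a > 0" and h: "h > 0" and f: "f \<in> L" and shift: "\<And>t. t \<in> S \<Longrightarrow> t - p * h \<in> S"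
  shows "grunwald a h p f \<in> L"
    and "z \<in> Z \<Longrightarrow> transform (grunwald a h p f) z = omega p a (of_real h * z) * (z powr of_real a * transform f z)"
proof -
  define g where "g = (\<lambda>m x. of_real (grunwald_coeff a m) * f (x - (real m - p) * h))"
  have gL: "g m \<in> L" for m
    unfolding g_def
  proof (rule L_cmult[OF L_translate[OF f]])
    fix t assume "t \<in> S"
    then have "t - p * h + real m * h \<in> S" using h by (intro S_add shift) auto
    then show "t + (real m - p) * h \<in> S" by (simp add: algebra_simps)
  qed
  have ng: "(LINT x|lborel. norm (g m x)) = \<bar>grunwald_coeff a m\<bar> * (LINT x|lborel. norm (f x))" for m
    by (simp add: g_def norm_mult integral_norm_translate)
  have sm: "summable (\<lambda>m. LINT x|lborel. norm (g m x))"
    unfolding ng by (intro summable_mult2 summable_abs_grunwald_coeff a)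
  note s = L_suminf[OF gL sm]
  have G: "grunwald a h p f = (\<lambda>x. of_real (1 / h powr a) * (\<Sum>m. g m x))"
    by (simp add: grunwald_def[abs_def] g_def scaleR_conv_of_real)
  show "grunwald a h p f \<in> L" unfolding G by (rule L_cmult[OF s(1)])
  assume z: "z \<in> Z"
  have hz: "of_real h * z \<in> Z" using z h by (rule Z_scale)
  have "transform (g m) z = of_real (grunwald_coeff a m) * exp (- (of_real h * z)) ^ m * (exp (of_real h * z * of_real p) * transform f z)" for m
  proof -
    have "exp (- (z * of_real ((real m - p) * h))) = exp (- (of_real h * z)) ^ m * exp (of_real h * z * of_real p)"
      by (simp add: algebra_simps flip: exp_of_nat_mult exp_add)
    then show ?thesis by (simp add: g_def transform_cmult transform_translate)
  qed
  moreover have "(\<lambda>m. of_real (grunwald_coeff a m) * exp (- (of_real h * z)) ^ m * (exp (of_real h * z * of_real p) * transform f z)) sums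
      ((1 - exp (- (of_real h * z))) powr of_real a * (exp (of_real h * z * of_real p) * transform f z))"
    using Z_Re[OF hz] by (intro sums_mult2 grunwald_coeff_sums a) simp
  ultimately have "transform (\<lambda>x. \<Sum>m. g m x) z = (1 - exp (- (of_real h * z))) powr of_real a * (exp (of_real h * z * of_real p) * transform f z)"
    using s(2)[OF z] sums_unique2 by force
  moreover have "(of_real h * z) powr (- of_real a) * z powr of_real a = of_real (1 / h powr a)"
    using h Z_nonzero[OF z] by (simp add: powr_scale[OF h Z_Re[OF z]] powr_minus_divide powr_of_real flip: powr_add)
  ultimately have "transform (grunwald a h p f) z =
      ((of_real h * z) powr (- of_real a) * z powr of_real a) *
      ((1 - exp (- (of_real h * z))) powr of_real a * (exp (of_real h * z * of_real p) * transform f z))"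
    unfolding G transform_cmult by simp
  then show "transform (grunwald a h p f) z = omega p a (of_real h * z) * (z powr of_real a * transform f z)"
    unfolding omega_eq_spline_symbol[OF Z_Re[OF hz] Z_nonzero[OF hz]] spline_symbol_def
    by (simp only: mult_ac)
qed

lemma grunwald_comb_L:
  assumes a: "a > 0" and h: "h > 0" and f: "f \<in> L" and c: "\<And>j. j \<le> N \<Longrightarrow> c j > 0"
    and shift: "\<And>t j s. t \<in> S \<Longrightarrow> j \<le> N \<Longrightarrow> s > 0 \<Longrightarrow> t - p j * s \<in> S"
  shows "grunwald_comb a N b c p h f \<in> L"
    and "z \<in> Z \<Longrightarrow> transform (grunwald_comb a N b c p h f) z =
       (\<Sum>j\<le>N. of_real (b j) * omega (p j) a (of_real (c j) * (of_real h * z))) * (z powr of_real a * transform f z)"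
proof -
  let ?G = "\<lambda>j. grunwald a (c j * h) (p j) f"
  have G: "?G j \<in> L" "z \<in> Z \<Longrightarrow> transform (?G j) z = omega (p j) a (of_real (c j) * (of_real h * z)) * (z powr of_real a * transform f z)"
    if "j \<le> N" for j z
    using grunwald_L[OF a _ f, of "c j * h" "p j"] shift[OF _ that, of _ "c j * h"] c[OF that] h
    by (auto simp: mult.assoc)
  have *: "(\<lambda>x. \<Sum>j\<in>A. b j *\<^sub>R ?G j x) \<in> L \<and> (\<forall>z\<in>Z. transform (\<lambda>x. \<Sum>j\<in>A. b j *\<^sub>R ?G j x) z =
      (\<Sum>j\<in>A. of_real (b j) * omega (p j) a (of_real (c j) * (of_real h * z))) * (z powr of_real a * transform f z))"
    if "finite A" "A \<subseteq> {..N}" for A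
    using that
  proof (induction A rule: finite_induct)
    case empty
    show ?case by (simp add: L_def transform_def)
  next
    case (insert j A)
    then have j: "j \<le> N" by simp
    have 1: "(\<lambda>x. of_real (b j) * ?G j x) \<in> L" by (rule L_cmult[OF G(1)[OF j]])
    have 2: "(\<lambda>x. \<Sum>j\<in>A. b j *\<^sub>R ?G j x) \<in> L" using insert by simp
    have eq: "(\<lambda>x. \<Sum>j\<in>insert j A. b j *\<^sub>R ?G j x) = (\<lambda>x. of_real (b j) * ?G j x + (\<Sum>j\<in>A. b j *\<^sub>R ?G j x))"
      using insert by (simp add: scaleR_conv_of_real)
    show ?case
      unfolding eq using L_add[OF 1 2] insert
      by (auto simp: transform_add[OF 1 2] transform_cmult G(2)[OF j] distrib_right)
  qed
  from *[of "{..N}"] show "grunwald_comb a N b c p h f \<in> L"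
    "z \<in> Z \<Longrightarrow> transform (grunwald_comb a N b c p h f) z =
       (\<Sum>j\<le>N. of_real (b j) * omega (p j) a (of_real (c j) * (of_real h * z))) * (z powr of_real a * transform f z)"
    by (auto simp: grunwald_comb_def[abs_def])
qed

text \<open>
  The derivative \<open>k\<close> of order \<open>a\<close> is constructed along with the estimate, as the Gruenwald combination minus
  \<open>h powr (N + \<beta>)\<close> times the image of \<open>g\<close> under the dilated error operator.
\<close>

theorem grunwald_comb_error:
  assumes a: "a > 0" and \<beta>: "0 < \<beta>" "\<beta> \<le> 1" and approx: "grunwald_approx a N b c p"
    and p: "(\<forall>j\<le>N. p j \<le> 0) \<or> S = UNIV"
  obtains C where "C > 0" and
    "\<And>f g h. f \<in> L \<Longrightarrow> g \<in> L \<Longrightarrow> (\<And>z. z \<in> Z \<Longrightarrow> transform g z = z powr of_real (a + real N + \<beta>) * transform f z) \<Longrightarrow> h > 0 \<Longrightarrow>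
      \<exists>k\<in>L. (\<forall>z\<in>Z. transform k z = z powr of_real a * transform f z) \<and>
        grunwald_comb a N b c p h f \<in> L \<and>
        (LINT x|lborel. norm (grunwald_comb a N b c p h f x - k x)) \<le> C * h powr (real N + \<beta>) * (LINT x|lborel. norm (g x))"
proof -
  define s where "s = real N + \<beta>"
  from approx have c: "\<And>j. j \<le> N \<Longrightarrow> c j > 0" by (simp add: grunwald_approx_def)
  define W where "W = (\<lambda>z. (\<Sum>j\<le>N. of_real (b j) * omega (p j) a (of_real (c j) * z)) - 1)"
  have shift: "t - p j * r \<in> S" if "t \<in> S" "j \<le> N" "r > 0" for t j r
  proof (cases "S = UNIV")
    case False
    then have "p j * r \<le> 0" using p that by (auto simp: mult_le_0_iff)
    then show ?thesis using S_add[OF that(1), of "- (p j * r)"] by simp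
  qed simp
  \<comment> \<open>A common upper bound of the shifts on the line, and \<open>0\<close> on the half-line.\<close>
  obtain P where P: "0 \<le> P" "\<And>j. j \<le> N \<Longrightarrow> c j * p j \<le> P" "\<And>t. t \<in> S \<Longrightarrow> t - P \<in> S"
  proof (cases "S = UNIV")
    case True
    have "c j * p j \<le> (\<Sum>j\<le>N. \<bar>c j * p j\<bar>)" if "j \<le> N" for j
      using member_le_sum[of j "{..N}" "\<lambda>j. \<bar>c j * p j\<bar>"] that by simp
    with True show ?thesis by (intro that[of "\<Sum>j\<le>N. \<bar>c j * p j\<bar>"]) (auto intro: sum_nonneg)
  next
    case False
    then show ?thesis using p c by (intro that[of 0]) (auto simp: mult_le_0_iff less_imp_le)
  qed
  have "multiplier (\<lambda>z. W z * z powr (- of_real s))"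
    unfolding W_def s_def using P by (intro multiplier_grunwald_error a \<beta> approx) auto
  then obtain C0 where "mult_bound (\<lambda>z. W z * z powr (- of_real s)) C0" by (auto simp: multiplier_def)
  then have C: "mult_bound (\<lambda>z. W z * z powr (- of_real s)) (max 1 C0)" (is "mult_bound _ ?C")
    by (rule mult_bound_mono) simp
  show ?thesis
  proof (rule that[of ?C])
    fix f g and h :: real assume f: "f \<in> L" and g: "g \<in> L" and h: "h > 0"
      and fg: "\<And>z. z \<in> Z \<Longrightarrow> transform g z = z powr of_real (a + real N + \<beta>) * transform f z"
    let ?A = "grunwald_comb a N b c p h f"
    have A: "?A \<in> L" "\<And>z. z \<in> Z \<Longrightarrow> transform ?A z = (W (of_real h * z) + 1) * (z powr of_real a * transform f z)"
      using grunwald_comb_L[OF a h f, where N = N and c = c and p = p and b = b] c shift by (auto simp: W_def)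
    from mult_bound_dilate[OF C h] g obtain e where e: "e \<in> L"
      "\<And>z. z \<in> Z \<Longrightarrow> transform e z = W (of_real h * z) * (of_real h * z) powr (- of_real s) * transform g z"
      "(LINT x|lborel. norm (e x)) \<le> ?C * (LINT x|lborel. norm (g x))"
      unfolding mult_bound_def by blast
    let ?e = "\<lambda>x. of_real (h powr s) * e x"
    let ?k = "\<lambda>x. ?A x - ?e x"
    have eL: "?e \<in> L" by (rule L_cmult[OF e(1)])
    have "transform ?k z = z powr of_real a * transform f z" if z: "z \<in> Z" for z
    proof -
      have "of_real (h powr s) * ((of_real h * z) powr (- of_real s) * z powr of_real (a + real N + \<beta>)) =
        (of_real (h powr s) * of_real h powr (- of_real s)) * (z powr (- of_real s) * z powr of_real (a + real N + \<beta>))"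
        by (simp add: powr_scale[OF h Z_Re[OF z]])
      also have "of_real (h powr s) * (of_real h :: complex) powr (- of_real s) = 1"
        using h by (simp add: powr_minus_divide powr_of_real)
      also have "z powr (- of_real s) * z powr of_real (a + real N + \<beta>) = z powr of_real a"
        by (simp add: s_def flip: powr_add)
      finally have eq: "of_real (h powr s) * ((of_real h * z) powr (- of_real s) * z powr of_real (a + real N + \<beta>)) = z powr of_real a"
        by simp
      have "transform ?e z = W (of_real h * z) * (of_real (h powr s) * ((of_real h * z) powr (- of_real s) * z powr of_real (a + real N + \<beta>))) * transform f z"
        unfolding transform_cmult e(2)[OF z] fg[OF z] by (simp only: mult_ac)
      then have "transform ?e z = W (of_real h * z) * (z powr of_real a * transform f z)"
        by (simp only: eq mult.assoc)
      then show ?thesis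
        unfolding transform_diff[OF A(1) eL z] A(2)[OF z] by (simp add: distrib_right)
    qed
    moreover have "(LINT x|lborel. norm (?A x - ?k x)) \<le> ?C * h powr (real N + \<beta>) * (LINT x|lborel. norm (g x))"
      using mult_left_mono[OF e(3), of "h powr s"] by (simp add: norm_mult s_def mult_ac)
    moreover have "?k \<in> L" by (rule L_diff[OF A(1) eL])
    ultimately show "\<exists>k\<in>L. (\<forall>z\<in>Z. transform k z = z powr of_real a * transform f z) \<and> ?A \<in> L \<and>
        (LINT x|lborel. norm (?A x - k x)) \<le> ?C * h powr (real N + \<beta>) * (LINT x|lborel. norm (g x))"
      using A(1) by blast
  qed simp
qed

end

section \<open>The real line and the half-line\<close>

interpretation line: transform_domain UNIV "{z. Re z = 0 \<and> z \<noteq> 0}"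
  by unfold_locales auto

interpretation half_line: transform_domain "{0..}" "{z. 0 \<le> Re z \<and> z \<noteq> 0}"
  by unfold_locales auto

lemma line_L_iff: "f \<in> line.L \<longleftrightarrow> f \<in> L1 UNIV"
  by (simp add: line.L_def L1_def set_integrable_def)

lemma fourier_eq_transform: "fourier f k = transform f (- (\<i> * of_real k))"
  by (simp add: fourier_def transform_def)

lemma is_frac_deriv_iff:
  "is_frac_deriv a f g \<longleftrightarrow> g \<in> line.L \<and> transform g 0 = 0 \<and>
     (\<forall>z\<in>{z. Re z = 0 \<and> z \<noteq> 0}. transform g z = z powr of_real a * transform f z)"
proof -
  have "(\<forall>k. fourier g k = (- \<i> * of_real k) powr of_real a * fourier f k) \<longleftrightarrow>
    (\<forall>z\<in>{z. Re z = 0}. transform g z = z powr of_real a * transform f z)" (is "?L \<longleftrightarrow> ?R")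
  proof
    assume ?L
    show ?R
    proof
      fix z :: complex assume "z \<in> {z. Re z = 0}"
      then have "z = - (\<i> * of_real (- Im z))" by (simp add: complex_eq_iff)
      with \<open>?L\<close>[unfolded fourier_eq_transform, rule_format, of "- Im z"]
      show "transform g z = z powr of_real a * transform f z" by simp
    qed
  qed (simp add: fourier_eq_transform)
  also have "\<dots> \<longleftrightarrow> transform g 0 = 0 \<and> (\<forall>z\<in>{z. Re z = 0 \<and> z \<noteq> 0}. transform g z = z powr of_real a * transform f z)"
    by (auto; metis)
  finally show ?thesis unfolding is_frac_deriv_def line_L_iff by blast
qed

lemma half_line_L_iff: "zero_ext f \<in> half_line.L \<longleftrightarrow> f \<in> L1 {0..}"
proof -
  have "zero_ext f = (\<lambda>x. indicator {0..} x *\<^sub>R f x)" by (auto simp: zero_ext_def indicator_def)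
  then show ?thesis by (simp add: half_line.L_def L1_def set_integrable_def)
qed

lemma zero_ext_L: "g \<in> half_line.L \<Longrightarrow> zero_ext g = g"
  by (auto simp: half_line.L_def zero_ext_def)

lemma laplace_eq_transform: "laplace f z = transform (zero_ext f) (- z)"
  unfolding laplace_def transform_def set_lebesgue_integral_def
  by (intro Bochner_Integration.integral_cong) (auto simp: zero_ext_def indicator_def)

lemma is_frac_deriv_half_iff:
  "is_frac_deriv_half a f g \<longleftrightarrow> zero_ext g \<in> half_line.L \<and> transform (zero_ext g) 0 = 0 \<and>
     (\<forall>z\<in>{z. 0 \<le> Re z \<and> z \<noteq> 0}. transform (zero_ext g) z = z powr of_real a * transform (zero_ext f) z)"
proof -
  have "(\<forall>z. Re z \<le> 0 \<longrightarrow> laplace g z = (- z) powr of_real a * laplace f z) \<longleftrightarrow>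
    (\<forall>z. 0 \<le> Re z \<longrightarrow> transform (zero_ext g) z = z powr of_real a * transform (zero_ext f) z)" (is "?L \<longleftrightarrow> ?R")
  proof
    assume ?L
    show ?R
    proof (intro allI impI)
      fix z :: complex assume "0 \<le> Re z"
      with \<open>?L\<close>[unfolded laplace_eq_transform, rule_format, of "- z"]
      show "transform (zero_ext g) z = z powr of_real a * transform (zero_ext f) z" by simp
    qed
  qed (simp add: laplace_eq_transform)
  also have "\<dots> \<longleftrightarrow> transform (zero_ext g) 0 = 0 \<and> (\<forall>z\<in>{z. 0 \<le> Re z \<and> z \<noteq> 0}. transform (zero_ext g) z = z powr of_real a * transform (zero_ext f) z)"
    by (auto; metis)
  finally show ?thesis unfolding is_frac_deriv_half_def half_line_L_iff by blast
qed

lemma L1_norm_eq_integral: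
  assumes "integrable lborel f" "\<And>x. x \<notin> S \<Longrightarrow> f x = 0"
  shows "L1_norm S f = ennreal (LINT x|lborel. norm (f x))"
proof -
  have "L1_norm S f = (\<integral>\<^sup>+x. ennreal (norm (f x)) \<partial>lborel)"
    unfolding L1_norm_def using assms(2) by (intro nn_integral_cong) (auto simp: indicator_def)
  also have "\<dots> = ennreal (LINT x|lborel. norm (f x))"
    using assms(1) by (intro nn_integral_eq_integral) auto
  finally show ?thesis .
qed

lemma L1_norm_cong_AE:
  assumes "AE x in lborel. x \<in> S \<longrightarrow> f x = g x"
  shows "L1_norm S f = L1_norm S g"
  unfolding L1_norm_def
  by (rule nn_integral_cong_AE) (use assms in \<open>eventually_elim, auto simp: indicator_def\<close>)

lemma line_error:
  assumes a: "a > 0" and \<beta>: "0 < \<beta>" "\<beta> \<le> 1" and approx: "grunwald_approx a N b c p"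
  obtains C where "C > 0"
    "\<And>f. f \<in> frac_space (a + real N + \<beta>) \<Longrightarrow> f \<in> frac_space a"
    "\<And>f h. f \<in> frac_space (a + real N + \<beta>) \<Longrightarrow> h > 0 \<Longrightarrow>
       L1_norm UNIV (\<lambda>x. grunwald_comb a N b c p h f x - frac_deriv a f x)
            \<le> ennreal (C * h powr (real N + \<beta>)) * frac_norm (a + real N + \<beta>) f"
proof -
  let ?\<gamma> = "a + real N + \<beta>"
  obtain C where C: "C > 0" and err: "\<And>f g h. f \<in> line.L \<Longrightarrow> g \<in> line.L \<Longrightarrow>
      (\<And>z. z \<in> {z. Re z = 0 \<and> z \<noteq> 0} \<Longrightarrow> transform g z = z powr of_real ?\<gamma> * transform f z) \<Longrightarrow> h > 0 \<Longrightarrow>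
      \<exists>k\<in>line.L. (\<forall>z\<in>{z. Re z = 0 \<and> z \<noteq> 0}. transform k z = z powr of_real a * transform f z) \<and>
        grunwald_comb a N b c p h f \<in> line.L \<and>
        (LINT x|lborel. norm (grunwald_comb a N b c p h f x - k x)) \<le> C * h powr (real N + \<beta>) * (LINT x|lborel. norm (g x))"
    by (rule line.grunwald_comb_error[OF a \<beta> approx]) blast+
  have key: "\<exists>k. is_frac_deriv a f k \<and> grunwald_comb a N b c p h f \<in> line.L \<and>
      (LINT x|lborel. norm (grunwald_comb a N b c p h f x - k x)) \<le> C * h powr (real N + \<beta>) * (LINT x|lborel. norm (frac_deriv ?\<gamma> f x))
      \<and> frac_deriv ?\<gamma> f \<in> line.L"
    if f: "f \<in> frac_space ?\<gamma>" and h: "h > 0" for f h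
  proof -
    have fL: "f \<in> line.L" using f by (simp add: frac_space_def line_L_iff)
    have "is_frac_deriv ?\<gamma> f (frac_deriv ?\<gamma> f)"
      using f someI_ex[of "is_frac_deriv ?\<gamma> f"] unfolding frac_space_def frac_deriv_def by blast
    then have g: "frac_deriv ?\<gamma> f \<in> line.L"
      "\<And>z. z \<in> {z. Re z = 0 \<and> z \<noteq> 0} \<Longrightarrow> transform (frac_deriv ?\<gamma> f) z = z powr of_real ?\<gamma> * transform f z"
      by (simp_all only: is_frac_deriv_iff)
    from err[OF fL g h] obtain k where k: "k \<in> line.L"
      "\<forall>z\<in>{z. Re z = 0 \<and> z \<noteq> 0}. transform k z = z powr of_real a * transform f z"
      "grunwald_comb a N b c p h f \<in> line.L"
      "(LINT x|lborel. norm (grunwald_comb a N b c p h f x - k x)) \<le> C * h powr (real N + \<beta>) * (LINT x|lborel. norm (frac_deriv ?\<gamma> f x))"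
      by blast
    moreover have "is_frac_deriv a f k"
      unfolding is_frac_deriv_iff using k line.transform_0_eq_0[OF k(1) fL a] by blast
    ultimately show ?thesis using g(1) by blast
  qed
  show ?thesis
  proof (rule that[OF C])
    fix f assume f: "f \<in> frac_space ?\<gamma>"
    show fa: "f \<in> frac_space a"
      using key[OF f, of 1] f by (auto simp: frac_space_def)
    fix h :: real assume h: "h > 0"
    from key[OF f h] obtain k where k: "is_frac_deriv a f k" "grunwald_comb a N b c p h f \<in> line.L"
      "(LINT x|lborel. norm (grunwald_comb a N b c p h f x - k x)) \<le> C * h powr (real N + \<beta>) * (LINT x|lborel. norm (frac_deriv ?\<gamma> f x))"
      "frac_deriv ?\<gamma> f \<in> line.L" by blast
    have k': "is_frac_deriv a f (frac_deriv a f)"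
      using k(1) unfolding frac_deriv_def by (rule someI[of "is_frac_deriv a f"])
    have kL: "k \<in> line.L" using k(1) by (simp add: is_frac_deriv_iff)
    have "AE x in lborel. frac_deriv a f x = k x"
      using k(1) k' by (intro line.transform_injective) (auto simp: is_frac_deriv_iff)
    then have "L1_norm UNIV (\<lambda>x. grunwald_comb a N b c p h f x - frac_deriv a f x) = L1_norm UNIV (\<lambda>x. grunwald_comb a N b c p h f x - k x)"
      by (intro L1_norm_cong_AE) auto
    also have "\<dots> = ennreal (LINT x|lborel. norm (grunwald_comb a N b c p h f x - k x))"
      using k(2) kL line.L_integrable by (intro L1_norm_eq_integral) auto
    also have "\<dots> \<le> ennreal (C * h powr (real N + \<beta>) * (LINT x|lborel. norm (frac_deriv ?\<gamma> f x)))"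
      by (rule ennreal_leI[OF k(3)])
    also have "\<dots> = ennreal (C * h powr (real N + \<beta>)) * ennreal (LINT x|lborel. norm (frac_deriv ?\<gamma> f x))"
      using C by (intro ennreal_mult) auto
    also have "ennreal (LINT x|lborel. norm (frac_deriv ?\<gamma> f x)) = frac_norm ?\<gamma> f"
      unfolding frac_norm_def using k(4) line.L_integrable by (intro L1_norm_eq_integral[symmetric]) auto
    finally show "L1_norm UNIV (\<lambda>x. grunwald_comb a N b c p h f x - frac_deriv a f x)
            \<le> ennreal (C * h powr (real N + \<beta>)) * frac_norm ?\<gamma> f" .
  qed
qed

lemma half_line_error:
  assumes a: "a > 0" and \<beta>: "0 < \<beta>" "\<beta> \<le> 1" and approx: "grunwald_approx a N b c p"
    and p: "\<forall>j\<le>N. p j \<le> 0"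
  obtains C where "C > 0"
    "\<And>f. f \<in> frac_space_half (a + real N + \<beta>) \<Longrightarrow> f \<in> frac_space_half a"
    "\<And>f h. f \<in> frac_space_half (a + real N + \<beta>) \<Longrightarrow> h > 0 \<Longrightarrow>
       L1_norm {0..} (\<lambda>x. grunwald_comb a N b c p h (zero_ext f) x - frac_deriv_half a f x)
            \<le> ennreal (C * h powr (real N + \<beta>)) * frac_norm_half (a + real N + \<beta>) f"
proof -
  let ?\<gamma> = "a + real N + \<beta>"
  let ?A = "\<lambda>h f. grunwald_comb a N b c p h (zero_ext f)"
  let ?Z = "{z. 0 \<le> Re z \<and> z \<noteq> 0}"
  obtain C where C: "C > 0" and err: "\<And>f g h. f \<in> half_line.L \<Longrightarrow> g \<in> half_line.L \<Longrightarrow>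
      (\<And>z. z \<in> ?Z \<Longrightarrow> transform g z = z powr of_real ?\<gamma> * transform f z) \<Longrightarrow> h > 0 \<Longrightarrow>
      \<exists>k\<in>half_line.L. (\<forall>z\<in>?Z. transform k z = z powr of_real a * transform f z) \<and>
        grunwald_comb a N b c p h f \<in> half_line.L \<and>
        (LINT x|lborel. norm (grunwald_comb a N b c p h f x - k x)) \<le> C * h powr (real N + \<beta>) * (LINT x|lborel. norm (g x))"
    by (rule half_line.grunwald_comb_error[OF a \<beta> approx]) (use p in blast)+
  have key: "\<exists>k. k \<in> half_line.L \<and> is_frac_deriv_half a f k \<and> ?A h f \<in> half_line.L \<and>
      (LINT x|lborel. norm (?A h f x - k x)) \<le> C * h powr (real N + \<beta>) * (LINT x|lborel. norm (zero_ext (frac_deriv_half ?\<gamma> f) x))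
      \<and> zero_ext (frac_deriv_half ?\<gamma> f) \<in> half_line.L"
    if f: "f \<in> frac_space_half ?\<gamma>" and h: "h > 0" for f h
  proof -
    have fL: "zero_ext f \<in> half_line.L" using f by (simp add: frac_space_half_def half_line_L_iff)
    have "is_frac_deriv_half ?\<gamma> f (frac_deriv_half ?\<gamma> f)"
      using f someI_ex[of "is_frac_deriv_half ?\<gamma> f"] unfolding frac_space_half_def frac_deriv_half_def by blast
    then have g: "zero_ext (frac_deriv_half ?\<gamma> f) \<in> half_line.L"
      "\<And>z. z \<in> ?Z \<Longrightarrow> transform (zero_ext (frac_deriv_half ?\<gamma> f)) z = z powr of_real ?\<gamma> * transform (zero_ext f) z"
      by (simp_all only: is_frac_deriv_half_iff)
    from err[OF fL g h] obtain k where k: "k \<in> half_line.L"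
      "\<forall>z\<in>?Z. transform k z = z powr of_real a * transform (zero_ext f) z"
      "?A h f \<in> half_line.L"
      "(LINT x|lborel. norm (?A h f x - k x)) \<le> C * h powr (real N + \<beta>) * (LINT x|lborel. norm (zero_ext (frac_deriv_half ?\<gamma> f) x))"
      by blast
    moreover have "is_frac_deriv_half a f k"
      unfolding is_frac_deriv_half_iff zero_ext_L[OF k(1)] using k half_line.transform_0_eq_0[OF k(1) fL a] by blast
    ultimately show ?thesis using g(1) by blast
  qed
  show ?thesis
  proof (rule that[OF C])
    fix f assume f: "f \<in> frac_space_half ?\<gamma>"
    show fa: "f \<in> frac_space_half a"
      using key[OF f, of 1] f by (auto simp: frac_space_half_def)
    fix h :: real assume h: "h > 0"
    from key[OF f h] obtain k where k: "k \<in> half_line.L" "is_frac_deriv_half a f k" "?A h f \<in> half_line.L"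
      "(LINT x|lborel. norm (?A h f x - k x)) \<le> C * h powr (real N + \<beta>) * (LINT x|lborel. norm (zero_ext (frac_deriv_half ?\<gamma> f) x))"
      "zero_ext (frac_deriv_half ?\<gamma> f) \<in> half_line.L" by blast
    have k': "is_frac_deriv_half a f (frac_deriv_half a f)"
      using k(2) unfolding frac_deriv_half_def by (rule someI[of "is_frac_deriv_half a f"])
    have "AE x in lborel. zero_ext (frac_deriv_half a f) x = k x"
      using k(2) k' by (intro half_line.transform_injective) (auto simp: is_frac_deriv_half_iff zero_ext_L[OF k(1)])
    then have "L1_norm {0..} (\<lambda>x. ?A h f x - frac_deriv_half a f x) = L1_norm {0..} (\<lambda>x. ?A h f x - k x)"
      by (intro L1_norm_cong_AE) (auto simp: zero_ext_def)
    also have "\<dots> = ennreal (LINT x|lborel. norm (?A h f x - k x))"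
      using half_line.L_diff[OF k(3) k(1)] by (intro L1_norm_eq_integral) (auto simp: half_line.L_def)
    also have "\<dots> \<le> ennreal (C * h powr (real N + \<beta>) * (LINT x|lborel. norm (zero_ext (frac_deriv_half ?\<gamma> f) x)))"
      by (rule ennreal_leI[OF k(4)])
    also have "\<dots> = ennreal (C * h powr (real N + \<beta>)) * ennreal (LINT x|lborel. norm (zero_ext (frac_deriv_half ?\<gamma> f) x))"
      using C by (intro ennreal_mult) auto
    also have "ennreal (LINT x|lborel. norm (zero_ext (frac_deriv_half ?\<gamma> f) x)) = L1_norm {0..} (zero_ext (frac_deriv_half ?\<gamma> f))"
      using k(5) by (intro L1_norm_eq_integral[symmetric]) (auto simp: half_line.L_def)
    also have "\<dots> = frac_norm_half ?\<gamma> f"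
      unfolding frac_norm_half_def by (rule L1_norm_cong_AE) (auto simp: zero_ext_def)
    finally show "L1_norm {0..} (\<lambda>x. ?A h f x - frac_deriv_half a f x)
            \<le> ennreal (C * h powr (real N + \<beta>)) * frac_norm_half ?\<gamma> f" .
  qed
qed

theorem corollary3p5:
  fixes \<alpha> \<beta> :: real and N :: nat and b c p :: "nat \<Rightarrow> real"
  assumes "\<alpha> > 0" and "0 < \<beta>" and "\<beta> \<le> 1"
    and "grunwald_approx \<alpha> N b c p"
  shows "\<exists>C>0.
    (\<forall>f \<in> frac_space (\<alpha> + real N + \<beta>).
       f \<in> frac_space \<alpha> \<and>
       (\<forall>\<^sub>F h in at_right 0.
          L1_norm UNIV (\<lambda>x. grunwald_comb \<alpha> N b c p h f x - frac_deriv \<alpha> f x)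
            \<le> ennreal (C * h powr (real N + \<beta>)) * frac_norm (\<alpha> + real N + \<beta>) f)) \<and>
    ((\<forall>j\<le>N. p j \<le> 0) \<longrightarrow>
       (\<forall>f \<in> frac_space_half (\<alpha> + real N + \<beta>).
          f \<in> frac_space_half \<alpha> \<and>
          (\<forall>\<^sub>F h in at_right 0.
             L1_norm {0..} (\<lambda>x. grunwald_comb \<alpha> N b c p h (zero_ext f) x - frac_deriv_half \<alpha> f x)
               \<le> ennreal (C * h powr (real N + \<beta>)) * frac_norm_half (\<alpha> + real N + \<beta>) f)))"
proof -
  let ?\<gamma> = "\<alpha> + real N + \<beta>"
  let ?line = "\<lambda>C. \<forall>f \<in> frac_space ?\<gamma>. f \<in> frac_space \<alpha> \<and> (\<forall>h>0.
     L1_norm UNIV (\<lambda>x. grunwald_comb \<alpha> N b c p h f x - frac_deriv \<alpha> f x)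
       \<le> ennreal (C * h powr (real N + \<beta>)) * frac_norm ?\<gamma> f)"
  let ?half = "\<lambda>C. \<forall>f \<in> frac_space_half ?\<gamma>. f \<in> frac_space_half \<alpha> \<and> (\<forall>h>0.
     L1_norm {0..} (\<lambda>x. grunwald_comb \<alpha> N b c p h (zero_ext f) x - frac_deriv_half \<alpha> f x)
       \<le> ennreal (C * h powr (real N + \<beta>)) * frac_norm_half ?\<gamma> f)"
  obtain C1 where C1: "C1 > 0" "?line C1"
    using line_error[OF assms] by metis
  obtain C2 where C2: "(\<forall>j\<le>N. p j \<le> 0) \<longrightarrow> ?half C2"
    using half_line_error[OF assms] by metis
  define C where "C = max C1 C2"
  have mono: "ennreal (D * h powr (real N + \<beta>)) * M \<le> ennreal (C * h powr (real N + \<beta>)) * M"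
    if "D \<le> C" for D h M
    using that by (intro mult_right_mono ennreal_leI) auto
  have pos: "\<forall>\<^sub>F h in at_right (0::real). h > 0"
    by (rule eventually_at_right_less)
  have "?line C" using C1(2) mono[of C1] unfolding C_def by (meson max.cobounded1 order_trans)
  moreover have "(\<forall>j\<le>N. p j \<le> 0) \<longrightarrow> ?half C" using C2 mono[of C2] unfolding C_def by (meson max.cobounded2 order_trans)
  moreover have "C > 0" using C1(1) by (simp add: C_def)
  ultimately show ?thesis
    by (intro exI[of _ C]) (auto intro!: eventually_mono[OF pos])
qed

end
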